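(* Let $f=(f_1,f_2,f_3):\mathbb{R}^3\to\mathbb{R}^3$ be a polynomial mapping, and let $I_1,I_2,I_3,I$, $\mathcal{A}=\mathbb{R}[x,y,z]/I$, $g$, $\Theta$, $\Psi$ be as defined in the context. Assume that $I_1=I_2=I_3=\mathbb{R}[x,y,z]$ and $\dim_{\mathbb{R}}\mathcal{A}<\infty$. Then $S_{1,1,1}(f)=V(I)$ is finite, and $$\sigma(\Theta)=\#\,S_{1,1,1}(f).$$ If the quadratic form $\Psi$ is non-degenerate, then all points in $S_{1,1,1}(f)$ are simple swallowtails and $$\sigma(\Psi)=\sum_{p\in S_{1,1,1}(f)} I(f,p).$$ If that is the case then $$\#\{p\in S_{1,1,1}(f)\ |\ I(f,p)=+1\}=(\sigma(\Theta)+\sigma(\Psi))/2,$$ $$\#\{p\in S_{1,1,1}(f)\ |\ I(f,p)=-1\}=(\sigma(\Theta)-\sigma(\Psi))/2.$$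
   Context: Let $J=\det[Df]$, and for $1\le i<j\le 3$ put $K_{ij}=\nabla f_i\times\nabla f_j$, $X_{ij}=\langle\nabla J,K_{ij}\rangle$, $Y_{ij}=\langle\nabla X_{ij},K_{ij}\rangle$, $Z_{ij}=\langle\nabla Y_{ij},K_{ij}\rangle$, $H_{ij}=(J,X_{ij},Y_{ij})$, $g_{ij}=Z_{ij}\cdot\det[DH_{ij}]$; $J,X_{ij},Y_{ij},Z_{ij},g_{ij}$ all lie in $\mathbb{R}[x,y,z]$. Ideals of $\mathbb{R}[x,y,z]$: $I_1$ is generated by $J,\partial J/\partial x,\partial J/\partial y,\partial J/\partial z$; $I_2$ is generated by $J$ and all $2\times2$ minors of the derivative matrix $Df$; $I_3$ is generated by $J,X_{12},X_{13},X_{23}$ and all $2\times2$ minors of the derivative matrix $D(J,X_{12},X_{13},X_{23})$; $I$ is generated by $J$, all $X_{ij}$ and all $Y_{ij}$. $V(I)\subset\mathbb{R}^3$ is the set of real zeros of $I$, and $\mathcal{A}=\mathbb{R}[x,y,z]/I$. Put $g=\sum\alpha_{ij}g_{ij}$, where the $\alpha_{ij}$ are fixed non-negative real numbers, at least one of them positive. When $\dim_{\mathbb{R}}\mathcal{A}<\infty$, for $u\in\mathbb{R}[x,y,z]$ let $t(u)$ be the trace of the linear endomorphism $\mathcal{A}\ni a\mapsto u\cdot a\in\mathcal{A}$ (this depends only on the class of $u$ in $\mathcal{A}$), and define quadratic forms on $\mathcal{A}$ by $\Theta(h)=t(h^2)$, $\Psi(h)=t(g\cdot h^2)$. $\sigma(\cdot)$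 denotes the signature of a quadratic form. Singular sets: $S_1(f)=\{p\in\mathbb{R}^3 : \operatorname{rank}Df(p)=2\}$; when $S_1(f)$ is a smooth surface (or empty), $S_{1,1}(f)=\{p\in S_1(f) : \operatorname{rank}D(f|S_1(f))(p)=1\}$; when $S_{1,1}(f)$ is a smooth curve (or empty), $S_{1,1,1}(f)=\{p\in S_{1,1}(f) : \operatorname{rank}D(f|S_{1,1}(f))(p)=0\}$. (Under the hypotheses $I_1=I_2=I_3=\mathbb{R}[x,y,z]$ these sets are defined.) Simple swallowtails and sign: if $\operatorname{rank}[Df(p_0)]=2$, choose a smooth vector field $K$ near $p_0$ with $K(p_0)\neq\mathbf{0}$ and $Df(p)K(p)=\mathbf{0}$ for all $p\in S_1(f)$ near $p_0$ (such $K$ exists), and put $X=\langle\nabla J,K\rangle$, $Y=\langle\nabla X,K\rangle$, $Z=\langle\nabla Y,K\rangle$, $H=(J,X,Y)$. The point $p_0$ is a simple swallowtail (point) if $\operatorname{rank}[Df(p_0)]=2$, $J(p_0)=X(p_0)=Y(p_0)=0$, and $\nabla J(p_0),\nabla X(p_0),\nabla Y(p_0)$ are linearly independent. In that case $Z(p_0)\neq0$ and its sign is $I(f,p_0)=\operatorname{sgn}(Z(p_0)\cdot\det[DH(p_0)])$. Neither notion depends on the choice of $K$. *)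

theory Defs
  imports "HOL-Analysis.Analysis" "HOL-Algebra.QuotRing" "Jordan_Normal_Form.Missing_VectorSpace"
begin

section \<open>The polynomial ring and its quotients\<close>

text \<open>
  Since the field of real numbers is infinite, the ring \<open>\<real>[x,y,z]\<close> is identified with the ring of
  polynomial functions on \<open>\<real>\<^sup>3\<close>; formal partial derivatives become analytic ones.
\<close>

definition poly3_ring :: "(real^3 \<Rightarrow> real) ring" where
  "poly3_ring = \<lparr>carrier = {u. real_polynomial_function u},
     mult = (\<lambda>u v p. u p * v p), one = (\<lambda>p. 1), zero = (\<lambda>p. 0), add = (\<lambda>u v p. u p + v p)\<rparr>"

definition real_ring :: "real ring" where
  "real_ring = \<lparr>carrier = UNIV, mult = (*), one = 1, zero = 0, add = (+)\<rparr>"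

definition quot_class :: "(real^3 \<Rightarrow> real) set \<Rightarrow> (real^3 \<Rightarrow> real) \<Rightarrow> (real^3 \<Rightarrow> real) set" where
  "quot_class I u = I +>\<^bsub>poly3_ring\<^esub> u"

text \<open>The quotient ring by \<open>I\<close>, extended to a real algebra by multiplication with the classes of
  constant polynomials.\<close>

definition quot_alg ::
  "(real^3 \<Rightarrow> real) set \<Rightarrow> (real, (real^3 \<Rightarrow> real) set) module" where
  "quot_alg I = ring.extend (poly3_ring Quot I)
     (module.fields (\<lambda>c a. quot_class I (\<lambda>p. c) \<otimes>\<^bsub>poly3_ring Quot I\<^esub> a))"

definition zero_set :: "(real^3 \<Rightarrow> real) set \<Rightarrow> (real^3) set" where
  "zero_set I = {p. \<forall>u\<in>I. u p = 0}"

section \<open>Traces and quadratic forms on real vector spaces\<close>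

text \<open>Trace with respect to an arbitrary finite basis; the \<open>THE\<close> term is the coordinate vector of
  \<open>L b\<close> in the basis \<open>B\<close>.\<close>

definition lin_trace :: "(real, 'v, 'm) module_scheme \<Rightarrow> ('v \<Rightarrow> 'v) \<Rightarrow> real" where
  "lin_trace V L =
     (let B = (SOME B. finite B \<and> vectorspace.basis real_ring V B)
      in \<Sum>b\<in>B. (THE c. c \<in> B \<rightarrow>\<^sub>E UNIV \<and> module.lincomb V c B = L b) b)"

text \<open>Maximal dimension of a subspace on which \<open>q\<close> is positive definite.\<close>

definition pos_index :: "(real, 'v, 'm) module_scheme \<Rightarrow> ('v \<Rightarrow> real) \<Rightarrow> nat" where
  "pos_index V q = Max {vectorspace.dim real_ring (V\<lparr>carrier := W\<rparr>) | W.
     VectorSpace.subspace real_ring W V \<and> (\<forall>w\<in>W - {\<zero>\<^bsub>V\<^esub>}. q w > 0)}"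

definition signature :: "(real, 'v, 'm) module_scheme \<Rightarrow> ('v \<Rightarrow> real) \<Rightarrow> int" where
  "signature V q = int (pos_index V q) - int (pos_index V (\<lambda>v. - q v))"

text \<open>The radical of the polar form of \<open>q\<close> is trivial.\<close>

definition nondegenerate :: "(real, 'v, 'm) module_scheme \<Rightarrow> ('v \<Rightarrow> real) \<Rightarrow> bool" where
  "nondegenerate V q \<longleftrightarrow>
     (\<forall>a\<in>carrier V. (\<forall>b\<in>carrier V. q (a \<oplus>\<^bsub>V\<^esub> b) - q a - q b = 0) \<longrightarrow> a = \<zero>\<^bsub>V\<^esub>)"

definition mult_trace :: "(real, 'v, 'm) module_scheme \<Rightarrow> 'v \<Rightarrow> real" where
  "mult_trace V c = lin_trace V (\<lambda>a. c \<otimes>\<^bsub>V\<^esub> a)"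

section \<open>The functions attached to a mapping and a vector field\<close>

definition partial_deriv :: "3 \<Rightarrow> (real^3 \<Rightarrow> real) \<Rightarrow> real^3 \<Rightarrow> real" where
  "partial_deriv k u p = frechet_derivative u (at p) (axis k 1)"

definition grad :: "(real^3 \<Rightarrow> real) \<Rightarrow> real^3 \<Rightarrow> real^3" where
  "grad u p = (\<chi> k. partial_deriv k u p)"

definition comp_fun :: "(real^3 \<Rightarrow> real^3) \<Rightarrow> 3 \<Rightarrow> real^3 \<Rightarrow> real" where
  "comp_fun f i p = f p $ i"

definition jac_det :: "(real^3 \<Rightarrow> real^3) \<Rightarrow> real^3 \<Rightarrow> real" where
  "jac_det f p = det (jacobian f (at p))"

definition X_fun :: "(real^3 \<Rightarrow> real^3) \<Rightarrow> (real^3 \<Rightarrow> real^3) \<Rightarrow> real^3 \<Rightarrow> real" where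
  "X_fun f K p = grad (jac_det f) p \<bullet> K p"

definition Y_fun :: "(real^3 \<Rightarrow> real^3) \<Rightarrow> (real^3 \<Rightarrow> real^3) \<Rightarrow> real^3 \<Rightarrow> real" where
  "Y_fun f K p = grad (X_fun f K) p \<bullet> K p"

definition Z_fun :: "(real^3 \<Rightarrow> real^3) \<Rightarrow> (real^3 \<Rightarrow> real^3) \<Rightarrow> real^3 \<Rightarrow> real" where
  "Z_fun f K p = grad (Y_fun f K) p \<bullet> K p"

definition H_map :: "(real^3 \<Rightarrow> real^3) \<Rightarrow> (real^3 \<Rightarrow> real^3) \<Rightarrow> real^3 \<Rightarrow> real^3" where
  "H_map f K p = vector [jac_det f p, X_fun f K p, Y_fun f K p]"

definition g_fun :: "(real^3 \<Rightarrow> real^3) \<Rightarrow> (real^3 \<Rightarrow> real^3) \<Rightarrow> real^3 \<Rightarrow> real" where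
  "g_fun f K p = Z_fun f K p * det (jacobian (H_map f K) (at p))"

definition K_field :: "(real^3 \<Rightarrow> real^3) \<Rightarrow> 3 \<Rightarrow> 3 \<Rightarrow> real^3 \<Rightarrow> real^3" where
  "K_field f i j p = cross3 (grad (comp_fun f i) p) (grad (comp_fun f j) p)"

text \<open>The pairs \<open>1 \<le> i < j \<le> 3\<close>; they are listed because \<open>3 = 0\<close> in the index type \<open>3\<close>.\<close>

definition index_pairs :: "(3 \<times> 3) set" where
  "index_pairs = {(1,2), (1,3), (2,3)}"

definition g_sum :: "(3 \<Rightarrow> 3 \<Rightarrow> real) \<Rightarrow> (real^3 \<Rightarrow> real^3) \<Rightarrow> real^3 \<Rightarrow> real" where
  "g_sum \<alpha> f p = (\<Sum>(i,j)\<in>index_pairs. \<alpha> i j * g_fun f (K_field f i j) p)"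

section \<open>The ideals\<close>

text \<open>The \<open>2 \<times> 2\<close> minors of the matrix whose rows are the gradients of the listed functions.\<close>

definition minors2 :: "(real^3 \<Rightarrow> real) list \<Rightarrow> (real^3 \<Rightarrow> real) set" where
  "minors2 us = {\<lambda>p. partial_deriv k (us ! r) p * partial_deriv l (us ! s) p
                   - partial_deriv l (us ! r) p * partial_deriv k (us ! s) p | r s k l.
                 r < s \<and> s < length us \<and> (k, l) \<in> index_pairs}"

definition ideal1 :: "(real^3 \<Rightarrow> real^3) \<Rightarrow> (real^3 \<Rightarrow> real) set" where
  "ideal1 f = Idl\<^bsub>poly3_ring\<^esub> ({jac_det f} \<union> {partial_deriv k (jac_det f) | k. True})"

definition ideal2 :: "(real^3 \<Rightarrow> real^3) \<Rightarrow> (real^3 \<Rightarrow> real) set" where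
  "ideal2 f = Idl\<^bsub>poly3_ring\<^esub> ({jac_det f} \<union> minors2 [comp_fun f 1, comp_fun f 2, comp_fun f 3])"

definition ideal3 :: "(real^3 \<Rightarrow> real^3) \<Rightarrow> (real^3 \<Rightarrow> real) set" where
  "ideal3 f =
     (let X12 = X_fun f (K_field f 1 2); X13 = X_fun f (K_field f 1 3);
          X23 = X_fun f (K_field f 2 3)
      in Idl\<^bsub>poly3_ring\<^esub> ({jac_det f, X12, X13, X23} \<union> minors2 [jac_det f, X12, X13, X23]))"

definition idealI :: "(real^3 \<Rightarrow> real^3) \<Rightarrow> (real^3 \<Rightarrow> real) set" where
  "idealI f = Idl\<^bsub>poly3_ring\<^esub>
     ({jac_det f} \<union> {X_fun f (K_field f i j) | i j. (i, j) \<in> index_pairs}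
                  \<union> {Y_fun f (K_field f i j) | i j. (i, j) \<in> index_pairs})"

definition algA :: "(real^3 \<Rightarrow> real^3) \<Rightarrow> (real, (real^3 \<Rightarrow> real) set) module" where
  "algA f = quot_alg (idealI f)"

definition Theta :: "(real^3 \<Rightarrow> real^3) \<Rightarrow> (real^3 \<Rightarrow> real) set \<Rightarrow> real" where
  "Theta f h = mult_trace (algA f) (h \<otimes>\<^bsub>algA f\<^esub> h)"

definition Psi ::
  "(3 \<Rightarrow> 3 \<Rightarrow> real) \<Rightarrow> (real^3 \<Rightarrow> real^3) \<Rightarrow> (real^3 \<Rightarrow> real) set \<Rightarrow> real" where
  "Psi \<alpha> f h = mult_trace (algA f)
     (quot_class (idealI f) (g_sum \<alpha> f) \<otimes>\<^bsub>algA f\<^esub> (h \<otimes>\<^bsub>algA f\<^esub> h))"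

section \<open>Smoothness and singular sets\<close>

primrec Ck_on :: "nat \<Rightarrow> ('a::real_normed_vector \<Rightarrow> 'b::real_normed_vector) \<Rightarrow> 'a set \<Rightarrow> bool" where
  "Ck_on 0 f U \<longleftrightarrow> continuous_on U f"
| "Ck_on (Suc k) f U \<longleftrightarrow> (\<forall>x\<in>U. f differentiable (at x)) \<and>
     (\<forall>v. Ck_on k (\<lambda>x. frechet_derivative f (at x) v) U)"

text \<open>\<open>C\<^sup>\<infinity>\<close>, intended for open sets \<open>U\<close>.\<close>

definition smooth_on :: "('a::real_normed_vector \<Rightarrow> 'b::real_normed_vector) \<Rightarrow> 'a set \<Rightarrow> bool" where
  "smooth_on f U \<longleftrightarrow> (\<forall>k. Ck_on k f U)"

text \<open>Velocities at \<open>p\<close> of smooth curves in \<open>S\<close>; this is the tangent space at \<open>p\<close> if \<open>S\<close> is a smooth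
  submanifold containing \<open>p\<close>.\<close>

definition tangent_space :: "(real^3) set \<Rightarrow> real^3 \<Rightarrow> (real^3) set" where
  "tangent_space S p = {v. \<exists>\<gamma> e. 0 < e \<and> smooth_on \<gamma> {-e<..<e} \<and> \<gamma> ` {-e<..<e} \<subseteq> S \<and>
     \<gamma> 0 = p \<and> (\<gamma> has_vector_derivative v) (at (0::real))}"

text \<open>The rank at \<open>p\<close> of the derivative of the restriction of \<open>f\<close> to the submanifold \<open>S\<close>.\<close>

definition rank_restr :: "(real^3 \<Rightarrow> real^3) \<Rightarrow> (real^3) set \<Rightarrow> real^3 \<Rightarrow> nat" where
  "rank_restr f S p = dim ((*v) (jacobian f (at p)) ` tangent_space S p)"

definition S1 :: "(real^3 \<Rightarrow> real^3) \<Rightarrow> (real^3) set" where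
  "S1 f = {p. rank (jacobian f (at p)) = 2}"

text \<open>The next two sets are meaningful only if \<open>S1 f\<close> is a smooth surface or empty and,
  respectively, \<open>S11 f\<close> is a smooth curve or empty.\<close>

definition S11 :: "(real^3 \<Rightarrow> real^3) \<Rightarrow> (real^3) set" where
  "S11 f = {p \<in> S1 f. rank_restr f (S1 f) p = 1}"

definition S111 :: "(real^3 \<Rightarrow> real^3) \<Rightarrow> (real^3) set" where
  "S111 f = {p \<in> S11 f. rank_restr f (S11 f) p = 0}"

section \<open>Simple swallowtails\<close>

definition kernel_field :: "(real^3 \<Rightarrow> real^3) \<Rightarrow> real^3 \<Rightarrow> (real^3 \<Rightarrow> real^3) \<Rightarrow> bool" where
  "kernel_field f p0 K \<longleftrightarrow> K p0 \<noteq> 0 \<and>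
     (\<exists>U. open U \<and> p0 \<in> U \<and> smooth_on K U \<and> (\<forall>p\<in>U \<inter> S1 f. jacobian f (at p) *v K p = 0))"

text \<open>An arbitrary choice of kernel field; being a simple swallowtail and its sign do not depend
  on the choice.\<close>

definition some_kernel_field :: "(real^3 \<Rightarrow> real^3) \<Rightarrow> real^3 \<Rightarrow> real^3 \<Rightarrow> real^3" where
  "some_kernel_field f p0 = (SOME K. kernel_field f p0 K)"

definition simple_swallowtail :: "(real^3 \<Rightarrow> real^3) \<Rightarrow> real^3 \<Rightarrow> bool" where
  "simple_swallowtail f p0 \<longleftrightarrow>
     (let K = some_kernel_field f p0 in
        rank (jacobian f (at p0)) = 2 \<and>
        jac_det f p0 = 0 \<and> X_fun f K p0 = 0 \<and> Y_fun f K p0 = 0 \<and>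
        (\<forall>a b c. a *\<^sub>R grad (jac_det f) p0 + b *\<^sub>R grad (X_fun f K) p0
                 + c *\<^sub>R grad (Y_fun f K) p0 = 0 \<longrightarrow> a = 0 \<and> b = 0 \<and> c = 0))"

definition swallowtail_sign :: "(real^3 \<Rightarrow> real^3) \<Rightarrow> real^3 \<Rightarrow> real" where
  "swallowtail_sign f p0 =
     (let K = some_kernel_field f p0
      in sgn (Z_fun f K p0 * det (jacobian (H_map f K) (at p0))))"

end

theory Submission
  imports Defs "HOL-Computational_Algebra.Fundamental_Theorem_Algebra"
begin

text \<open>
  The proof has an algebraic and a geometric half, which meet in the set \<open>V(I)\<close> of real zeros of \<open>I\<close>.

  Algebra: for every polynomial \<open>g\<close> the quadratic form \<open>h \<mapsto> t(g h\<^sup>2)\<close> on \<open>\<A> = \<real>[x,y,z]/I\<close> has signature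
  \<open>\<Sum>p\<in>V(I). sgn (g p)\<close>, and \<open>g\<close> has no zero on \<open>V(I)\<close> if the form is non-degenerate
  (\<open>signature_trace_form\<close>). The multiplications by the elements of \<open>\<A>\<close> commute, hence they have a
  common complex eigenvector. Splitting off one eigenvector after the other shows that the trace
  is a sum of characters, that is, of unital real algebra homomorphisms \<open>\<phi> : \<real>[x,y,z] \<rightarrow> \<complex>\<close> which vanish
  on \<open>I\<close> (\<open>rep_characters\<close>). The real-valued ones are precisely the evaluations at the points of \<open>V(I)\<close>;
  the remaining ones can be replaced by their conjugates, since the trace is real. Therefore \<open>t(g h\<^sup>2)\<close> is a
  sum, with positive weights, of terms \<open>g(p) h(p)\<^sup>2\<close> for \<open>p \<in> V(I)\<close> and of terms \<open>Re (\<phi>(g) \<phi>(h)\<^sup>2)\<close> for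
  non-real \<open>\<phi>\<close>. With \<open>s\<^sup>2 = \<phi>(g)\<close> the latter equals \<open>(Re (s \<phi>(h)))\<^sup>2 - (Im (s \<phi>(h)))\<^sup>2\<close> and contributes one
  plus and one minus, or nothing if \<open>\<phi>(g) = 0\<close>. Pairwise non-conjugate characters can be prescribed
  independently of each other (\<open>char_dual\<close>), so this is a genuine diagonalisation and the signature
  can be read off. The weight \<open>1\<close> gives \<open>\<Theta>\<close>, the weight \<open>\<Sum>\<alpha>\<^sub>i\<^sub>j g\<^sub>i\<^sub>j\<close> gives \<open>\<Psi>\<close>.

  Geometry: on \<open>S\<^sub>1 = {J = 0}\<close> every \<open>K\<^sub>i\<^sub>j\<close> lies in the line \<open>ker Df\<close>, and at each point some \<open>K\<^sub>i\<^sub>j\<close> spans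
  it. The inverse function theorem yields enough smooth curves in \<open>{J = 0}\<close> and \<open>{J = X\<^sub>i\<^sub>j = 0}\<close>
  (\<open>curve_in_surface\<close>, \<open>curve_in_intersection\<close>) to see that the velocities of curves in \<open>S\<^sub>1\<close> and \<open>S\<^sub>1\<^sub>,\<^sub>1\<close> span
  the orthogonal complements of \<open>\<nabla>J\<close> and of \<open>\<nabla>J, \<nabla>X\<^sub>i\<^sub>j\<close>. The rank of \<open>f\<close> restricted to these sets drops exactly
  when \<open>ker Df\<close> is tangent, that is, when \<open>X\<^sub>i\<^sub>j = 0\<close> and then \<open>Y\<^sub>i\<^sub>j = 0\<close>; so \<open>S\<^sub>1\<^sub>,\<^sub>1\<^sub>,\<^sub>1 = V(I)\<close>.
  Two kernel fields differ on \<open>S\<^sub>1\<close> by a smooth factor \<open>\<lambda>\<close>. Passing from one to the other multiplies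
  \<open>X, Y, Z\<close> by \<open>\<lambda>, \<lambda>\<^sup>2, \<lambda>\<^sup>3\<close> and the determinant of \<open>(\<nabla>J, \<nabla>X, \<nabla>Y)\<close> by \<open>\<lambda>\<^sup>3\<close>, up to terms that vanish at the points
  in question (\<open>kernel_field_change\<close>), so the product of \<open>Z\<close> and the determinant is multiplied by
  \<open>\<lambda>\<^sup>6 \<ge> 0\<close>. Hence at a point of \<open>V(I)\<close> all non-zero \<open>g\<^sub>i\<^sub>j\<close> have the sign \<open>I(f,p)\<close>, and so has their
  combination with non-negative coefficients whenever it does not vanish.
\<close>

section \<open>Linear systems and common eigenvectors\<close>

text \<open>
  Gaussian elimination on the equations: solve one equation for one unknown and substitute.
\<close>

lemma underdetermined_system:
  fixes a :: "'k \<Rightarrow> 'b \<Rightarrow> 'f::field"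
  assumes "finite B" "finite K" "card B < card K"
  shows "\<exists>c. (\<exists>k\<in>K. c k \<noteq> 0) \<and> (\<forall>b\<in>B. (\<Sum>k\<in>K. c k * a k b) = 0)"
  using assms
proof (induction B arbitrary: K a rule: finite_induct)
  case empty
  then obtain k where "k \<in> K" by (metis card.empty less_irrefl ex_in_conv)
  then show ?case by (intro exI[of _ "\<lambda>_. 1"]) auto
next
  case (insert b B)
  show ?case
  proof (cases "\<forall>k\<in>K. a k b = 0")
    case True
    from insert.IH[OF insert.prems(1), of a] insert show ?thesis
      using True by auto
  next
    case False
    then obtain k0 where k0: "k0 \<in> K" "a k0 b \<noteq> 0" by blast
    \<comment> \<open>the system after eliminating the unknown \<open>k0\<close> with the help of equation \<open>b\<close>\<close>
    define a' where "a' k \<beta> = a k \<beta> - a k b / a k0 b * a k0 \<beta>" for k \<beta>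
    have "card B < card (K - {k0})" using insert k0 by simp
    from insert.IH[OF _ this, of a'] insert.prems obtain c k1 where
      c: "k1 \<in> K - {k0}" "c k1 \<noteq> 0" "\<And>\<beta>. \<beta> \<in> B \<Longrightarrow> (\<Sum>k\<in>K-{k0}. c k * a' k \<beta>) = 0"
      by auto
    define s where "s = (\<Sum>k\<in>K-{k0}. c k * a k b) / a k0 b"
    define c' where "c' k = (if k = k0 then - s else c k)" for k
    have split: "(\<Sum>k\<in>K. c' k * a k \<beta>) = - s * a k0 \<beta> + (\<Sum>k\<in>K-{k0}. c k * a k \<beta>)" for \<beta>
    proof -
      have "(\<Sum>k\<in>K. c' k * a k \<beta>) = c' k0 * a k0 \<beta> + (\<Sum>k\<in>K-{k0}. c' k * a k \<beta>)"
        by (rule sum.remove) (use insert.prems k0 in auto)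
      also have "(\<Sum>k\<in>K-{k0}. c' k * a k \<beta>) = (\<Sum>k\<in>K-{k0}. c k * a k \<beta>)"
        by (rule sum.cong) (auto simp: c'_def)
      finally show ?thesis by (simp add: c'_def)
    qed
    have "(\<Sum>k\<in>K. c' k * a k \<beta>) = 0" if "\<beta> \<in> insert b B" for \<beta>
    proof (cases "\<beta> = b")
      case True
      then show ?thesis using k0 by (simp add: split s_def)
    next
      case False
      with that have "(\<Sum>k\<in>K-{k0}. c k * a' k \<beta>) = 0" using c by auto
      moreover have "(\<Sum>k\<in>K-{k0}. c k * a' k \<beta>) = (\<Sum>k\<in>K-{k0}. c k * a k \<beta>) - s * a k0 \<beta>"
        by (simp add: a'_def s_def algebra_simps sum_subtractf sum_distrib_left sum_divide_distrib)
      ultimately show ?thesis by (simp add: split)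
    qed
    moreover have "c' k1 \<noteq> 0" "k1 \<in> K" using c by (auto simp: c'_def)
    ultimately show ?thesis by blast
  qed
qed

text \<open>
  Vectors are functions of which only the values on the finite index set \<open>B\<close> matter, and matrices
  likewise. In this way a row and a column can be deleted by shrinking \<open>B\<close>.
\<close>

definition mat_vec :: "'b set \<Rightarrow> ('b \<Rightarrow> 'b \<Rightarrow> complex) \<Rightarrow> ('b \<Rightarrow> complex) \<Rightarrow> 'b \<Rightarrow> complex" where
  "mat_vec B M v i = (\<Sum>j\<in>B. M i j * v j)"

lemma mat_vec_lincomb:
  "mat_vec B M (\<lambda>i. \<Sum>k\<in>K. c k * x k i) i = (\<Sum>k\<in>K. c k * mat_vec B M (x k) i)"
proof -
  have "mat_vec B M (\<lambda>i. \<Sum>k\<in>K. c k * x k i) i = (\<Sum>j\<in>B. \<Sum>k\<in>K. c k * (M i j * x k j))"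
    by (simp add: mat_vec_def sum_distrib_left mult_ac)
  also have "\<dots> = (\<Sum>k\<in>K. \<Sum>j\<in>B. c k * (M i j * x k j))" by (rule sum.swap)
  finally show ?thesis by (simp add: mat_vec_def sum_distrib_left)
qed

text \<open>
  Among the nonzero polynomials \<open>p\<close> with \<open>p(M) v = 0\<close> take one of least degree. If \<open>ev\<close> is a root,
  \<open>p = (X - ev) q\<close>, then \<open>q(M) v\<close> is nonzero by minimality and is annihilated by \<open>M - ev\<close>. That the
  eigenvector is a combination of the \<open>M\<^sup>k v\<close> keeps it inside every \<open>M\<close>-invariant subspace that
  contains \<open>v\<close>; this is what makes common eigenvectors possible.
\<close>

lemma eigenvector_in_orbit:
  fixes M :: "'b \<Rightarrow> 'b \<Rightarrow> complex"
  assumes "finite B" and v: "\<exists>i\<in>B. v i \<noteq> 0"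
  obtains c n ev where "\<exists>i\<in>B. (\<Sum>k\<le>n. c k * (mat_vec B M ^^ k) v i) \<noteq> 0"
    "\<And>i. i \<in> B \<Longrightarrow> mat_vec B M (\<lambda>i. \<Sum>k\<le>n. c k * (mat_vec B M ^^ k) v i) i
       = ev * (\<Sum>k\<le>n. c k * (mat_vec B M ^^ k) v i)"
proof -
  define n where "n = card B"
  define x where "x k = (mat_vec B M ^^ k) v" for k
  define S where "S p i = (\<Sum>k\<le>n. coeff p k * x k i)" for p i
  define Q where "Q p \<longleftrightarrow> p \<noteq> 0 \<and> degree p \<le> n \<and> (\<forall>i\<in>B. S p i = 0)" for p
  have "\<exists>p. Q p"
  proof -
    obtain c k where c: "k \<le> n" "c k \<noteq> 0" "\<And>b. b \<in> B \<Longrightarrow> (\<Sum>k\<le>n. c k * x k b) = 0"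
      using underdetermined_system[OF assms(1), of "{..n}" x] by (auto simp: n_def)
    define p where "p = (\<Sum>k\<le>n. monom (c k) k)"
    have cf: "coeff p k = (if k \<le> n then c k else 0)" for k
      by (auto simp: p_def coeff_sum)
    have "p \<noteq> 0" using c cf[of k] by auto
    moreover have "degree p \<le> n" by (rule degree_le) (simp add: cf)
    ultimately show ?thesis using c(3) by (auto simp: Q_def S_def cf intro!: exI[of _ p])
  qed
  then obtain p where p: "Q p" "\<And>q. Q q \<Longrightarrow> degree p \<le> degree q"
    using ex_has_least_nat[of Q _ degree] by blast
  have deg: "degree p \<noteq> 0"
  proof
    assume "degree p = 0"
    then obtain a where a: "p = [:a:]" by (rule degree_eq_zeroE)
    have "S p i = a * v i" for i
    proof -
      have "S p i = (\<Sum>k\<in>{0}. coeff p k * x k i)"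
        unfolding S_def by (rule sum.mono_neutral_right) (auto simp: a coeff_pCons split: nat.splits)
      then show ?thesis by (simp add: a x_def)
    qed
    with v p(1) a show False by (auto simp: Q_def)
  qed
  then obtain ev where "poly p ev = 0"
    using fundamental_theorem_of_algebra[of p] constant_degree[of p] by auto
  then obtain q where q: "p = [:-ev, 1:] * q" by (auto simp: poly_eq_0_iff_dvd)
  have q0: "q \<noteq> 0" using p(1) q by (auto simp: Q_def)
  have dq: "degree p = Suc (degree q)"
    unfolding q using q0 by (subst degree_mult_eq) auto
  have dqn: "degree q < n" using dq p(1) by (auto simp: Q_def)
  have "\<not> Q q" using p(2)[of q] dq by auto
  then have ne: "\<exists>i\<in>B. S q i \<noteq> 0" using q0 dqn by (auto simp: Q_def)
  \<comment> \<open>multiplying \<open>q\<close> by \<open>X\<close> amounts to applying \<open>M\<close>; the degree of \<open>q\<close> leaves room for the shift\<close>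
  have sh: "(\<Sum>k\<le>n. (if k = 0 then 0 else coeff q (k-1)) * x k i) = mat_vec B M (S q) i" for i
  proof -
    obtain m where m: "n = Suc m" using dqn by (cases n) auto
    have "(\<Sum>k\<le>n. (if k = 0 then 0 else coeff q (k-1)) * x k i) = (\<Sum>k\<le>m. coeff q k * x (Suc k) i)"
      unfolding m by (subst sum.atMost_Suc_shift) simp
    also have "\<dots> = (\<Sum>k\<le>n. coeff q k * x (Suc k) i)"
      unfolding m using dqn m by (simp add: coeff_eq_0)
    also have "\<dots> = mat_vec B M (S q) i"
      unfolding S_def[abs_def] by (subst mat_vec_lincomb) (simp add: x_def)
    finally show ?thesis .
  qed
  have cp: "coeff p k = (if k = 0 then 0 else coeff q (k-1)) - ev * coeff q k" for k
    unfolding q by (cases k) (auto simp: coeff_pCons)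
  have "mat_vec B M (S q) i = ev * S q i" if "i \<in> B" for i
  proof -
    have "0 = S p i" using p(1) that by (simp add: Q_def)
    also have "\<dots> = mat_vec B M (S q) i - ev * S q i"
      unfolding sh[symmetric] S_def by (simp add: cp left_diff_distrib sum_subtractf sum_distrib_left mult.assoc)
    finally show ?thesis by simp
  qed
  then show thesis using that[of "coeff q" n ev] ne unfolding S_def[abs_def] x_def by auto
qed

text \<open>
  The common eigenspace of all but one matrix is invariant under the remaining one, because they
  commute; so the orbit of a vector in it contains an eigenvector of the remaining matrix.
\<close>

lemma common_eigenvector:
  fixes Ms :: "('b \<Rightarrow> 'b \<Rightarrow> complex) list"
  assumes "finite B" "B \<noteq> {}"
    and comm: "\<And>M N i j. M \<in> set Ms \<Longrightarrow> N \<in> set Ms \<Longrightarrow> i \<in> B \<Longrightarrow> j \<in> B \<Longrightarrow>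
      (\<Sum>l\<in>B. M i l * N l j) = (\<Sum>l\<in>B. N i l * M l j)"
  shows "\<exists>v. (\<exists>i\<in>B. v i \<noteq> 0) \<and> (\<forall>M\<in>set Ms. \<exists>ev. \<forall>i\<in>B. mat_vec B M v i = ev * v i)"
  using comm
proof (induction Ms)
  case Nil
  then show ?case using assms by (intro exI[of _ "\<lambda>_. 1"]) auto
next
  case (Cons M Ms)
  have "\<exists>v. (\<exists>i\<in>B. v i \<noteq> 0) \<and> (\<forall>M\<in>set Ms. \<exists>ev. \<forall>i\<in>B. mat_vec B M v i = ev * v i)"
    using Cons by auto
  then obtain v where v: "\<exists>i\<in>B. v i \<noteq> 0"
    and "\<forall>M\<in>set Ms. \<exists>ev. \<forall>i\<in>B. mat_vec B M v i = ev * v i" by blast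
  from bchoice[OF this(2)] obtain e where
    e: "\<And>N i. N \<in> set Ms \<Longrightarrow> i \<in> B \<Longrightarrow> mat_vec B N v i = e N * v i" by blast
  let ?x = "\<lambda>k. (mat_vec B M ^^ k) v"
  have x: "mat_vec B N (?x k) i = e N * ?x k i" if "N \<in> set Ms" "i \<in> B" for N k i
    using that(2)
  proof (induction k arbitrary: i)
    case (Suc k)
    have "mat_vec B N (mat_vec B M (?x k)) i = (\<Sum>l\<in>B. (\<Sum>j\<in>B. N i j * M j l) * ?x k l)"
      unfolding mat_vec_def sum_distrib_left sum_distrib_right
      by (subst sum.swap) (simp add: mult.assoc)
    also have "\<dots> = (\<Sum>l\<in>B. (\<Sum>j\<in>B. M i j * N j l) * ?x k l)"
      by (rule sum.cong[OF refl]) (use Cons.prems[of N M i] that Suc.prems in auto)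
    also have "\<dots> = mat_vec B M (mat_vec B N (?x k)) i"
      unfolding mat_vec_def sum_distrib_left sum_distrib_right
      by (subst (2) sum.swap) (simp add: mult.assoc)
    also have "\<dots> = (\<Sum>j\<in>B. M i j * (e N * ?x k j))"
      unfolding mat_vec_def[of B M "mat_vec B N (?x k)"] by (rule sum.cong[OF refl]) (simp add: Suc.IH)
    also have "\<dots> = e N * mat_vec B M (?x k) i"
      by (simp add: mat_vec_def[of B M "?x k"] sum_distrib_left mult_ac)
    finally show ?case by simp
  qed (simp add: e that(1))
  from eigenvector_in_orbit[OF assms(1) v, of M] obtain c n l where
    c: "\<exists>i\<in>B. (\<Sum>k\<le>n. c k * ?x k i) \<noteq> 0"
    "\<And>i. i \<in> B \<Longrightarrow> mat_vec B M (\<lambda>i. \<Sum>k\<le>n. c k * ?x k i) i = l * (\<Sum>k\<le>n. c k * ?x k i)"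
    by blast
  have "mat_vec B N (\<lambda>i. \<Sum>k\<le>n. c k * ?x k i) i = e N * (\<Sum>k\<le>n. c k * ?x k i)"
    if "N \<in> set Ms" "i \<in> B" for N i
    by (simp add: mat_vec_lincomb x that sum_distrib_left mult_ac)
  then show ?case using c by (intro exI[of _ "\<lambda>i. \<Sum>k\<le>n. c k * ?x k i"]) auto
qed

section \<open>Representations of the polynomial ring by complex matrices\<close>

abbreviation "poly3 \<equiv> (real_polynomial_function :: (real^3 \<Rightarrow> real) \<Rightarrow> bool)"

lemma poly3_coord: "poly3 (\<lambda>p. p $ k)"
  by (rule real_polynomial_function.intros(1)) (rule bounded_linear_vec_nth)

text \<open>
  Linear forms are generated by the coordinates, so that they need not be treated separately.
\<close>

lemma poly3_induct [consumes 1, case_names coord const add mult]: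
  assumes "poly3 u"
    and coord: "\<And>k. P (\<lambda>p. p $ k)" and const: "\<And>c. P (\<lambda>p. c)"
    and add: "\<And>u v. poly3 u \<Longrightarrow> poly3 v \<Longrightarrow> P u \<Longrightarrow> P v \<Longrightarrow> P (\<lambda>p. u p + v p)"
    and mult: "\<And>u v. poly3 u \<Longrightarrow> poly3 v \<Longrightarrow> P u \<Longrightarrow> P v \<Longrightarrow> P (\<lambda>p. u p * v p)"
  shows "P u"
  using assms(1)
proof (induction rule: real_polynomial_function.induct)
  case (linear f)
  have "f = (\<lambda>p. (f (axis 1 1) * p $ 1 + f (axis 2 1) * p $ 2) + f (axis 3 1) * p $ 3)"
  proof
    fix p :: "real^3"
    have "p = (\<Sum>k\<in>UNIV. (p $ k) *\<^sub>R axis k 1)"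
      by (simp add: vec_eq_iff axis_def if_distrib cong: if_cong)
    then have "f p = f (\<Sum>k\<in>UNIV. (p $ k) *\<^sub>R axis k 1)" by simp
    also have "\<dots> = (\<Sum>k\<in>UNIV. p $ k * f (axis k 1))"
      using linear by (simp add: linear_sum bounded_linear.linear linear_scale)
    finally show "f p = (f (axis 1 1) * p $ 1 + f (axis 2 1) * p $ 2) + f (axis 3 1) * p $ 3"
      by (simp add: sum_3)
  qed
  moreover have "P (\<lambda>p. (f (axis 1 1) * p $ 1 + f (axis 2 1) * p $ 2) + f (axis 3 1) * p $ 3)"
    by (intro add mult coord const real_polynomial_function.intros(2-4) poly3_coord)
  ultimately show ?case by simp
qed (auto intro: assms)

text \<open>
  Characters are required to vanish off the polynomials, so that two of them agree on all polynomials
  if and only if they are equal as functions.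
\<close>

definition is_char :: "((real^3 \<Rightarrow> real) \<Rightarrow> complex) \<Rightarrow> bool" where
  "is_char \<phi> \<longleftrightarrow> (\<forall>u v. poly3 u \<longrightarrow> poly3 v \<longrightarrow>
      \<phi> (\<lambda>p. u p + v p) = \<phi> u + \<phi> v \<and> \<phi> (\<lambda>p. u p * v p) = \<phi> u * \<phi> v) \<and>
     (\<forall>c. \<phi> (\<lambda>p. c) = of_real c) \<and> (\<forall>u. \<not> poly3 u \<longrightarrow> \<phi> u = 0)"

definition is_rep :: "'b set \<Rightarrow> ((real^3 \<Rightarrow> real) \<Rightarrow> 'b \<Rightarrow> 'b \<Rightarrow> complex) \<Rightarrow> bool" where
  "is_rep B \<rho> \<longleftrightarrow> (\<forall>u v. poly3 u \<longrightarrow> poly3 v \<longrightarrow> (\<forall>i\<in>B. \<forall>j\<in>B.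
      \<rho> (\<lambda>p. u p + v p) i j = \<rho> u i j + \<rho> v i j \<and>
      \<rho> (\<lambda>p. u p * v p) i j = (\<Sum>l\<in>B. \<rho> u i l * \<rho> v l j))) \<and>
     (\<forall>c. \<forall>i\<in>B. \<forall>j\<in>B. \<rho> (\<lambda>p. c) i j = (if i = j then of_real c else 0))"

context
  fixes B :: "'b set" and \<rho> assumes fin_B: "finite B" and rep: "is_rep B \<rho>"
begin

lemma rep_add: "poly3 u \<Longrightarrow> poly3 v \<Longrightarrow> i \<in> B \<Longrightarrow> j \<in> B \<Longrightarrow> \<rho> (\<lambda>p. u p + v p) i j = \<rho> u i j + \<rho> v i j"
  and rep_mult: "poly3 u \<Longrightarrow> poly3 v \<Longrightarrow> i \<in> B \<Longrightarrow> j \<in> B \<Longrightarrow>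
    \<rho> (\<lambda>p. u p * v p) i j = (\<Sum>l\<in>B. \<rho> u i l * \<rho> v l j)"
  and rep_const: "i \<in> B \<Longrightarrow> j \<in> B \<Longrightarrow> \<rho> (\<lambda>p. c) i j = (if i = j then of_real c else 0)"
  using rep unfolding is_rep_def by blast+

lemma mat_vec_rep_add:
  "poly3 u \<Longrightarrow> poly3 w \<Longrightarrow> i \<in> B \<Longrightarrow>
    mat_vec B (\<rho> (\<lambda>p. u p + w p)) v i = mat_vec B (\<rho> u) v i + mat_vec B (\<rho> w) v i"
  by (simp add: mat_vec_def rep_add algebra_simps sum.distrib)

lemma mat_vec_rep_mult:
  assumes "poly3 u" "poly3 w" "i \<in> B"
  shows "mat_vec B (\<rho> (\<lambda>p. u p * w p)) v i = mat_vec B (\<rho> u) (mat_vec B (\<rho> w) v) i"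
proof -
  have "mat_vec B (\<rho> (\<lambda>p. u p * w p)) v i = (\<Sum>j\<in>B. (\<Sum>l\<in>B. \<rho> u i l * \<rho> w l j) * v j)"
    by (simp add: mat_vec_def rep_mult assms)
  also have "\<dots> = (\<Sum>l\<in>B. \<rho> u i l * mat_vec B (\<rho> w) v l)"
    unfolding mat_vec_def sum_distrib_left sum_distrib_right
    by (subst sum.swap) (simp add: mult.assoc)
  finally show ?thesis by (simp add: mat_vec_def[of B "\<rho> u"])
qed

lemma mat_vec_rep_const:
  assumes "i \<in> B" shows "mat_vec B (\<rho> (\<lambda>p. c)) v i = of_real c * v i"
proof -
  have "mat_vec B (\<rho> (\<lambda>p. c)) v i = (\<Sum>j\<in>B. if i = j then of_real c * v j else 0)"
    unfolding mat_vec_def by (rule sum.cong) (simp_all add: rep_const assms)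
  then show ?thesis using assms fin_B by simp
qed

text \<open>
  A common eigenvector of the three coordinates is an eigenvector of every polynomial in them. Once an
  entry of the eigenvector is normalised to \<open>1\<close>, the eigenvalue is a matrix entry, and hence a
  character.
\<close>

lemma rep_common_eigenvector:
  assumes "B \<noteq> {}"
  obtains v k \<phi> where "k \<in> B" "v k = 1" "is_char \<phi>"
    "\<And>u i. poly3 u \<Longrightarrow> i \<in> B \<Longrightarrow> mat_vec B (\<rho> u) v i = \<phi> u * v i"
proof -
  have "\<exists>v. (\<exists>i\<in>B. v i \<noteq> 0) \<and> (\<forall>M\<in>set (map (\<lambda>k. \<rho> (\<lambda>p. p $ k)) [1,2,3::3]).
      \<exists>ev. \<forall>i\<in>B. mat_vec B M v i = ev * v i)"
    using fin_B assms
  proof (rule common_eigenvector)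
    fix M N i j
    assume MN: "M \<in> set (map (\<lambda>k. \<rho> (\<lambda>p. p $ k)) [1,2,3::3])"
      "N \<in> set (map (\<lambda>k. \<rho> (\<lambda>p. p $ k)) [1,2,3::3])" and ij: "i \<in> B" "j \<in> B"
    obtain a b where "M = \<rho> (\<lambda>p. p $ a)" "N = \<rho> (\<lambda>p. p $ b)" using MN by auto
    then show "(\<Sum>l\<in>B. M i l * N l j) = (\<Sum>l\<in>B. N i l * M l j)"
      using rep_mult[OF poly3_coord poly3_coord ij, of a b] rep_mult[OF poly3_coord poly3_coord ij, of b a]
      by (simp add: mult.commute)
  qed
  then obtain v0 k where v0: "k \<in> B" "v0 k \<noteq> 0"
    and "\<forall>M\<in>set (map (\<lambda>k. \<rho> (\<lambda>p. p $ k)) [1,2,3::3]). \<exists>ev. \<forall>i\<in>B. mat_vec B M v0 i = ev * v0 i"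
    by blast
  then have ev0: "\<exists>ev. \<forall>i\<in>B. mat_vec B (\<rho> (\<lambda>p. p $ k)) v0 i = ev * v0 i" for k
    using exhaust_3[of k] by auto
  define v where "v i = v0 i / v0 k" for i
  have vk: "v k = 1" using v0 by (simp add: v_def)
  have mv: "mat_vec B M v i = mat_vec B M v0 i / v0 k" for M i
    by (simp add: mat_vec_def v_def sum_divide_distrib)
  have scale: "mat_vec B M w i = e * mat_vec B M v i" if "\<And>j. j \<in> B \<Longrightarrow> w j = e * v j" for M w e i
    by (simp add: mat_vec_def that sum_distrib_left mult_ac)
  have ev: "\<exists>ev. \<forall>i\<in>B. mat_vec B (\<rho> u) v i = ev * v i" if "poly3 u" for u
    using that
  proof (induction rule: poly3_induct)
    case (coord k)
    obtain e where "\<forall>i\<in>B. mat_vec B (\<rho> (\<lambda>p. p $ k)) v0 i = e * v0 i" using ev0[of k] by blast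
    then show ?case by (intro exI[of _ e]) (simp add: mv, simp add: v_def)
  next
    case (const c)
    show ?case by (intro exI[of _ "of_real c"]) (simp add: mat_vec_rep_const)
  next
    case (add u w)
    then obtain a b where "\<forall>i\<in>B. mat_vec B (\<rho> u) v i = a * v i" "\<forall>i\<in>B. mat_vec B (\<rho> w) v i = b * v i" by blast
    then show ?case using add(1,2)
      by (intro exI[of _ "a + b"]) (simp add: mat_vec_rep_add algebra_simps)
  next
    case (mult u w)
    then obtain a b where ab: "\<forall>i\<in>B. mat_vec B (\<rho> u) v i = a * v i" "\<forall>i\<in>B. mat_vec B (\<rho> w) v i = b * v i" by blast
    then have "mat_vec B (\<rho> u) (mat_vec B (\<rho> w) v) i = b * mat_vec B (\<rho> u) v i" for i by (intro scale) simp
    then show ?case using mult(1,2) ab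
      by (intro exI[of _ "b * a"]) (simp add: mat_vec_rep_mult)
  qed
  define \<phi> where "\<phi> u = (if poly3 u then mat_vec B (\<rho> u) v k else 0)" for u
  have eig: "mat_vec B (\<rho> u) v i = \<phi> u * v i" if "poly3 u" "i \<in> B" for u i
    using ev[OF that(1)] v0(1) vk that by (auto simp: \<phi>_def)
  have "is_char \<phi>"
    unfolding is_char_def
  proof (intro conjI allI impI)
    fix u w assume uw: "poly3 u" "poly3 w"
    then show "\<phi> (\<lambda>p. u p + w p) = \<phi> u + \<phi> w"
      using v0(1) by (simp add: \<phi>_def mat_vec_rep_add real_polynomial_function.intros(3))
    have "mat_vec B (\<rho> u) (mat_vec B (\<rho> w) v) k = \<phi> w * mat_vec B (\<rho> u) v k"
      by (rule scale) (rule eig[OF uw(2)])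
    then show "\<phi> (\<lambda>p. u p * w p) = \<phi> u * \<phi> w"
      using uw v0(1) by (simp add: \<phi>_def mat_vec_rep_mult real_polynomial_function.intros(4) mult.commute)
  next
    fix c show "\<phi> (\<lambda>p. c) = of_real c"
      using v0(1) vk by (simp add: \<phi>_def mat_vec_rep_const real_polynomial_function.intros(2))
  qed (simp add: \<phi>_def)
  then show thesis by (rule that[OF v0(1) vk _ eig])
qed

end

text \<open>
  Simultaneous triangularisation. If \<open>v\<close> is a common eigenvector with character \<open>\<phi>1\<close> and \<open>v k = 1\<close>, then
  the basis vectors other than the \<open>k\<close>-th one form a basis of the quotient by \<open>v\<close>, on which the matrices
  \<open>\<rho>' u i j = \<rho> u i j - v i * \<rho> u k j\<close> represent the polynomials. The trace drops by \<open>\<phi>1\<close>.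
  
  The last conjunct provides the characters that do occur. A common left eigenvector \<open>w\<close> with character
  \<open>\<phi>\<close> satisfies \<open>\<phi>1 u (w \<cdot> v) = \<phi> u (w \<cdot> v)\<close>. So either \<open>\<phi> = \<phi>1\<close>, or \<open>w \<cdot> v = 0\<close> and \<open>w\<close> descends to the
  quotient.
\<close>

theorem rep_characters:
  assumes "finite B" "is_rep B \<rho>"
  shows "\<exists>xs. (\<forall>\<phi>\<in>set xs. is_char \<phi> \<and> (\<forall>u. poly3 u \<longrightarrow> (\<forall>i\<in>B. \<forall>j\<in>B. \<rho> u i j = 0) \<longrightarrow> \<phi> u = 0)) \<and>
    (\<forall>u. poly3 u \<longrightarrow> (\<Sum>i\<in>B. \<rho> u i i) = (\<Sum>\<phi>\<leftarrow>xs. \<phi> u)) \<and>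
    (\<forall>w \<phi>. (\<exists>i\<in>B. w i \<noteq> 0) \<longrightarrow> (\<forall>u. poly3 u \<longrightarrow> (\<forall>j\<in>B. (\<Sum>i\<in>B. w i * \<rho> u i j) = \<phi> u * w j)) \<longrightarrow>
       (\<exists>\<phi>'\<in>set xs. \<forall>u. poly3 u \<longrightarrow> \<phi> u = \<phi>' u))"
  using assms
proof (induction "card B" arbitrary: B \<rho>)
  case 0
  then show ?case by (intro exI[of _ "[]"]) auto
next
  case (Suc n)
  have fin: "finite B" and rep: "is_rep B \<rho>" and ne: "B \<noteq> {}" using Suc by auto
  note radd = rep_add[OF fin rep] and rmult = rep_mult[OF fin rep] and rconst = rep_const[OF fin rep]
  obtain v k \<phi>1 where k: "k \<in> B" "v k = 1" and \<phi>1: "is_char \<phi>1"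
    and eig0: "\<And>u i. poly3 u \<Longrightarrow> i \<in> B \<Longrightarrow> mat_vec B (\<rho> u) v i = \<phi>1 u * v i"
    by (rule rep_common_eigenvector[OF fin rep ne]) (rule that)
  have eig: "(\<Sum>l\<in>B. \<rho> u i l * v l) = \<phi>1 u * v i" if "poly3 u" "i \<in> B" for u i
    using eig0[OF that] by (simp add: mat_vec_def)
  define \<rho>' where "\<rho>' u i j = \<rho> u i j - v i * \<rho> u k j" for u i j
  \<comment> \<open>row \<open>k\<close> of \<open>\<rho>'\<close> vanishes, so sums over \<open>B - {k}\<close> may be extended to \<open>B\<close>\<close>
  have k0: "\<rho>' u k j = 0" for u j by (simp add: \<rho>'_def k)
  have sumk: "(\<Sum>l\<in>B-{k}. f l) = (\<Sum>l\<in>B. f l)" if "f k = 0" for f :: "_ \<Rightarrow> complex"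
    by (rule sum.mono_neutral_left) (use fin that in auto)
  have rep': "is_rep (B - {k}) \<rho>'"
    unfolding is_rep_def
  proof (intro conjI allI impI ballI)
    fix u w i j assume uw: "poly3 u" "poly3 w" and ij: "i \<in> B - {k}" "j \<in> B - {k}"
    show "\<rho>' (\<lambda>p. u p + w p) i j = \<rho>' u i j + \<rho>' w i j"
      using uw ij k by (simp add: \<rho>'_def radd algebra_simps)
    have "(\<Sum>l\<in>B-{k}. \<rho>' u i l * \<rho>' w l j) = (\<Sum>l\<in>B. \<rho>' u i l * \<rho>' w l j)"
      by (rule sumk) (simp add: k0)
    also have "\<dots> = (\<Sum>l\<in>B. \<rho> u i l * \<rho> w l j) - (\<Sum>l\<in>B. \<rho> u i l * v l) * \<rho> w k j
       - v i * (\<Sum>l\<in>B. \<rho> u k l * \<rho> w l j) + v i * ((\<Sum>l\<in>B. \<rho> u k l * v l) * \<rho> w k j)"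
      unfolding sum_distrib_left sum_distrib_right sum_subtractf[symmetric] sum.distrib[symmetric]
      by (rule sum.cong) (simp_all add: \<rho>'_def algebra_simps)
    also have "\<dots> = \<rho>' (\<lambda>p. u p * w p) i j"
      using uw ij k by (simp add: eig \<rho>'_def rmult)
    finally show "\<rho>' (\<lambda>p. u p * w p) i j = (\<Sum>l\<in>B - {k}. \<rho>' u i l * \<rho>' w l j)" by simp
  next
    fix c i j assume ij: "i \<in> B - {k}" "j \<in> B - {k}"
    then show "\<rho>' (\<lambda>p. c) i j = (if i = j then of_real c else 0)"
      using k by (auto simp: \<rho>'_def rconst)
  qed
  have "n = card (B - {k})" using Suc(2) k fin by simp
  note ih = Suc(1)[OF this finite_Diff[OF fin] rep']
  obtain xs where xs:
    "(\<forall>\<phi>\<in>set xs. is_char \<phi> \<and> (\<forall>u. poly3 u \<longrightarrow> (\<forall>i\<in>B-{k}. \<forall>j\<in>B-{k}. \<rho>' u i j = 0) \<longrightarrow> \<phi> u = 0))"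
    "(\<forall>u. poly3 u \<longrightarrow> (\<Sum>i\<in>B-{k}. \<rho>' u i i) = (\<Sum>\<phi>\<leftarrow>xs. \<phi> u))"
    "(\<forall>w \<phi>. (\<exists>i\<in>B-{k}. w i \<noteq> 0) \<longrightarrow> (\<forall>u. poly3 u \<longrightarrow> (\<forall>j\<in>B-{k}. (\<Sum>i\<in>B-{k}. w i * \<rho>' u i j) = \<phi> u * w j)) \<longrightarrow>
       (\<exists>\<phi>'\<in>set xs. \<forall>u. poly3 u \<longrightarrow> \<phi> u = \<phi>' u))"
    by (rule exE[OF ih], elim conjE, rule that)
  have xs1: "\<And>\<phi>. \<phi> \<in> set xs \<Longrightarrow> is_char \<phi>"
      "\<And>\<phi> u. \<phi> \<in> set xs \<Longrightarrow> poly3 u \<Longrightarrow> (\<And>i j. i\<in>B - {k} \<Longrightarrow> j\<in>B - {k} \<Longrightarrow> \<rho>' u i j = 0) \<Longrightarrow> \<phi> u = 0"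
    and xs2: "\<And>u. poly3 u \<Longrightarrow> (\<Sum>i\<in>B - {k}. \<rho>' u i i) = (\<Sum>\<phi>\<leftarrow>xs. \<phi> u)"
    and xs3: "\<And>w \<phi>. (\<exists>i\<in>B - {k}. w i \<noteq> 0) \<Longrightarrow>
      (\<And>u j. poly3 u \<Longrightarrow> j\<in>B - {k} \<Longrightarrow> (\<Sum>i\<in>B - {k}. w i * \<rho>' u i j) = \<phi> u * w j) \<Longrightarrow>
       (\<exists>\<phi>'\<in>set xs. \<forall>u. poly3 u \<longrightarrow> \<phi> u = \<phi>' u)"
    subgoal using xs(1) by simp
    subgoal premises prems for \<phi> u
      using bspec[OF xs(1) prems(1)] prems(2,3) by simp
    subgoal using xs(2) by simp
    subgoal premises prems for w \<phi>
      using xs(3)[THEN spec, of w, THEN spec, of \<phi>] prems by simp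
    done
  show ?case
  proof (intro exI[of _ "\<phi>1 # xs"] conjI allI impI ballI)
    fix \<phi> assume "\<phi> \<in> set (\<phi>1 # xs)"
    then show "is_char \<phi>" using \<phi>1 xs1 by auto
  next
    fix \<phi> u assume \<phi>: "\<phi> \<in> set (\<phi>1 # xs)" and u: "poly3 u" and z: "\<forall>i\<in>B. \<forall>j\<in>B. \<rho> u i j = 0"
    have "\<phi>1 u = 0" using eig[OF u k(1)] z k by simp
    moreover have "\<phi> u = 0" if "\<phi> \<in> set xs"
      by (rule xs1(2)[OF that u]) (use z k in \<open>auto simp: \<rho>'_def\<close>)
    ultimately show "\<phi> u = 0" using \<phi> by auto
  next
    fix u assume u: "poly3 u"
    have "(\<Sum>\<phi>\<leftarrow>xs. \<phi> u) = (\<Sum>i\<in>B. \<rho>' u i i)"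
      unfolding xs2[OF u, symmetric] by (rule sumk) (simp add: k0)
    also have "\<dots> = (\<Sum>i\<in>B. \<rho> u i i) - (\<Sum>i\<in>B. \<rho> u k i * v i)"
      by (simp add: \<rho>'_def sum_subtractf mult.commute)
    also have "\<dots> = (\<Sum>i\<in>B. \<rho> u i i) - \<phi>1 u" using eig[OF u k(1)] k by simp
    finally show "(\<Sum>i\<in>B. \<rho> u i i) = (\<Sum>\<phi>\<leftarrow>\<phi>1 # xs. \<phi> u)" by simp
  next
    fix w \<phi> assume w: "\<exists>i\<in>B. w i \<noteq> 0"
      and le0: "\<forall>u. poly3 u \<longrightarrow> (\<forall>j\<in>B. (\<Sum>i\<in>B. w i * \<rho> u i j) = \<phi> u * w j)"
    have le: "(\<Sum>i\<in>B. w i * \<rho> u i j) = \<phi> u * w j" if "poly3 u" "j \<in> B" for u j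
      using le0 that by blast
    define wv where "wv = (\<Sum>i\<in>B. w i * v i)"
    show "\<exists>\<phi>'\<in>set (\<phi>1 # xs). \<forall>u. poly3 u \<longrightarrow> \<phi> u = \<phi>' u"
    proof (cases "wv = 0")
      case False
      have "\<phi> u = \<phi>1 u" if u: "poly3 u" for u
      proof -
        have "\<phi>1 u * wv = (\<Sum>i\<in>B. w i * (\<Sum>l\<in>B. \<rho> u i l * v l))"
        proof -
          have "(\<Sum>i\<in>B. w i * (\<Sum>l\<in>B. \<rho> u i l * v l)) = (\<Sum>i\<in>B. w i * (\<phi>1 u * v i))"
            by (rule sum.cong) (simp_all add: eig u)
          then show ?thesis by (simp add: wv_def sum_distrib_left mult_ac)
        qed
        also have "\<dots> = (\<Sum>l\<in>B. (\<Sum>i\<in>B. w i * \<rho> u i l) * v l)"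
          unfolding sum_distrib_left sum_distrib_right by (subst sum.swap) (simp add: mult.assoc)
        also have "\<dots> = \<phi> u * wv"
          unfolding wv_def sum_distrib_left by (rule sum.cong) (simp_all add: le u)
        finally show ?thesis using False by simp
      qed
      then show ?thesis by (intro bexI[of _ "\<phi>1"]) simp_all
    next
      case True
      have "\<exists>i\<in>B - {k}. w i \<noteq> 0"
      proof (rule ccontr)
        assume n: "\<not> (\<exists>i\<in>B - {k}. w i \<noteq> 0)"
        have "wv = (\<Sum>i\<in>{k}. w i * v i)"
          unfolding wv_def by (rule sum.mono_neutral_right) (use n fin k in auto)
        then show False using True w n k by auto
      qed
      moreover have "(\<Sum>i\<in>B - {k}. w i * \<rho>' u i j) = \<phi> u * w j" if "poly3 u" "j \<in> B - {k}" for u j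
      proof -
        have "(\<Sum>i\<in>B - {k}. w i * \<rho>' u i j) = (\<Sum>i\<in>B. w i * \<rho>' u i j)"
          by (rule sumk) (simp add: k0)
        also have "\<dots> = (\<Sum>i\<in>B. w i * \<rho> u i j) - wv * \<rho> u k j"
          unfolding wv_def sum_distrib_right sum_subtractf[symmetric]
          by (rule sum.cong) (simp_all add: \<rho>'_def algebra_simps)
        finally show ?thesis using True that by (simp add: le)
      qed
      ultimately have "\<exists>\<phi>'\<in>set xs. \<forall>u. poly3 u \<longrightarrow> \<phi> u = \<phi>' u" by (rule xs3)
      then show ?thesis by simp
    qed
  qed
qed

section \<open>Characters of the polynomial ring\<close>

abbreviation cnj_char :: "((real^3 \<Rightarrow> real) \<Rightarrow> complex) \<Rightarrow> (real^3 \<Rightarrow> real) \<Rightarrow> complex" where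
  "cnj_char \<phi> \<equiv> \<lambda>u. cnj (\<phi> u)"

lemmas poly3_intros = real_polynomial_function.intros(2-4) poly3_coord

context
  fixes \<phi> assumes \<phi>: "is_char \<phi>"
begin

lemma char_add: "poly3 u \<Longrightarrow> poly3 v \<Longrightarrow> \<phi> (\<lambda>p. u p + v p) = \<phi> u + \<phi> v"
  and char_mult: "poly3 u \<Longrightarrow> poly3 v \<Longrightarrow> \<phi> (\<lambda>p. u p * v p) = \<phi> u * \<phi> v"
  and char_const: "\<phi> (\<lambda>p. c) = of_real c"
  using \<phi> unfolding is_char_def by blast+

lemma char_scale: "poly3 u \<Longrightarrow> \<phi> (\<lambda>p. c * u p) = of_real c * \<phi> u"
  using char_mult[of "\<lambda>p. c" u] by (simp add: char_const poly3_intros)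

lemma char_diff: "poly3 u \<Longrightarrow> poly3 v \<Longrightarrow> \<phi> (\<lambda>p. u p - v p) = \<phi> u - \<phi> v"
  using char_add[of u "\<lambda>p. - v p"] char_scale[of v "-1"] by (simp add: real_polynomial_function_minus)

lemma char_prod:
  "finite S \<Longrightarrow> (\<And>i. i \<in> S \<Longrightarrow> poly3 (a i)) \<Longrightarrow>
    poly3 (\<lambda>p. \<Prod>i\<in>S. a i p) \<and> \<phi> (\<lambda>p. \<Prod>i\<in>S. a i p) = (\<Prod>i\<in>S. \<phi> (a i))"
proof (induction S rule: finite_induct)
  case empty
  then show ?case by (simp add: char_const poly3_intros)
next
  case (insert i S)
  then show ?case using char_mult[of "a i" "\<lambda>p. \<Prod>i\<in>S. a i p"] by (simp add: poly3_intros)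
qed

lemma real_char_eval:
  assumes "\<And>u. Im (\<phi> u) = 0" "poly3 u"
  shows "\<phi> u = of_real (u (\<chi> k. Re (\<phi> (\<lambda>p. p $ k))))"
  using assms(2)
proof (induction rule: poly3_induct)
  case (coord k)
  then show ?case using assms(1)[of "\<lambda>p. p $ k"] by (simp add: complex_eq_iff)
qed (simp_all add: char_const char_add char_mult)

end

definition eval_char :: "real^3 \<Rightarrow> (real^3 \<Rightarrow> real) \<Rightarrow> complex" where
  "eval_char p u = (if poly3 u then of_real (u p) else 0)"

lemma is_char_eval: "is_char (eval_char p)"
  by (auto simp: is_char_def eval_char_def poly3_intros)

lemma eval_char_inj: "inj eval_char"
proof (rule injI)
  fix p q assume eq: "eval_char p = eval_char q"
  have "p $ k = q $ k" for k
    using fun_cong[OF eq, of "\<lambda>p. p $ k"] by (simp add: eval_char_def poly3_coord)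
  then show "p = q" by (simp add: vec_eq_iff)
qed

lemma real_char_eq_eval:
  assumes "is_char \<phi>" "\<And>u. Im (\<phi> u) = 0"
  shows "\<phi> = eval_char (\<chi> k. Re (\<phi> (\<lambda>p. p $ k)))"
proof
  fix u
  show "\<phi> u = eval_char (\<chi> k. Re (\<phi> (\<lambda>p. p $ k))) u"
  proof (cases "poly3 u")
    case True
    then show ?thesis using real_char_eval[OF assms] by (simp add: eval_char_def)
  next
    case False
    then show ?thesis using assms(1) by (simp add: eval_char_def is_char_def)
  qed
qed

text \<open>
  If the kernel of \<open>\<psi>\<close> were contained in that of \<open>\<phi>\<close>, then \<open>\<phi>\<close> would kill the real polynomial
  \<open>(u - \<psi> u) (u - cnj (\<psi> u))\<close> for every \<open>u\<close>, so \<open>\<phi> u\<close> would be \<open>\<psi> u\<close> or its conjugate. A vector space is not the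
  union of two proper subspaces, so one of the two alternatives would hold for all \<open>u\<close>.
\<close>

lemma char_separate:
  assumes c: "is_char \<phi>" "is_char \<psi>" and ne: "\<phi> \<noteq> \<psi>" "\<phi> \<noteq> cnj_char \<psi>"
  obtains a where "poly3 a" "\<psi> a = 0" "\<phi> a \<noteq> 0"
proof (rule ccontr)
  assume no: "\<not> thesis"
  note obtained = that
  have ker: "\<phi> a = 0" if "poly3 a" "\<psi> a = 0" for a
  proof (rule ccontr)
    assume "\<phi> a \<noteq> 0"
    with that have thesis by (rule obtained)
    with no show False by (rule notE)
  qed
  have two: "\<phi> u = \<psi> u \<or> \<phi> u = cnj (\<psi> u)" if u: "poly3 u" for u
  proof -
    define a where "a = (\<lambda>p. (u p * u p - 2 * Re (\<psi> u) * u p) + (cmod (\<psi> u))\<^sup>2)"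
    have pa: "poly3 a" unfolding a_def using u
      by (intro poly3_intros real_polynomial_function_diff)
    have ev: "\<theta> a = \<theta> u * \<theta> u - of_real (2 * Re (\<psi> u)) * \<theta> u + of_real ((cmod (\<psi> u))\<^sup>2)" if "is_char \<theta>" for \<theta>
      unfolding a_def using u
      by (simp add: char_add[OF that] char_diff[OF that] char_scale[OF that] char_mult[OF that]
          char_const[OF that] poly3_intros real_polynomial_function_diff)
    have fac: "z * z - of_real (2 * Re (\<psi> u)) * z + of_real ((cmod (\<psi> u))\<^sup>2) = (z - \<psi> u) * (z - cnj (\<psi> u))" for z
    proof -
      have 1: "of_real (2 * Re (\<psi> u)) = \<psi> u + cnj (\<psi> u)" by (simp add: complex_add_cnj)
      have 2: "of_real ((cmod (\<psi> u))\<^sup>2) = \<psi> u * cnj (\<psi> u)"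
        using complex_norm_square[of "\<psi> u"] by simp
      show ?thesis unfolding 1 2 by (simp add: algebra_simps)
    qed
    have "\<psi> a = 0" unfolding ev[OF c(2)] fac by simp
    then have "\<phi> a = 0" by (rule ker[OF pa])
    then show ?thesis unfolding ev[OF c(1)] fac by simp
  qed
  have off: "\<phi> u = 0 \<and> \<psi> u = 0" if "\<not> poly3 u" for u
    using c that by (simp add: is_char_def)
  obtain u1 where u1: "\<phi> u1 \<noteq> \<psi> u1" using ne(1) by blast
  obtain u2 where u2: "\<phi> u2 \<noteq> cnj (\<psi> u2)" using ne(2) by auto
  have p: "poly3 u1" "poly3 u2" using u1 u2 off by force+
  then have "\<phi> u1 = cnj (\<psi> u1)" "\<phi> u2 = \<psi> u2" using two u1 u2 by blast+
  moreover have "\<phi> u1 + \<phi> u2 = \<psi> u1 + \<psi> u2 \<or> \<phi> u1 + \<phi> u2 = cnj (\<psi> u1) + cnj (\<psi> u2)"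
    using two[of "\<lambda>p. u1 p + u2 p"] p by (simp add: char_add[OF c(1)] char_add[OF c(2)] poly3_intros)
  ultimately show False using u1 u2 by auto
qed

text \<open>
  Chinese remaindering: the product of the separating polynomials is killed by all other characters and
  not by \<open>\<phi>\<close>; a further factor adjusts the value, since the range of \<open>\<phi>\<close> is \<open>\<real>\<close> or \<open>\<complex>\<close>.
\<close>

lemma char_dual:
  assumes fin: "finite F" and F: "\<And>\<phi>. \<phi> \<in> F \<Longrightarrow> is_char \<phi>"
    and conj: "\<And>\<phi> \<psi>. \<phi> \<in> F \<Longrightarrow> \<psi> \<in> F \<Longrightarrow> \<phi> \<noteq> \<psi> \<Longrightarrow> \<phi> \<noteq> cnj_char \<psi>"
    and \<phi>: "\<phi> \<in> F" and w: "(\<And>u. Im (\<phi> u) = 0) \<Longrightarrow> Im w = 0"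
  obtains e where "poly3 e" "\<phi> e = w" "\<And>\<psi>. \<psi> \<in> F \<Longrightarrow> \<psi> \<noteq> \<phi> \<Longrightarrow> \<psi> e = 0"
proof -
  have "\<exists>a. poly3 a \<and> \<psi> a = 0 \<and> \<phi> a \<noteq> 0" if "\<psi> \<in> F - {\<phi>}" for \<psi>
  proof -
    have \<psi>: "\<psi> \<in> F" "\<phi> \<noteq> \<psi>" using that by auto
    show ?thesis
      by (rule char_separate[OF F[OF \<phi>] F[OF \<psi>(1)] \<psi>(2) conj[OF \<phi> \<psi>]]) (intro exI conjI)
  qed
  then have "\<forall>\<psi>\<in>F - {\<phi>}. \<exists>a. poly3 a \<and> \<psi> a = 0 \<and> \<phi> a \<noteq> 0" by (rule ballI)
  from bchoice[OF this] obtain a where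
    a: "\<forall>\<psi>\<in>F - {\<phi>}. poly3 (a \<psi>) \<and> \<psi> (a \<psi>) = 0 \<and> \<phi> (a \<psi>) \<noteq> 0" by (rule exE)
  define b where "b = (\<lambda>p. \<Prod>\<psi>\<in>F - {\<phi>}. a \<psi> p)"
  have b: "poly3 b" "\<And>\<theta>. is_char \<theta> \<Longrightarrow> \<theta> b = (\<Prod>\<psi>\<in>F - {\<phi>}. \<theta> (a \<psi>))"
  proof -
    have pa: "\<And>\<psi>. \<psi> \<in> F - {\<phi>} \<Longrightarrow> poly3 (a \<psi>)" using a by simp
    show "poly3 b" unfolding b_def by (rule conjunct1[OF char_prod[OF is_char_eval finite_Diff[OF fin] pa]])
    show "\<theta> b = (\<Prod>\<psi>\<in>F - {\<phi>}. \<theta> (a \<psi>))" if "is_char \<theta>" for \<theta>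
      unfolding b_def by (rule conjunct2[OF char_prod[OF that finite_Diff[OF fin] pa]])
  qed
  have b1: "\<phi> b \<noteq> 0" using b(2)[OF F[OF \<phi>]] a fin by simp
  have b0: "\<psi> b = 0" if "\<psi> \<in> F" "\<psi> \<noteq> \<phi>" for \<psi>
    using b(2)[OF F[OF that(1)]] a that fin by (auto intro!: prod_zero)
  have "\<exists>c. poly3 c \<and> \<phi> c = z" if z: "(\<And>u. Im (\<phi> u) = 0) \<Longrightarrow> Im z = 0" for z
  proof (cases "\<forall>u. Im (\<phi> u) = 0")
    case True
    then show ?thesis using z
      by (intro exI[of _ "\<lambda>p. Re z"]) (simp add: char_const[OF F[OF \<phi>]] poly3_intros complex_eq_iff)
  next
    case False
    then obtain u where u: "Im (\<phi> u) \<noteq> 0" by blast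
    then have pu: "poly3 u" using F[OF \<phi>] by (auto simp: is_char_def)
    define s where "s = Im z / Im (\<phi> u)"
    have "\<phi> (\<lambda>p. s * u p + (Re z - s * Re (\<phi> u))) 
        = of_real s * \<phi> u + of_real (Re z - s * Re (\<phi> u))"
      using pu by (simp add: char_add[OF F[OF \<phi>]] char_scale[OF F[OF \<phi>]] char_const[OF F[OF \<phi>]]
          poly3_intros del: of_real_diff)
    also have "\<dots> = z" using u by (simp add: complex_eq_iff s_def)
    finally show ?thesis using pu by (intro exI[of _ "\<lambda>p. s * u p + (Re z - s * Re (\<phi> u))"]) (auto intro!: poly3_intros)
  qed
  moreover have "Im (w / \<phi> b) = 0" if r: "\<And>u. Im (\<phi> u) = 0"
    using w[OF r] r[of b] by (simp add: complex_is_Real_iff[symmetric])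
  ultimately obtain c where c: "poly3 c" "\<phi> c = w / \<phi> b" by metis
  show thesis
  proof (rule that[of "\<lambda>p. b p * c p"])
    show "poly3 (\<lambda>p. b p * c p)" using b(1) c(1) by (intro poly3_intros)
    show "\<phi> (\<lambda>p. b p * c p) = w" using char_mult[OF F[OF \<phi>] b(1) c(1)] b1 c(2) by simp
    show "\<psi> (\<lambda>p. b p * c p) = 0" if "\<psi> \<in> F" "\<psi> \<noteq> \<phi>" for \<psi>
      using char_mult[OF F[OF that(1)] b(1) c(1)] b0[OF that] by simp
  qed
qed

text \<open>
  The real part does not distinguish \<open>\<phi>\<close> from its conjugate, so one representative of each conjugate pair
  suffices, with the multiplicities of both added up.
\<close>

lemma collect_conjugate_characters:
  fixes xs :: "((real^3 \<Rightarrow> real) \<Rightarrow> complex) list"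
  shows "\<exists>F m. finite F \<and> F \<subseteq> set xs \<and> (\<forall>\<phi>\<in>set xs. \<phi> \<in> F \<or> cnj_char \<phi> \<in> F) \<and>
    (\<forall>\<phi>\<in>F. \<forall>\<psi>\<in>F. \<phi> \<noteq> \<psi> \<longrightarrow> \<phi> \<noteq> cnj_char \<psi>) \<and> (\<forall>\<phi>\<in>F. m \<phi> > (0::real)) \<and>
    (\<forall>u. Re (\<Sum>\<phi>\<leftarrow>xs. \<phi> u) = (\<Sum>\<phi>\<in>F. m \<phi> * Re (\<phi> u)))"
proof (induction xs)
  case Nil
  then show ?case by (intro exI[of _ "{}"] exI[of _ "\<lambda>_. 1"]) auto
next
  case (Cons \<phi> xs)
  obtain F m where Fm: "finite F" "F \<subseteq> set xs" "\<forall>\<phi>\<in>set xs. \<phi> \<in> F \<or> cnj_char \<phi> \<in> F"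
    "\<forall>\<phi>\<in>F. \<forall>\<psi>\<in>F. \<phi> \<noteq> \<psi> \<longrightarrow> \<phi> \<noteq> cnj_char \<psi>" "\<forall>\<phi>\<in>F. m \<phi> > (0::real)"
    "\<forall>u. Re (\<Sum>\<phi>\<leftarrow>xs. \<phi> u) = (\<Sum>\<phi>\<in>F. m \<phi> * Re (\<phi> u))"
    by (rule exE[OF Cons.IH], elim exE conjE, rule that)
  have F: "finite F" "F \<subseteq> set xs" "\<And>\<phi>. \<phi> \<in> set xs \<Longrightarrow> \<phi> \<in> F \<or> cnj_char \<phi> \<in> F"
    "\<And>\<phi> \<psi>. \<phi> \<in> F \<Longrightarrow> \<psi> \<in> F \<Longrightarrow> \<phi> \<noteq> \<psi> \<Longrightarrow> \<phi> \<noteq> cnj_char \<psi>"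
    subgoal by (rule Fm(1))
    subgoal by (rule Fm(2))
    subgoal by (rule bspec[OF Fm(3)])
    subgoal by (rule mp[OF bspec[OF bspec[OF Fm(4)]]])
    done
  have m: "\<And>\<phi>. \<phi> \<in> F \<Longrightarrow> m \<phi> > (0::real)" by (rule bspec[OF Fm(5)])
  have s: "\<And>u. Re (\<Sum>\<phi>\<leftarrow>xs. \<phi> u) = (\<Sum>\<phi>\<in>F. m \<phi> * Re (\<phi> u))" by (rule spec[OF Fm(6)])
  show ?case
  proof (cases "\<phi> \<in> F \<or> cnj_char \<phi> \<in> F")
    case True
    then obtain \<psi> where \<psi>: "\<psi> \<in> F" "\<psi> = \<phi> \<or> \<psi> = cnj_char \<phi>" by blast
    define m' where "m' = m(\<psi> := m \<psi> + 1)"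
    have H: "(\<Sum>\<theta>\<in>F. m' \<theta> * Re (\<theta> u)) = Re (\<phi> u) + (\<Sum>\<theta>\<in>F. m \<theta> * Re (\<theta> u))" for u
    proof -
      have "(\<Sum>\<theta>\<in>F. m' \<theta> * Re (\<theta> u)) =
          (\<Sum>\<theta>\<in>F. (if \<theta> = \<psi> then Re (\<theta> u) else 0) + m \<theta> * Re (\<theta> u))"
        by (rule sum.cong) (auto simp: m'_def algebra_simps)
      also have "\<dots> = Re (\<psi> u) + (\<Sum>\<theta>\<in>F. m \<theta> * Re (\<theta> u))"
        using F(1) \<psi>(1) by (simp add: sum.distrib)
      finally show ?thesis using \<psi>(2) by auto
    qed
    have "\<forall>u. Re (\<Sum>\<phi>\<leftarrow>\<phi> # xs. \<phi> u) = (\<Sum>\<theta>\<in>F. m' \<theta> * Re (\<theta> u))"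
      by (simp only: H list.map sum_list.Cons plus_complex.sel s) simp
    moreover have "\<forall>\<theta>\<in>F. m' \<theta> > 0" using m by (simp add: m'_def add_pos_pos)
    moreover have "\<forall>\<theta>\<in>set (\<phi> # xs). \<theta> \<in> F \<or> cnj_char \<theta> \<in> F"
      using Fm(3) True by (simp only: list.set ball_simps)
    moreover have "F \<subseteq> set (\<phi> # xs)" using F(2) by auto
    ultimately show ?thesis using Fm(1,4)
      by (intro exI[of _ F] exI[of _ m'] conjI)
  next
    case False
    define m' where "m' = m(\<phi> := 1)"
    have sum: "(\<Sum>\<theta>\<in>insert \<phi> F. m' \<theta> * Re (\<theta> u)) = Re (\<phi> u) + (\<Sum>\<theta>\<in>F. m \<theta> * Re (\<theta> u))" for u
    proof -
      have "(\<Sum>\<theta>\<in>F. m' \<theta> * Re (\<theta> u)) = (\<Sum>\<theta>\<in>F. m \<theta> * Re (\<theta> u))"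
        by (rule sum.cong) (use False in \<open>auto simp: m'_def\<close>)
      then show ?thesis using F(1) False by (simp add: m'_def)
    qed
    have cc: "cnj_char (cnj_char \<theta>) = \<theta>" for \<theta> by simp
    have n: "\<theta> \<noteq> cnj_char \<psi>" if "\<theta> \<in> insert \<phi> F" "\<psi> \<in> insert \<phi> F" "\<theta> \<noteq> \<psi>" for \<theta> \<psi>
    proof -
      consider "\<theta> = \<phi>" "\<psi> \<in> F" | "\<psi> = \<phi>" "\<theta> \<in> F" | "\<theta> \<in> F" "\<psi> \<in> F" using \<open>\<theta> \<in> _\<close> \<open>\<psi> \<in> _\<close> \<open>\<theta> \<noteq> \<psi>\<close> by blast
      then show ?thesis
      proof cases
        case 1
        have "cnj_char \<phi> \<notin> F" using False by blast
        then show ?thesis using 1 cc[of \<psi>] by metis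
      next
        case 2
        then show ?thesis using False by metis
      next
        case 3
        show ?thesis by (rule F(4)[OF 3 \<open>\<theta> \<noteq> \<psi>\<close>])
      qed
    qed
    show ?thesis
    proof (intro exI[of _ "insert \<phi> F"] exI[of _ m'] conjI)
      show "finite (insert \<phi> F)" using F(1) by simp
      show "insert \<phi> F \<subseteq> set (\<phi> # xs)" using F(2) by auto
      show "\<forall>\<theta>\<in>set (\<phi> # xs). \<theta> \<in> insert \<phi> F \<or> cnj_char \<theta> \<in> insert \<phi> F"
      proof
        fix \<theta> assume "\<theta> \<in> set (\<phi> # xs)"
        then consider "\<theta> = \<phi>" | "\<theta> \<in> set xs" by auto
        then show "\<theta> \<in> insert \<phi> F \<or> cnj_char \<theta> \<in> insert \<phi> F"
          using F(3)[of \<theta>] by cases auto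
      qed
      show "\<forall>\<theta>\<in>insert \<phi> F. \<forall>\<psi>\<in>insert \<phi> F. \<theta> \<noteq> \<psi> \<longrightarrow> \<theta> \<noteq> cnj_char \<psi>"
        by (intro ballI impI n)
      show "\<forall>\<theta>\<in>insert \<phi> F. m' \<theta> > 0" using m by (simp add: m'_def)
      show "\<forall>u. Re (\<Sum>\<phi>\<leftarrow>\<phi> # xs. \<phi> u) = (\<Sum>\<theta>\<in>insert \<phi> F. m' \<theta> * Re (\<theta> u))"
        unfolding sum by (simp only: list.map sum_list.Cons plus_complex.sel s) simp
    qed
  qed
qed

section \<open>Signatures of diagonalised quadratic forms\<close>

lemma real_ring_simps [simp]:
  "carrier real_ring = UNIV" "x \<oplus>\<^bsub>real_ring\<^esub> y = x + y" "x \<otimes>\<^bsub>real_ring\<^esub> y = x * y"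
  "\<one>\<^bsub>real_ring\<^esub> = 1" "\<zero>\<^bsub>real_ring\<^esub> = 0"
  by (simp_all add: real_ring_def)

lemma field_real_ring: "field real_ring"
proof -
  interpret cring real_ring
  proof (rule cringI)
    show "abelian_group real_ring"
      by (rule abelian_groupI) (auto intro: exI[of _ "- x" for x::real])
    show "comm_monoid real_ring" by (rule comm_monoidI) auto
  qed (auto simp: algebra_simps)
  show ?thesis
  proof (rule cring_fieldI)
    show "Units real_ring = carrier real_ring - {\<zero>\<^bsub>real_ring\<^esub>}"
    proof (rule Set.set_eqI)
      fix x :: real
      have "\<exists>y. y * x = 1 \<and> x * y = 1" if "x \<noteq> 0"
        using that by (intro exI[of _ "inverse x"]) simp
      then show "x \<in> Units real_ring \<longleftrightarrow> x \<in> carrier real_ring - {\<zero>\<^bsub>real_ring\<^esub>}"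
        by (auto simp: Units_def)
    qed
  qed
qed

definition linear_form :: "(real, 'v, 'm) module_scheme \<Rightarrow> ('v \<Rightarrow> real) \<Rightarrow> bool" where
  "linear_form V l \<longleftrightarrow> (\<forall>a\<in>carrier V. \<forall>b\<in>carrier V. l (a \<oplus>\<^bsub>V\<^esub> b) = l a + l b) \<and>
     (\<forall>c. \<forall>a\<in>carrier V. l (c \<odot>\<^bsub>V\<^esub> a) = c * l a)"

locale real_space = vectorspace real_ring V for V :: "(real, 'v, 'm) module_scheme"
begin

lemma linear_form_zero: "linear_form V l \<Longrightarrow> l \<zero>\<^bsub>V\<^esub> = 0"
proof -
  assume l: "linear_form V l"
  have "l (0 \<odot>\<^bsub>V\<^esub> \<zero>\<^bsub>V\<^esub>) = 0 * l \<zero>\<^bsub>V\<^esub>"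
    using l M.zero_closed unfolding linear_form_def by blast
  moreover have "0 \<odot>\<^bsub>V\<^esub> \<zero>\<^bsub>V\<^esub> = \<zero>\<^bsub>V\<^esub>"
    using smult_r_null[of 0] by simp
  ultimately show ?thesis by simp
qed

lemma linear_form_lincomb:
  assumes l: "linear_form V l" and "finite S" "S \<subseteq> carrier V"
  shows "l (lincomb a S) = (\<Sum>v\<in>S. a v * l v)"
  using assms(2,3)
proof (induction S rule: finite_induct)
  case empty
  then show ?case by (simp add: linear_form_zero[OF l])
next
  case (insert v S)
  have "lincomb a (insert v S) = (a v \<odot>\<^bsub>V\<^esub> v) \<oplus>\<^bsub>V\<^esub> lincomb a S"
    using insert by (intro lincomb_insert2) auto
  moreover have "lincomb a S \<in> carrier V" "a v \<odot>\<^bsub>V\<^esub> v \<in> carrier V" "v \<in> carrier V"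
    using insert by auto
  ultimately show ?case
    using insert l unfolding linear_form_def by simp
qed

text \<open>
  More than \<open>card P\<close> vectors have a nontrivial combination on which all \<open>card P\<close> forms vanish.
\<close>

lemma lin_indpt_bound:
  assumes "finite P" and l: "\<And>i. i \<in> P \<Longrightarrow> linear_form V (l i)"
    and W: "submodule real_ring W V" "\<And>w. w \<in> W \<Longrightarrow> (\<And>i. i \<in> P \<Longrightarrow> l i w = 0) \<Longrightarrow> w = \<zero>\<^bsub>V\<^esub>"
    and S: "S \<subseteq> W" "lin_indpt S"
  shows "finite S \<and> card S \<le> card P"
proof -
  have WV: "W \<subseteq> carrier V" using W(1) by (simp add: submodule_def)
  have bound: "card T \<le> card P" if T: "finite T" "T \<subseteq> S" for T
  proof (rule ccontr)
    assume "\<not> card T \<le> card P"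
    then have "card P < card T" by simp
    from underdetermined_system[OF assms(1) T(1) this, of "\<lambda>t i. l i t"] obtain c t where
      c: "t \<in> T" "c t \<noteq> 0" "\<And>i. i \<in> P \<Longrightarrow> (\<Sum>k\<in>T. c k * l i k) = 0" by blast
    have TV: "T \<subseteq> carrier V" using T S WV by auto
    have "lincomb c T \<in> W"
    proof -
      have "lincomb c T \<in> span T" unfolding span_def using T by auto
      also have "span T \<subseteq> W" using T S by (intro span_is_subset[OF _ W(1)]) auto
      finally show ?thesis .
    qed
    then have "lincomb c T = \<zero>\<^bsub>V\<^esub>"
      by (rule W(2)) (use linear_form_lincomb[OF l T(1) TV] c(3) in auto)
    then have "lin_dep S"
      unfolding lin_dep_def using T c by (intro exI[of _ T] exI[of _ c] exI[of _ t]) auto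
    then show False using S by simp
  qed
  have "finite S"
  proof (rule ccontr)
    assume "infinite S"
    then obtain T where "T \<subseteq> S" "finite T" "card T = Suc (card P)"
      using infinite_arbitrarily_large by blast
    with bound[of T] show False by simp
  qed
  with bound[of S] show ?thesis by simp
qed

lemma dim_subspace_bound:
  assumes "finite P" and l: "\<And>i. i \<in> P \<Longrightarrow> linear_form V (l i)"
    and W: "VectorSpace.subspace real_ring W V"
      "\<And>w. w \<in> W \<Longrightarrow> (\<And>i. i \<in> P \<Longrightarrow> l i w = 0) \<Longrightarrow> w = \<zero>\<^bsub>V\<^esub>"
  shows "vectorspace.dim real_ring (vs W) \<le> card P"
proof -
  have sub: "submodule real_ring W V" using W(1) by simp
  interpret W: vectorspace real_ring "vs W" by (rule subspace_is_vs[OF W(1)])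
  have li: "W.lin_dep S = lin_dep S" if "S \<subseteq> W" for S
    using span_li_not_depend(2)[OF that sub] by simp
  have b: "finite S \<and> card S \<le> card P" if "S \<subseteq> W" "W.lin_indpt S" for S
    by (rule lin_indpt_bound[OF assms(1) l sub W(2)]) (use that li in auto)
  have "W.lin_indpt {}" unfolding W.lin_dep_def by auto
  then obtain S where S: "finite S" "maximal S (\<lambda>S. S \<subseteq> carrier (vs W) \<and> W.lin_indpt S)"
    using maximal_exists[of "\<lambda>S. S \<subseteq> carrier (vs W) \<and> W.lin_indpt S" "card P" "{}"] b by auto
  have "W.basis S" by (rule W.max_li_is_basis[OF S(2)])
  then have "W.dim = card S" by (rule W.dim_basis[OF S(1)])
  moreover have "S \<subseteq> W" "W.lin_indpt S" using S(2) by (auto simp: maximal_def)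
  ultimately show ?thesis using b by simp
qed

text \<open>
  Sylvester's law of inertia in the form needed here. On a positive definite subspace the forms with
  positive coefficient have no common zero except \<open>0\<close>, which bounds the dimension; the vectors dual to
  these forms span a positive definite subspace that attains the bound.
\<close>

lemma pos_index_diagonal:
  assumes fin: "finite Ix" and l: "\<And>i. i \<in> Ix \<Longrightarrow> linear_form V (l i)"
    and e: "\<And>i. i \<in> Ix \<Longrightarrow> e i \<in> carrier V"
    and dual: "\<And>i j. i \<in> Ix \<Longrightarrow> j \<in> Ix \<Longrightarrow> l i (e j) = (if i = j then 1 else 0)"
    and q: "\<And>v. v \<in> carrier V \<Longrightarrow> q v = (\<Sum>i\<in>Ix. c i * (l i v)\<^sup>2)"
  shows "pos_index V q = card {i\<in>Ix. c i > 0}"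
proof -
  define P where "P = {i\<in>Ix. c i > 0}"
  have finP: "finite P" "P \<subseteq> Ix" using fin by (auto simp: P_def)
  let ?D = "{vectorspace.dim real_ring (vs W) | W.
     VectorSpace.subspace real_ring W V \<and> (\<forall>w\<in>W - {\<zero>\<^bsub>V\<^esub>}. q w > 0)}"
  have up: "d \<le> card P" if "d \<in> ?D" for d
  proof -
    from that obtain W where d: "d = vectorspace.dim real_ring (vs W)"
      and W: "VectorSpace.subspace real_ring W V" "\<And>w. w \<in> W \<Longrightarrow> w \<noteq> \<zero>\<^bsub>V\<^esub> \<Longrightarrow> q w > 0" by blast
    have WV: "W \<subseteq> carrier V" using is_module[OF W(1)] by (simp add: submodule_def)
    show ?thesis unfolding d
    proof (rule dim_subspace_bound[OF finP(1) l W(1)])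
      fix w assume w: "w \<in> W" and z: "\<And>i. i \<in> P \<Longrightarrow> l i w = 0"
      have "q w = (\<Sum>i\<in>Ix. c i * (l i w)\<^sup>2)" using w WV q by auto
      also have "\<dots> \<le> 0"
      proof (rule sum_nonpos)
        fix i assume "i \<in> Ix"
        then show "c i * (l i w)\<^sup>2 \<le> 0"
          using z[of i] by (cases "c i > 0") (auto simp: P_def mult_nonpos_nonneg)
      qed
      finally show "w = \<zero>\<^bsub>V\<^esub>" using W(2)[OF w] by force
    qed (use finP in auto)
  qed
  have "card P \<in> ?D"
  proof -
    define S where "S = e ` P"
    have inj: "inj_on e P"
    proof (rule inj_onI)
      fix i j assume "i \<in> P" "j \<in> P" "e i = e j"
      then show "i = j" using dual[of i i] dual[of i j] finP(2) by (cases "i = j") auto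
    qed
    have S: "finite S" "S \<subseteq> carrier V" "card S = card P"
      using finP e inj by (auto simp: S_def card_image)
    have lc: "l i (lincomb a S) = (if i \<in> P then a (e i) else 0)" if "i \<in> Ix" for i a
    proof -
      have "l i (lincomb a S) = (\<Sum>v\<in>S. a v * l i v)"
        by (rule linear_form_lincomb[OF l[OF that] S(1,2)])
      also have "\<dots> = (\<Sum>j\<in>P. a (e j) * l i (e j))"
        unfolding S_def by (subst sum.reindex[OF inj]) simp
      also have "\<dots> = (\<Sum>j\<in>P. if j = i then a (e j) else 0)"
        by (rule sum.cong) (use dual that finP in auto)
      finally show ?thesis using finP by simp
    qed
    have li: "lin_indpt S"
    proof (rule finite_lin_indpt2[OF S(1,2)])
      fix a assume z: "lincomb a S = \<zero>\<^bsub>V\<^esub>"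
      show "\<forall>v\<in>S. a v = \<zero>\<^bsub>real_ring\<^esub>"
      proof
        fix v assume "v \<in> S"
        then obtain i where i: "i \<in> P" "v = e i" by (auto simp: S_def)
        then have "a v = l i (lincomb a S)" using lc finP by auto
        also have "\<dots> = 0" unfolding z using linear_form_zero[OF l] i finP by auto
        finally show "a v = \<zero>\<^bsub>real_ring\<^esub>" by simp
      qed
    qed
    let ?W = "span S"
    have sub: "VectorSpace.subspace real_ring ?W V" by (rule span_is_subspace[OF S(2)])
    then have subm: "submodule real_ring ?W V" by simp
    interpret W: vectorspace real_ring "vs ?W" by (rule subspace_is_vs[OF sub])
    have SW: "S \<subseteq> ?W" by (rule in_own_span[OF S(2)])
    have "W.basis S"
      unfolding W.basis_def using span_li_not_depend[OF SW subm] li SW by simp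
    then have dim: "W.dim = card P" using W.dim_basis[OF S(1)] S(3) by simp
    have "q w > 0" if w: "w \<in> ?W" "w \<noteq> \<zero>\<^bsub>V\<^esub>" for w
    proof -
      obtain a where a: "w = lincomb a S" using w(1) finite_span[OF S(1,2)] by auto
      have "\<exists>i\<in>P. a (e i) \<noteq> 0"
      proof (rule ccontr)
        assume "\<not> ?thesis"
        then have "w = \<zero>\<^bsub>V\<^esub>" unfolding a by (intro lincomb_zero[OF S(2)]) (auto simp: S_def)
        with w show False by simp
      qed
      then obtain i0 where i0: "i0 \<in> P" "a (e i0) \<noteq> 0" by blast
      have "q w = (\<Sum>i\<in>Ix. c i * (l i w)\<^sup>2)" using span_closed[OF S(2) w(1)] q by auto
      also have "\<dots> = (\<Sum>i\<in>Ix. if i \<in> P then c i * (a (e i))\<^sup>2 else 0)"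
        by (rule sum.cong) (auto simp: a lc)
      also have "\<dots> > 0"
        by (rule sum_pos2[OF fin, of i0]) (use i0 finP in \<open>auto simp: P_def\<close>)
      finally show ?thesis .
    qed
    then show ?thesis using sub dim[symmetric] by (intro CollectI exI[of _ ?W]) auto
  qed
  then have "Max ?D = card P"
    using up by (intro Max_eqI finite_subset[of ?D "{..card P}"]) auto
  then show ?thesis by (simp add: pos_index_def P_def)
qed

lemma signature_diagonal:
  assumes fin: "finite Ix" and l: "\<And>i. i \<in> Ix \<Longrightarrow> linear_form V (l i)"
    and e: "\<And>i. i \<in> Ix \<Longrightarrow> e i \<in> carrier V"
    and dual: "\<And>i j. i \<in> Ix \<Longrightarrow> j \<in> Ix \<Longrightarrow> l i (e j) = (if i = j then 1 else 0)"
    and q: "\<And>v. v \<in> carrier V \<Longrightarrow> q v = (\<Sum>i\<in>Ix. c i * (l i v)\<^sup>2)"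
  shows "signature V q = int (card {i\<in>Ix. c i > 0}) - int (card {i\<in>Ix. c i < 0})"
proof -
  have "pos_index V q = card {i\<in>Ix. c i > 0}"
    by (rule pos_index_diagonal[OF assms])
  moreover have "pos_index V (\<lambda>v. - q v) = card {i\<in>Ix. - c i > 0}"
    by (rule pos_index_diagonal[OF fin l e dual]) (auto simp: q sum_negf)
  ultimately show ?thesis by (simp add: signature_def)
qed

text \<open>
  The vector dual to a form with coefficient zero lies in the radical.
\<close>

lemma nondegenerate_diagonal:
  assumes fin: "finite Ix" and l: "\<And>i. i \<in> Ix \<Longrightarrow> linear_form V (l i)"
    and e: "\<And>i. i \<in> Ix \<Longrightarrow> e i \<in> carrier V"
    and dual: "\<And>i j. i \<in> Ix \<Longrightarrow> j \<in> Ix \<Longrightarrow> l i (e j) = (if i = j then 1 else 0)"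
    and q: "\<And>v. v \<in> carrier V \<Longrightarrow> q v = (\<Sum>i\<in>Ix. c i * (l i v)\<^sup>2)"
    and nd: "nondegenerate V q" and i: "i \<in> Ix"
  shows "c i \<noteq> 0"
proof
  assume c: "c i = 0"
  have "q (e i \<oplus>\<^bsub>V\<^esub> b) - q (e i) - q b = 0" if b: "b \<in> carrier V" for b
  proof -
    have "q (e i \<oplus>\<^bsub>V\<^esub> b) = (\<Sum>j\<in>Ix. c j * (l j (e i) + l j b)\<^sup>2)"
      using q[of "e i \<oplus>\<^bsub>V\<^esub> b"] e[OF i] b l by (simp add: linear_form_def)
    also have "\<dots> = (\<Sum>j\<in>Ix. c j * (l j (e i))\<^sup>2 + c j * (l j b)\<^sup>2)"
      by (rule sum.cong) (use dual i c in auto)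
    finally show ?thesis using q[OF e[OF i]] q[OF b] by (simp add: sum.distrib)
  qed
  then have "e i = \<zero>\<^bsub>V\<^esub>" using nd e[OF i] unfolding nondegenerate_def by blast
  then have "l i (e i) = 0" using linear_form_zero[OF l[OF i]] by simp
  then show False using dual[OF i i] by simp
qed

end

section \<open>The trace on the quotient algebra\<close>

lemma poly3_ring_simps [simp]:
  "u \<in> carrier poly3_ring \<longleftrightarrow> poly3 u" "u \<otimes>\<^bsub>poly3_ring\<^esub> v = (\<lambda>p. u p * v p)" "\<one>\<^bsub>poly3_ring\<^esub> = (\<lambda>p. 1)"
  "\<zero>\<^bsub>poly3_ring\<^esub> = (\<lambda>p. 0)" "u \<oplus>\<^bsub>poly3_ring\<^esub> v = (\<lambda>p. u p + v p)"
  by (simp_all add: poly3_ring_def)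

lemma cring_poly3_ring: "cring poly3_ring"
proof (rule cringI)
  show "abelian_group poly3_ring"
  proof (rule abelian_groupI)
    fix u assume "u \<in> carrier poly3_ring"
    then show "\<exists>v\<in>carrier poly3_ring. v \<oplus>\<^bsub>poly3_ring\<^esub> u = \<zero>\<^bsub>poly3_ring\<^esub>"
      by (intro bexI[of _ "\<lambda>p. - u p"]) (auto simp: real_polynomial_function_minus)
  qed (auto simp: poly3_intros algebra_simps)
  show "comm_monoid poly3_ring"
    by (rule comm_monoidI) (auto simp: poly3_intros algebra_simps)
qed (auto simp: algebra_simps)

locale poly_ideal =
  fixes I :: "(real^3 \<Rightarrow> real) set"
  assumes ideal_I: "ideal I poly3_ring"
begin

interpretation ideal I poly3_ring by (rule ideal_I)

abbreviation "A \<equiv> quot_alg I"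
abbreviation "cls \<equiv> quot_class I"

lemma ideal_poly3: "h \<in> I \<Longrightarrow> poly3 h"
  using a_Hcarr by simp

lemma zero_in_I: "(\<lambda>p. 0) \<in> I"
  using additive_subgroup.zero_closed[OF ideal.axioms(1)[OF ideal_I]] by simp

lemma mem_cls: "v \<in> cls u \<longleftrightarrow> (\<exists>h\<in>I. v = (\<lambda>p. h p + u p))"
  by (auto simp: quot_class_def a_r_coset_def' )

lemma carrier_A: "carrier A = cls ` Collect poly3"
  by (auto simp: quot_alg_def ring.extend_def FactRing_def A_RCOSETS_def' quot_class_def)

lemma cls_in_A [simp]: "poly3 u \<Longrightarrow> cls u \<in> carrier A"
  by (simp add: carrier_A)

lemma in_A_cases: "a \<in> carrier A \<Longrightarrow> (\<And>u. poly3 u \<Longrightarrow> a = cls u \<Longrightarrow> P) \<Longrightarrow> P"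
  by (auto simp: carrier_A)

lemma A_ops:
  "poly3 u \<Longrightarrow> poly3 v \<Longrightarrow> cls u \<oplus>\<^bsub>A\<^esub> cls v = cls (\<lambda>p. u p + v p)"
  "poly3 u \<Longrightarrow> poly3 v \<Longrightarrow> cls u \<otimes>\<^bsub>A\<^esub> cls v = cls (\<lambda>p. u p * v p)"
  "\<zero>\<^bsub>A\<^esub> = cls (\<lambda>p. 0)"
  "poly3 u \<Longrightarrow> c \<odot>\<^bsub>A\<^esub> cls u = cls (\<lambda>p. c * u p)"
  using a_rcos_sum[of u v] rcoset_mult_add[of u v] rcoset_mult_add[of "\<lambda>p. c" u]
    a_rcos_const[OF zero_in_I]
  by (simp_all add: quot_alg_def ring.extend_def FactRing_def module.fields_def quot_class_def poly3_intros)

lemma cls_ideal: "h \<in> I \<Longrightarrow> cls h = \<zero>\<^bsub>A\<^esub>"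
  using a_rcos_const[of h] a_rcos_const[OF zero_in_I] by (simp add: A_ops quot_class_def)

text \<open>
  A representative of a residue class; a character that vanishes on \<open>I\<close> takes the same value on all of
  them.
\<close>

definition rep :: "(real^3 \<Rightarrow> real) set \<Rightarrow> real^3 \<Rightarrow> real" where
  "rep a = (SOME u. u \<in> a)"

lemma rep_cls: "\<exists>h\<in>I. rep (cls u) = (\<lambda>p. h p + u p)"
proof -
  have "u \<in> cls u" unfolding mem_cls using zero_in_I by (intro bexI[of _ "\<lambda>p. 0"]) auto
  then have "rep (cls u) \<in> cls u" unfolding rep_def by (rule someI[of "\<lambda>v. v \<in> cls u"])
  then show ?thesis by (simp add: mem_cls)
qed

lemma vectorspace_A: "vectorspace real_ring A"
proof (rule vs_criteria[OF field_real_ring])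
  show "\<forall>v\<in>carrier A. \<exists>neg_v\<in>carrier A. v \<oplus>\<^bsub>A\<^esub> neg_v = \<zero>\<^bsub>A\<^esub>"
  proof
    fix a assume "a \<in> carrier A"
    then obtain u where u: "poly3 u" "a = cls u" by (rule in_A_cases)
    then show "\<exists>neg_v\<in>carrier A. a \<oplus>\<^bsub>A\<^esub> neg_v = \<zero>\<^bsub>A\<^esub>"
      by (intro bexI[of _ "cls (\<lambda>p. - u p)"]) (simp_all add: A_ops real_polynomial_function_minus)
  qed
qed (auto simp: carrier_A A_ops poly3_intros algebra_simps intro!: arg_cong[where f = cls] elim!: in_A_cases)

sublocale A: real_space A
  by (simp add: real_space_def vectorspace_A)

lemma mult_A_closed: "a \<in> carrier A \<Longrightarrow> b \<in> carrier A \<Longrightarrow> a \<otimes>\<^bsub>A\<^esub> b \<in> carrier A"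
  by (auto simp: carrier_A A_ops poly3_intros)

lemma char_rep:
  assumes "is_char \<phi>" "\<And>h. h \<in> I \<Longrightarrow> \<phi> h = 0" "poly3 u"
  shows "\<phi> (rep (cls u)) = \<phi> u"
proof -
  obtain h where h: "h \<in> I" "rep (cls u) = (\<lambda>p. h p + u p)" using rep_cls by blast
  then show ?thesis using char_add[OF assms(1) ideal_poly3[OF h(1)] assms(3)] assms(2) by simp
qed

lemma linear_form_char:
  assumes "is_char \<phi>" "\<And>h. h \<in> I \<Longrightarrow> \<phi> h = 0"
  shows "linear_form A (\<lambda>a. Re (s * \<phi> (rep a)))" "linear_form A (\<lambda>a. Im (s * \<phi> (rep a)))"
  unfolding linear_form_def
  by (auto simp: carrier_A A_ops poly3_intros char_rep[OF assms] char_add[OF assms(1)]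
      char_scale[OF assms(1)] algebra_simps)

context
  fixes B assumes B: "finite B" "A.basis B"
begin

text \<open>
  The coordinate vector that occurs in the definition of the trace.
\<close>

definition coord :: "(real^3 \<Rightarrow> real) set \<Rightarrow> (real^3 \<Rightarrow> real) set \<Rightarrow> real" where
  "coord a = (THE c. c \<in> B \<rightarrow>\<^sub>E UNIV \<and> A.lincomb c B = a)"

lemma B_carrier: "B \<subseteq> carrier A"
  using B(2) by (simp add: A.basis_def)

lemma coord_unique_ex: "a \<in> carrier A \<Longrightarrow> \<exists>!c. c \<in> B \<rightarrow>\<^sub>E UNIV \<and> A.lincomb c B = a"
  using A.basis_criterion[OF B(1) B_carrier] B(2) by simp

lemma lincomb_coord: "a \<in> carrier A \<Longrightarrow> A.lincomb (coord a) B = a"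
  unfolding coord_def using theI'[OF coord_unique_ex] by blast

lemma coord_lincomb:
  assumes "b \<in> B"
  shows "coord (A.lincomb c B) b = c b"
proof -
  have eq: "A.lincomb (restrict c B) B = A.lincomb c B"
    by (rule A.lincomb_cong) (use B_carrier in auto)
  have "A.lincomb c B \<in> carrier A" using B_carrier by auto
  then have "coord (A.lincomb c B) = restrict c B"
    unfolding coord_def by (rule the1_equality[OF coord_unique_ex]) (use eq in auto)
  then show ?thesis using assms by simp
qed

lemma linear_form_coord:
  assumes "b \<in> B"
  shows "linear_form A (\<lambda>a. coord a b)"
  unfolding linear_form_def
proof (intro conjI ballI allI)
  fix x y assume xy: "x \<in> carrier A" "y \<in> carrier A"
  have "x \<oplus>\<^bsub>A\<^esub> y = A.lincomb (\<lambda>v. coord x v + coord y v) B"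
    using A.lincomb_sum[OF B(1) B_carrier, of "coord x" "coord y"] by (simp add: lincomb_coord xy)
  then show "coord (x \<oplus>\<^bsub>A\<^esub> y) b = coord x b + coord y b" by (simp add: coord_lincomb assms)
next
  fix c x assume x: "x \<in> carrier A"
  have "c \<odot>\<^bsub>A\<^esub> x = A.lincomb (\<lambda>v. c * coord x v) B"
    using A.lincomb_smult[OF B_carrier, of "coord x" c] by (simp add: lincomb_coord x)
  then show "coord (c \<odot>\<^bsub>A\<^esub> x) b = c * coord x b" by (simp add: coord_lincomb assms)
qed

lemma coord_basis:
  assumes "i \<in> B" "j \<in> B"
  shows "coord j i = (if i = j then 1 else 0)"
proof -
  have j: "j \<in> carrier A" using assms B_carrier by auto
  have z: "A.lincomb (\<lambda>v. if v = j then 1 else 0) (B - {j}) = \<zero>\<^bsub>A\<^esub>"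
    by (rule A.lincomb_zero) (use B_carrier in auto)
  have "A.lincomb (\<lambda>v. if v = j then 1 else 0) B = (1 \<odot>\<^bsub>A\<^esub> j) \<oplus>\<^bsub>A\<^esub> \<zero>\<^bsub>A\<^esub>"
    using A.lincomb_del2[OF B(1) B_carrier, of "\<lambda>v. if v = j then 1 else 0" j] assms
    unfolding z by simp
  also have "\<dots> = j" using A.smult_one[OF j] A.M.r_zero[OF j] by simp
  finally show ?thesis using coord_lincomb[OF assms(1), of "\<lambda>v. if v = j then 1 else 0"] by simp
qed

lemma linear_form_mult_coord:
  assumes "b \<in> B" "poly3 u"
  shows "linear_form A (\<lambda>a. coord (cls u \<otimes>\<^bsub>A\<^esub> a) b)"
  unfolding linear_form_def
proof (intro conjI ballI allI)
  fix x y assume "x \<in> carrier A" "y \<in> carrier A"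
  then obtain v w where vw: "poly3 v" "poly3 w" and xy: "x = cls v" "y = cls w" by (auto simp: carrier_A)
  have "cls u \<otimes>\<^bsub>A\<^esub> (x \<oplus>\<^bsub>A\<^esub> y) = (cls u \<otimes>\<^bsub>A\<^esub> x) \<oplus>\<^bsub>A\<^esub> (cls u \<otimes>\<^bsub>A\<^esub> y)"
    using assms(2) vw by (simp add: xy A_ops poly3_intros algebra_simps)
  moreover have "cls u \<otimes>\<^bsub>A\<^esub> x \<in> carrier A" "cls u \<otimes>\<^bsub>A\<^esub> y \<in> carrier A"
    using assms(2) vw by (auto simp: xy mult_A_closed)
  ultimately show "coord (cls u \<otimes>\<^bsub>A\<^esub> (x \<oplus>\<^bsub>A\<^esub> y)) b = coord (cls u \<otimes>\<^bsub>A\<^esub> x) b + coord (cls u \<otimes>\<^bsub>A\<^esub> y) b"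
    using linear_form_coord[OF assms(1)] by (simp add: linear_form_def)
next
  fix c x assume "x \<in> carrier A"
  then obtain v where v: "poly3 v" and x: "x = cls v" by (auto simp: carrier_A)
  have "cls u \<otimes>\<^bsub>A\<^esub> (c \<odot>\<^bsub>A\<^esub> x) = c \<odot>\<^bsub>A\<^esub> (cls u \<otimes>\<^bsub>A\<^esub> x)"
    using assms(2) v by (simp add: x A_ops poly3_intros algebra_simps)
  moreover have "cls u \<otimes>\<^bsub>A\<^esub> x \<in> carrier A" using assms(2) v by (auto simp: x mult_A_closed)
  ultimately show "coord (cls u \<otimes>\<^bsub>A\<^esub> (c \<odot>\<^bsub>A\<^esub> x)) b = c * coord (cls u \<otimes>\<^bsub>A\<^esub> x) b"
    using linear_form_coord[OF assms(1)] by (simp add: linear_form_def)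
qed

definition mult_matrix where
  "mult_matrix u i j = complex_of_real (coord (cls u \<otimes>\<^bsub>A\<^esub> j) i)"

lemma is_rep_mult_matrix: "is_rep B mult_matrix"
  unfolding is_rep_def
proof (intro conjI allI impI ballI)
  fix u v i j assume uv: "poly3 u" "poly3 v" and ij: "i \<in> B" "j \<in> B"
  obtain w where w: "poly3 w" "j = cls w" using ij B_carrier by (auto simp: carrier_A)
  have "cls (\<lambda>p. u p + v p) \<otimes>\<^bsub>A\<^esub> j = (cls u \<otimes>\<^bsub>A\<^esub> j) \<oplus>\<^bsub>A\<^esub> (cls v \<otimes>\<^bsub>A\<^esub> j)"
    using uv w by (simp add: A_ops poly3_intros algebra_simps)
  moreover have cl: "cls u \<otimes>\<^bsub>A\<^esub> j \<in> carrier A" "cls v \<otimes>\<^bsub>A\<^esub> j \<in> carrier A"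
    using uv w by (auto simp: mult_A_closed)
  ultimately show "mult_matrix (\<lambda>p. u p + v p) i j = mult_matrix u i j + mult_matrix v i j"
    using linear_form_coord[OF ij(1)] by (simp add: linear_form_def mult_matrix_def)
  have "cls (\<lambda>p. u p * v p) \<otimes>\<^bsub>A\<^esub> j = cls u \<otimes>\<^bsub>A\<^esub> A.lincomb (coord (cls v \<otimes>\<^bsub>A\<^esub> j)) B"
    unfolding lincomb_coord[OF cl(2)] using uv w by (simp add: A_ops poly3_intros algebra_simps)
  then have "coord (cls (\<lambda>p. u p * v p) \<otimes>\<^bsub>A\<^esub> j) i
      = (\<Sum>l\<in>B. coord (cls v \<otimes>\<^bsub>A\<^esub> j) l * coord (cls u \<otimes>\<^bsub>A\<^esub> l) i)"
    using A.linear_form_lincomb[OF linear_form_mult_coord[OF ij(1) uv(1)] B(1) B_carrier] by simp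
  then show "mult_matrix (\<lambda>p. u p * v p) i j = (\<Sum>l\<in>B. mult_matrix u i l * mult_matrix v l j)"
    by (simp add: mult_matrix_def mult.commute)
next
  fix c i j assume ij: "i \<in> B" "j \<in> B"
  obtain w where w: "poly3 w" "j = cls w" using ij B_carrier by (auto simp: carrier_A)
  then have "cls (\<lambda>p. c) \<otimes>\<^bsub>A\<^esub> j = c \<odot>\<^bsub>A\<^esub> j" by (simp add: A_ops poly3_intros)
  moreover have "j \<in> carrier A" using w by simp
  ultimately show "mult_matrix (\<lambda>p. c) i j = (if i = j then of_real c else 0)"
    using linear_form_coord[OF ij(1)] coord_basis[OF ij] by (simp add: linear_form_def mult_matrix_def)
qed

lemma mult_matrix_ideal:
  assumes "h \<in> I" "i \<in> B" "j \<in> B"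
  shows "mult_matrix h i j = 0"
proof -
  obtain w where w: "poly3 w" "j = cls w" using assms B_carrier by (auto simp: carrier_A)
  then have "cls h \<otimes>\<^bsub>A\<^esub> j = \<zero>\<^bsub>A\<^esub>" by (simp add: cls_ideal[OF assms(1)]) (simp add: A_ops poly3_intros)
  then show ?thesis
    using A.linear_form_zero[OF linear_form_coord[OF assms(2)]] by (simp add: mult_matrix_def)
qed

text \<open>
  At a zero \<open>p\<close> of \<open>I\<close>, evaluation is a well-defined functional on the quotient, and
  \<open>ev(u a) = u(p) ev(a)\<close> says that its coordinate vector is a left eigenvector of all multiplications. It is
  nonzero as \<open>ev(1) = 1\<close>. Therefore evaluation at \<open>p\<close> occurs among the characters in the trace.
\<close>

lemma eval_char_left_eigenvector:
  assumes "p \<in> zero_set I"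
  shows "\<exists>b\<in>B. eval_char p (rep b) \<noteq> 0"
    and "poly3 u \<Longrightarrow> j \<in> B \<Longrightarrow> (\<Sum>i\<in>B. eval_char p (rep i) * mult_matrix u i j) = eval_char p u * eval_char p (rep j)"
proof -
  have k: "eval_char p h = 0" if "h \<in> I" for h
    using that assms by (simp add: zero_set_def eval_char_def)
  note cr = char_rep[OF is_char_eval k]
  have im: "Im (eval_char p u) = 0" for u by (simp add: eval_char_def)
  have l: "linear_form A (\<lambda>a. Re (eval_char p (rep a)))"
    using linear_form_char(1)[OF is_char_eval k, where s = 1] by simp
  have expand: "(\<Sum>i\<in>B. eval_char p (rep i) * of_real (coord a i)) = eval_char p (rep a)" if "a \<in> carrier A" for a
  proof -
    have "Re (eval_char p (rep a)) = (\<Sum>i\<in>B. coord a i * Re (eval_char p (rep i)))"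
      using A.linear_form_lincomb[OF l B(1) B_carrier, of "coord a"] by (simp add: lincomb_coord that)
    then show ?thesis using im by (simp add: complex_eq_iff mult.commute)
  qed
  show "\<exists>b\<in>B. eval_char p (rep b) \<noteq> 0"
  proof (rule ccontr)
    assume "\<not> ?thesis"
    then have "eval_char p (rep (cls (\<lambda>p. 1))) = 0"
      using expand[of "cls (\<lambda>p. 1)"] by (simp add: poly3_intros)
    then show False by (simp add: cr poly3_intros) (simp add: eval_char_def poly3_intros)
  qed
  assume u: "poly3 u" and j: "j \<in> B"
  obtain w where w: "poly3 w" "j = cls w" using j B_carrier by (auto simp: carrier_A)
  have "cls u \<otimes>\<^bsub>A\<^esub> j \<in> carrier A" using u w by (auto simp: mult_A_closed)
  from expand[OF this] show "(\<Sum>i\<in>B. eval_char p (rep i) * mult_matrix u i j) = eval_char p u * eval_char p (rep j)"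
    using u w by (simp add: mult_matrix_def A_ops cr poly3_intros char_mult[OF is_char_eval])
qed

text \<open>
  Real-valued characters are evaluations at points, and these points are zeros of \<open>I\<close> because the
  multiplications by elements of \<open>I\<close> vanish. The converse inclusion uses that a real-valued character is
  its own conjugate, so it survives the choice of representatives.
\<close>

lemma trace_characters_of_basis:
  "\<exists>F m. finite F \<and> (\<forall>\<phi>\<in>F. is_char \<phi> \<and> (\<forall>h\<in>I. \<phi> h = 0) \<and> m \<phi> > (0::real)) \<and>
     (\<forall>\<phi>\<in>F. \<forall>\<psi>\<in>F. \<phi> \<noteq> \<psi> \<longrightarrow> \<phi> \<noteq> cnj_char \<psi>) \<and>
     eval_char ` zero_set I = {\<phi>\<in>F. \<forall>u. Im (\<phi> u) = 0} \<and>
     (\<forall>u. poly3 u \<longrightarrow> (\<Sum>b\<in>B. coord (cls u \<otimes>\<^bsub>A\<^esub> b) b) = (\<Sum>\<phi>\<in>F. m \<phi> * Re (\<phi> u)))"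
proof -
  obtain xs where xs: "\<forall>\<phi>\<in>set xs. is_char \<phi> \<and>
        (\<forall>u. poly3 u \<longrightarrow> (\<forall>i\<in>B. \<forall>j\<in>B. mult_matrix u i j = 0) \<longrightarrow> \<phi> u = 0)"
    and tr: "\<forall>u. poly3 u \<longrightarrow> (\<Sum>i\<in>B. mult_matrix u i i) = (\<Sum>\<phi>\<leftarrow>xs. \<phi> u)"
    and left: "\<forall>w \<phi>. (\<exists>i\<in>B. w i \<noteq> 0) \<longrightarrow>
        (\<forall>u. poly3 u \<longrightarrow> (\<forall>j\<in>B. (\<Sum>i\<in>B. w i * mult_matrix u i j) = \<phi> u * w j)) \<longrightarrow>
       (\<exists>\<phi>'\<in>set xs. \<forall>u. poly3 u \<longrightarrow> \<phi> u = \<phi>' u)"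
    by (rule exE[OF rep_characters[OF B(1) is_rep_mult_matrix]], elim conjE, rule that)
  obtain F m where F: "finite F" "F \<subseteq> set xs" "\<forall>\<phi>\<in>set xs. \<phi> \<in> F \<or> cnj_char \<phi> \<in> F"
    "\<forall>\<phi>\<in>F. \<forall>\<psi>\<in>F. \<phi> \<noteq> \<psi> \<longrightarrow> \<phi> \<noteq> cnj_char \<psi>" "\<forall>\<phi>\<in>F. m \<phi> > (0::real)"
    "\<forall>u. Re (\<Sum>\<phi>\<leftarrow>xs. \<phi> u) = (\<Sum>\<phi>\<in>F. m \<phi> * Re (\<phi> u))"
    by (rule exE[OF collect_conjugate_characters[of xs]], elim exE conjE, rule that)
  have char: "is_char \<phi>" if "\<phi> \<in> F" for \<phi> using that F(2) xs by auto
  have kill: "\<phi> h = 0" if "\<phi> \<in> F" "h \<in> I" for \<phi> h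
  proof -
    have "\<forall>i\<in>B. \<forall>j\<in>B. mult_matrix h i j = 0" using mult_matrix_ideal[OF that(2)] by simp
    then show ?thesis using that F(2) xs ideal_poly3[OF that(2)] by auto
  qed
  have "eval_char ` zero_set I = {\<phi>\<in>F. \<forall>u. Im (\<phi> u) = 0}"
  proof (intro equalityI subsetI)
    fix \<phi> assume "\<phi> \<in> eval_char ` zero_set I"
    then obtain p where p: "p \<in> zero_set I" "\<phi> = eval_char p" by blast
    have "\<exists>\<phi>'\<in>set xs. \<forall>u. poly3 u \<longrightarrow> eval_char p u = \<phi>' u"
      by (rule mp[OF mp[OF spec[OF spec[OF left, of "\<lambda>b. eval_char p (rep b)"], of "eval_char p"]]])
        (use eval_char_left_eigenvector[OF p(1)] in auto)
    then obtain \<phi>' where \<phi>': "\<phi>' \<in> set xs" "\<forall>u. poly3 u \<longrightarrow> eval_char p u = \<phi>' u" by blast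
    have "eval_char p = \<phi>'"
    proof
      fix u show "eval_char p u = \<phi>' u"
        using \<phi>' xs by (cases "poly3 u") (auto simp: eval_char_def is_char_def)
    qed
    then have "\<phi> \<in> set xs" using \<phi>' p by simp
    moreover have "cnj_char \<phi> = \<phi>" by (rule ext) (simp add: p eval_char_def)
    ultimately have "\<phi> \<in> F" using F(3) by auto
    then show "\<phi> \<in> {\<phi>\<in>F. \<forall>u. Im (\<phi> u) = 0}" by (simp add: p eval_char_def)
  next
    fix \<phi> assume "\<phi> \<in> {\<phi>\<in>F. \<forall>u. Im (\<phi> u) = 0}"
    then have \<phi>: "\<phi> \<in> F" "\<And>u. Im (\<phi> u) = 0" by auto
    define p where "p = (\<chi> k. Re (\<phi> (\<lambda>p. p $ k)))"
    have eq: "\<phi> = eval_char p" unfolding p_def by (rule real_char_eq_eval[OF char[OF \<phi>(1)] \<phi>(2)])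
    have "u p = 0" if "u \<in> I" for u
    proof -
      have "eval_char p u = 0" using kill[OF \<phi>(1) that] eq by simp
      then show ?thesis using ideal_poly3[OF that] by (simp add: eval_char_def)
    qed
    then show "\<phi> \<in> eval_char ` zero_set I" using eq by (auto simp: zero_set_def)
  qed
  moreover have "(\<Sum>b\<in>B. coord (cls u \<otimes>\<^bsub>A\<^esub> b) b) = (\<Sum>\<phi>\<in>F. m \<phi> * Re (\<phi> u))" if "poly3 u" for u
  proof -
    have "(\<Sum>b\<in>B. coord (cls u \<otimes>\<^bsub>A\<^esub> b) b) = Re (\<Sum>i\<in>B. mult_matrix u i i)"
      by (simp add: mult_matrix_def)
    then show ?thesis using tr F(6) that by simp
  qed
  ultimately show ?thesis
    by (intro exI[of _ F] exI[of _ m]) (use F char kill in auto)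
qed

end

lemma trace_characters:
  assumes "A.fin_dim"
  shows "\<exists>F m. finite F \<and> (\<forall>\<phi>\<in>F. is_char \<phi> \<and> (\<forall>h\<in>I. \<phi> h = 0) \<and> m \<phi> > (0::real)) \<and>
     (\<forall>\<phi>\<in>F. \<forall>\<psi>\<in>F. \<phi> \<noteq> \<psi> \<longrightarrow> \<phi> \<noteq> cnj_char \<psi>) \<and>
     eval_char ` zero_set I = {\<phi>\<in>F. \<forall>u. Im (\<phi> u) = 0} \<and>
     (\<forall>u. poly3 u \<longrightarrow> mult_trace A (cls u) = (\<Sum>\<phi>\<in>F. m \<phi> * Re (\<phi> u)))"
proof -
  define B where "B = (SOME B. finite B \<and> A.basis B)"
  have B: "finite B" "A.basis B"
    using someI_ex[OF A.finite_basis_exists[OF assms]] by (auto simp: B_def)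
  have "mult_trace A (cls u) = (\<Sum>b\<in>B. coord B (cls u \<otimes>\<^bsub>A\<^esub> b) b)" for u
    by (simp add: mult_trace_def lin_trace_def B_def[symmetric] coord_def[OF B] Let_def)
  then show ?thesis using trace_characters_of_basis[OF B] by simp
qed

end

section \<open>The signature of a weighted trace form\<close>

context poly_ideal
begin

text \<open>
  A multivariate Hermite theorem. The trace form is \<open>\<Sum>\<phi>. m \<phi> * Re (\<phi> g * (\<phi> h)\<^sup>2)\<close>. A real-valued \<open>\<phi>\<close>, which is
  evaluation at some \<open>p\<close>, gives one square with coefficient \<open>m \<phi> * g p\<close>; a non-real one gives a
  difference of two squares if \<open>\<phi> g \<noteq> 0\<close>, and nothing otherwise. The non-real characters thus contribute
  equally to both indices.
\<close>

theorem signature_trace_form: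
  assumes fd: "A.fin_dim" and g: "poly3 g"
    and q_eq: "\<And>h. h \<in> carrier A \<Longrightarrow> q h = mult_trace A (cls g \<otimes>\<^bsub>A\<^esub> (h \<otimes>\<^bsub>A\<^esub> h))"
  shows "finite (zero_set I)"
    and "signature A q = int (card {p\<in>zero_set I. g p > 0}) - int (card {p\<in>zero_set I. g p < 0})"
    and "nondegenerate A q \<Longrightarrow> p \<in> zero_set I \<Longrightarrow> g p \<noteq> 0"
proof -
  obtain F m where finF: "finite F"
    and F: "\<forall>\<phi>\<in>F. is_char \<phi> \<and> (\<forall>h\<in>I. \<phi> h = 0) \<and> m \<phi> > (0::real)"
    and conj: "\<forall>\<phi>\<in>F. \<forall>\<psi>\<in>F. \<phi> \<noteq> \<psi> \<longrightarrow> \<phi> \<noteq> cnj_char \<psi>"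
    and real: "eval_char ` zero_set I = {\<phi>\<in>F. \<forall>u. Im (\<phi> u) = 0}"
    and tr: "\<forall>u. poly3 u \<longrightarrow> mult_trace A (cls u) = (\<Sum>\<phi>\<in>F. m \<phi> * Re (\<phi> u))"
    by (rule exE[OF trace_characters[OF fd]], elim exE conjE, rule that)
  have char: "is_char \<phi>" and kill: "\<And>h. h \<in> I \<Longrightarrow> \<phi> h = 0" and m: "m \<phi> > 0" if "\<phi> \<in> F" for \<phi>
    using F that by auto
  define R where "R = {\<phi>\<in>F. \<forall>u. Im (\<phi> u) = 0}"
  have RF: "R \<subseteq> F" and realR: "\<And>\<phi> u. \<phi> \<in> R \<Longrightarrow> Im (\<phi> u) = 0" by (auto simp: R_def)
  have bij: "bij_betw eval_char (zero_set I) R"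
    using real eval_char_inj by (auto simp: bij_betw_def R_def intro: inj_on_subset)
  then show "finite (zero_set I)"
    using finF RF finite_subset bij_betw_finite by blast
  \<comment> \<open>the value \<open>1\<close> for \<open>\<phi> g = 0\<close> keeps the forms independent; their coefficient is then zero\<close>
  define s where "s \<phi> = (if \<phi> \<in> R \<or> \<phi> g = 0 then 1 else csqrt (\<phi> g))" for \<phi>
  have s0: "s \<phi> \<noteq> 0" for \<phi> by (auto simp: s_def)
  define l where "l i a = (if snd i then Re (s (fst i) * fst i (rep a)) else Im (s (fst i) * fst i (rep a)))"
    for i :: "((real^3 \<Rightarrow> real) \<Rightarrow> complex) \<times> bool" and a
  define c where "c i = (if fst i \<in> R then m (fst i) * Re (fst i g)
      else if fst i g = 0 then 0 else if snd i then m (fst i) else - m (fst i))"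
    for i :: "((real^3 \<Rightarrow> real) \<Rightarrow> complex) \<times> bool"
  \<comment> \<open>the flag selects real or imaginary part; the imaginary part of a real-valued character is left out\<close>
  define Ix where "Ix = F \<times> {True} \<union> (F - R) \<times> {False}"
  have finIx: "finite Ix" using finF by (simp add: Ix_def)
  have IxF: "fst i \<in> F" if "i \<in> Ix" for i using that by (auto simp: Ix_def)
  have lin: "linear_form A (l i)" if "i \<in> Ix" for i
    using linear_form_char[OF char[OF IxF[OF that]] kill[OF IxF[OF that]], where s = "s (fst i)"]
    by (cases "snd i") (simp_all add: l_def[abs_def])
  have "\<exists>e. e \<in> carrier A \<and> (\<forall>i\<in>Ix. l i e = (if i = j then 1 else 0))" if j: "j \<in> Ix" for j
  proof -
    define w where "w = (if snd j then 1 else \<i>) / s (fst j)"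
    have imw: "Im w = 0" if "\<And>u. Im (fst j u) = 0"
    proof -
      have "fst j \<in> R" using that IxF[OF j] by (simp add: R_def)
      then have "snd j" using j by (auto simp: Ix_def)
      with \<open>fst j \<in> R\<close> show ?thesis by (simp add: w_def s_def)
    qed
    have "\<exists>u. poly3 u \<and> fst j u = w \<and> (\<forall>\<psi>\<in>F. \<psi> \<noteq> fst j \<longrightarrow> \<psi> u = 0)"
    proof (rule char_dual[of F "fst j" w])
      show "is_char \<phi>" if "\<phi> \<in> F" for \<phi> by (rule char[OF that])
      show "\<phi> \<noteq> cnj_char \<psi>" if "\<phi> \<in> F" "\<psi> \<in> F" "\<phi> \<noteq> \<psi>" for \<phi> \<psi>
        by (rule mp[OF bspec[OF bspec[OF conj that(1)] that(2)] that(3)])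
      show "Im w = 0" if "\<And>u. Im (fst j u) = 0" by (rule imw[OF that])
    qed (use finF IxF[OF j] in auto)
    then obtain u where u: "poly3 u" "fst j u = w" and u0: "\<forall>\<psi>\<in>F. \<psi> \<noteq> fst j \<longrightarrow> \<psi> u = 0"
      by (elim exE conjE) (rule that)
    have "l i (cls u) = (if i = j then 1 else 0)" if i: "i \<in> Ix" for i
    proof -
      have r: "fst i (rep (cls u)) = fst i u" by (rule char_rep[OF char[OF IxF[OF i]] kill[OF IxF[OF i]] u(1)])
      show ?thesis
      proof (cases "fst i = fst j")
        case True
        then have "s (fst i) * fst i u = (if snd j then 1 else \<i>)"
          using u(2) s0[of "fst j"] by (simp add: w_def)
        then show ?thesis using True unfolding l_def r by (auto simp: prod_eq_iff)
      next
        case False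
        then have "fst i u = 0" using u0 IxF[OF i] by simp
        then show ?thesis using False unfolding l_def r by auto
      qed
    qed
    then show ?thesis using u(1) by (intro exI[of _ "cls u"]) simp
  qed
  then have "\<forall>j\<in>Ix. \<exists>e. e \<in> carrier A \<and> (\<forall>i\<in>Ix. l i e = (if i = j then 1 else 0))" by (rule ballI)
  from bchoice[OF this] obtain e where
    e0: "\<forall>j\<in>Ix. e j \<in> carrier A \<and> (\<forall>i\<in>Ix. l i (e j) = (if i = j then 1 else 0))" by (rule exE)
  have e: "e j \<in> carrier A" if "j \<in> Ix" for j using e0 that by simp
  have dual: "l i (e j) = (if i = j then 1 else 0)" if "i \<in> Ix" "j \<in> Ix" for i j
    using e0 that by simp
  have q: "q a = (\<Sum>i\<in>Ix. c i * (l i a)\<^sup>2)" if "a \<in> carrier A" for a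
  proof -
    obtain h where h: "poly3 h" "a = cls h" using \<open>a \<in> carrier A\<close> by (rule in_A_cases)
    have "(\<Sum>i\<in>Ix. c i * (l i a)\<^sup>2) =
        (\<Sum>\<phi>\<in>F. c (\<phi>, True) * (l (\<phi>, True) a)\<^sup>2) + (\<Sum>\<phi>\<in>F - R. c (\<phi>, False) * (l (\<phi>, False) a)\<^sup>2)"
    proof -
      have "(\<Sum>i\<in>Ix. c i * (l i a)\<^sup>2) = (\<Sum>i\<in>F \<times> {True}. c i * (l i a)\<^sup>2) + (\<Sum>i\<in>(F - R) \<times> {False}. c i * (l i a)\<^sup>2)"
        unfolding Ix_def by (rule sum.union_disjoint) (use finF in auto)
      moreover have "(\<Sum>i\<in>S \<times> {b}. f i) = (\<Sum>\<phi>\<in>S. f (\<phi>, b))" for S b and f :: "((real^3 \<Rightarrow> real) \<Rightarrow> complex) \<times> bool \<Rightarrow> real"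
        by (rule sum.reindex_bij_witness[of _ "\<lambda>\<phi>. (\<phi>, b)" fst]) auto
      ultimately show ?thesis by simp
    qed
    also have "(\<Sum>\<phi>\<in>F - R. c (\<phi>, False) * (l (\<phi>, False) a)\<^sup>2) =
        (\<Sum>\<phi>\<in>F. if \<phi> \<in> R then 0 else c (\<phi>, False) * (l (\<phi>, False) a)\<^sup>2)"
      by (rule sum.mono_neutral_cong_left) (use finF in auto)
    also have "(\<Sum>\<phi>\<in>F. c (\<phi>, True) * (l (\<phi>, True) a)\<^sup>2) + \<dots> =
        (\<Sum>\<phi>\<in>F. m \<phi> * Re (\<phi> (\<lambda>p. g p * (h p * h p))))"
      unfolding sum.distrib[symmetric]
    proof (rule sum.cong[OF refl])
      fix \<phi> assume \<phi>: "\<phi> \<in> F"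
      note cm = char_mult[OF char[OF \<phi>]]
      have v: "\<phi> (\<lambda>p. g p * (h p * h p)) = \<phi> g * (\<phi> h * \<phi> h)"
        using g h(1) by (simp add: cm poly3_intros)
      have r: "\<phi> (rep a) = \<phi> h" unfolding h(2) by (rule char_rep[OF char[OF \<phi>] kill[OF \<phi>] h(1)])
      show "c (\<phi>, True) * (l (\<phi>, True) a)\<^sup>2 + (if \<phi> \<in> R then 0 else c (\<phi>, False) * (l (\<phi>, False) a)\<^sup>2)
          = m \<phi> * Re (\<phi> (\<lambda>p. g p * (h p * h p)))"
      proof (cases "\<phi> \<in> R")
        case True
        then show ?thesis using realR[OF True]
          unfolding v l_def c_def fst_conv snd_conv r s_def by (simp add: power2_eq_square)
      next
        case False
        show ?thesis
        proof (cases "\<phi> g = 0")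
          case True
          then show ?thesis using False unfolding v c_def by simp
        next
          case nz: False
          define z where "z = csqrt (\<phi> g) * \<phi> h"
          have "\<phi> g * (\<phi> h * \<phi> h) = z\<^sup>2"
            unfolding z_def power_mult_distrib power2_csqrt by (simp add: power2_eq_square)
          then have "Re (\<phi> g * (\<phi> h * \<phi> h)) = (Re z)\<^sup>2 - (Im z)\<^sup>2" by (simp only: Re_power2)
          moreover have "l (\<phi>, True) a = Re z" "l (\<phi>, False) a = Im z"
            unfolding l_def fst_conv snd_conv r s_def z_def using False nz by simp_all
          moreover have "c (\<phi>, True) = m \<phi>" "c (\<phi>, False) = - m \<phi>"
            using False nz by (simp_all add: c_def)
          ultimately show ?thesis using False unfolding v by (simp only: if_False) (simp add: right_diff_distrib)
        qed
      qed
    qed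
    also have "\<dots> = q a"
      unfolding q_eq[OF \<open>a \<in> carrier A\<close>] unfolding h(2) using tr g h(1) by (simp add: A_ops poly3_intros)
    finally show ?thesis by simp
  qed
  have card_R: "card {\<phi>\<in>R. P (Re (\<phi> g))} = card {p\<in>zero_set I. P (g p)}" for P
  proof -
    have "{\<phi>\<in>R. P (Re (\<phi> g))} = eval_char ` {p\<in>zero_set I. P (g p)}"
      using bij g by (auto simp: bij_betw_def eval_char_def)
    then show ?thesis using card_image[OF inj_on_subset[OF eval_char_inj]] by simp
  qed
  define C where "C = {\<phi>\<in>F - R. \<phi> g \<noteq> 0}"
  have finR: "finite {\<phi>\<in>R. P \<phi>}" for P using finF RF by (auto intro: finite_subset)
  have finC: "finite C" using finF by (simp add: C_def)
  have cpos: "c (\<phi>, True) > 0 \<longleftrightarrow> (if \<phi> \<in> R then Re (\<phi> g) > 0 else \<phi> g \<noteq> 0)" if "\<phi> \<in> F" for \<phi>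
    using m[OF that] by (simp add: c_def zero_less_mult_iff)
  have cneg: "c (\<phi>, True) < 0 \<longleftrightarrow> \<phi> \<in> R \<and> Re (\<phi> g) < 0" if "\<phi> \<in> F" for \<phi>
    using m[OF that] by (simp add: c_def mult_less_0_iff)
  have cF: "\<not> c (\<phi>, False) > 0 \<and> (c (\<phi>, False) < 0 \<longleftrightarrow> \<phi> g \<noteq> 0)" if "\<phi> \<in> F - R" for \<phi>
    using m[of \<phi>] that by (simp add: c_def)
  have "{i\<in>Ix. c i > 0} = ({\<phi>\<in>R. Re (\<phi> g) > 0} \<union> C) \<times> {True}"
  proof (rule Set.set_eqI)
    fix i
    show "i \<in> {i\<in>Ix. c i > 0} \<longleftrightarrow> i \<in> ({\<phi>\<in>R. Re (\<phi> g) > 0} \<union> C) \<times> {True}"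
      using cpos[of "fst i"] cF[of "fst i"] RF
      by (cases i; cases "snd i") (auto simp: Ix_def C_def split: if_splits)
  qed
  moreover have "card ({\<phi>\<in>R. Re (\<phi> g) > 0} \<union> C) = card {\<phi>\<in>R. Re (\<phi> g) > 0} + card C"
    by (rule card_Un_disjoint) (use finR finC in \<open>auto simp: C_def\<close>)
  ultimately have pos: "card {i\<in>Ix. c i > 0} = card {p\<in>zero_set I. g p > 0} + card C"
    using card_R[of "\<lambda>x. x > 0"] by (simp add: card_cartesian_product)
  have "{i\<in>Ix. c i < 0} = {\<phi>\<in>R. Re (\<phi> g) < 0} \<times> {True} \<union> C \<times> {False}"
  proof (rule Set.set_eqI)
    fix i
    show "i \<in> {i\<in>Ix. c i < 0} \<longleftrightarrow> i \<in> {\<phi>\<in>R. Re (\<phi> g) < 0} \<times> {True} \<union> C \<times> {False}"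
      using cneg[of "fst i"] cF[of "fst i"] RF by (cases i; cases "snd i") (auto simp: Ix_def C_def)
  qed
  moreover have "card ({\<phi>\<in>R. Re (\<phi> g) < 0} \<times> {True} \<union> C \<times> {False}) =
      card ({\<phi>\<in>R. Re (\<phi> g) < 0} \<times> {True}) + card (C \<times> {False})"
    by (rule card_Un_disjoint) (use finR finC in auto)
  ultimately have neg: "card {i\<in>Ix. c i < 0} = card {p\<in>zero_set I. g p < 0} + card C"
    using card_R[of "\<lambda>x. x < 0"] by (simp add: card_cartesian_product)
  show "signature A q = int (card {p\<in>zero_set I. g p > 0}) - int (card {p\<in>zero_set I. g p < 0})"
    using A.signature_diagonal[OF finIx lin e dual q] by (simp add: pos neg)
  show "g p \<noteq> 0" if nd: "nondegenerate A q" and p: "p \<in> zero_set I"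
  proof
    assume "g p = 0"
    have R: "eval_char p \<in> R" using bij p by (auto simp: bij_betw_def)
    then have "(eval_char p, True) \<in> Ix" using RF by (auto simp: Ix_def)
    from A.nondegenerate_diagonal[OF finIx lin e dual q nd this] show False
      using R \<open>g p = 0\<close> g by (simp add: c_def eval_char_def)
  qed
qed

end

section \<open>Gradients and smooth functions\<close>

lemma frechet_grad:
  assumes "u differentiable (at p)"
  shows "frechet_derivative u (at p) v = grad u p \<bullet> v"
proof -
  have lin: "linear (frechet_derivative u (at p))"
    using assms by (rule linear_frechet_derivative)
  have "v = (\<Sum>k\<in>UNIV. (v $ k) *\<^sub>R axis k 1)"
    by (simp add: vec_eq_iff axis_def if_distrib cong: if_cong)
  then have "frechet_derivative u (at p) v = frechet_derivative u (at p) (\<Sum>k\<in>UNIV. (v $ k) *\<^sub>R axis k 1)" by simp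
  also have "\<dots> = (\<Sum>k\<in>UNIV. v $ k * partial_deriv k u p)"
    using lin by (simp add: linear_sum linear_scale partial_deriv_def)
  finally show ?thesis by (simp add: inner_vec_def grad_def mult.commute)
qed

lemma has_derivative_grad:
  assumes "u differentiable (at p)"
  shows "(u has_derivative (\<lambda>v. grad u p \<bullet> v)) (at p)"
proof -
  have "frechet_derivative u (at p) = (\<lambda>v. grad u p \<bullet> v)" using frechet_grad[OF assms] by auto
  then show ?thesis using assms frechet_derivative_works by metis
qed

lemma grad_unique:
  assumes "(u has_derivative u') (at p)"
  shows "grad u p \<bullet> v = u' v"
proof -
  have "u differentiable (at p)" using assms by (auto simp: differentiable_def)
  from frechet_grad[OF this] show ?thesis by (simp add: frechet_derivative_at[OF assms])
qed

lemma grad_eqI: "(\<And>v. grad u p \<bullet> v = w \<bullet> v) \<Longrightarrow> grad u p = w"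
  by (metis vector_eq_rdot)

lemma poly3_differentiable: "poly3 u \<Longrightarrow> u differentiable (at p)"
  by (rule differentiable_at_real_polynomial_function)

lemma poly3_continuous_on: "poly3 u \<Longrightarrow> continuous_on S u"
  by (simp add: continuous_at_imp_continuous_on differentiable_imp_continuous_within poly3_differentiable)

lemma open_poly3_nonzero: "poly3 u \<Longrightarrow> open {p. u p \<noteq> 0}"
  by (intro open_Collect_neq continuous_on_const poly3_continuous_on)

lemma partial_deriv_unique: "(u has_derivative u') (at p) \<Longrightarrow> partial_deriv k u p = u' (axis k 1)"
  by (simp add: partial_deriv_def frechet_derivative_at[symmetric])

lemma poly3_partial_deriv: "poly3 u \<Longrightarrow> poly3 (partial_deriv k u)"
proof (induction rule: poly3_induct)
  case (coord j)
  have "partial_deriv k (\<lambda>p. p $ j) = (\<lambda>p. axis k 1 $ j)"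
    by (rule ext, rule partial_deriv_unique) (rule bounded_linear.has_derivative[OF bounded_linear_vec_nth has_derivative_ident])
  then show ?case by (simp add: poly3_intros)
next
  case (const c)
  have "partial_deriv k (\<lambda>p. c) = (\<lambda>p. 0)"
    by (rule ext, rule partial_deriv_unique) (rule has_derivative_const)
  then show ?case by (simp add: poly3_intros)
next
  case (add u v)
  have "partial_deriv k (\<lambda>p. u p + v p) p = partial_deriv k u p + partial_deriv k v p" for p
    using partial_deriv_unique[OF has_derivative_add[OF has_derivative_grad has_derivative_grad], of u p v k] add
    by (simp add: poly3_differentiable grad_def inner_axis)
  then have "partial_deriv k (\<lambda>p. u p + v p) = (\<lambda>p. partial_deriv k u p + partial_deriv k v p)" by (rule ext)
  then show ?case using add by (simp add: poly3_intros)
next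
  case (mult u v)
  have "partial_deriv k (\<lambda>p. u p * v p) p = u p * partial_deriv k v p + partial_deriv k u p * v p" for p
    using partial_deriv_unique[OF has_derivative_mult[OF has_derivative_grad has_derivative_grad], of u p v k] mult
    by (simp add: poly3_differentiable grad_def inner_axis)
  then have "partial_deriv k (\<lambda>p. u p * v p) = (\<lambda>p. u p * partial_deriv k v p + partial_deriv k u p * v p)" by (rule ext)
  then show ?case using mult by (simp add: poly3_intros)
qed

definition poly3_field :: "(real^3 \<Rightarrow> real^3) \<Rightarrow> bool" where
  "poly3_field K \<longleftrightarrow> (\<forall>k. poly3 (\<lambda>p. K p $ k))"

lemma poly3_field_grad: "poly3 u \<Longrightarrow> poly3_field (grad u)"
  by (simp add: poly3_field_def grad_def poly3_partial_deriv)

lemma poly3_inner: "poly3_field K \<Longrightarrow> poly3_field L \<Longrightarrow> poly3 (\<lambda>p. K p \<bullet> L p)"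
  by (simp add: poly3_field_def inner_vec_def sum_3 poly3_intros)

lemma poly3_field_cross:
  assumes "poly3_field K" "poly3_field L" shows "poly3_field (\<lambda>p. cross3 (K p) (L p))"
  unfolding poly3_field_def
proof
  fix k :: 3
  consider "k = 1" | "k = 2" | "k = 3" using exhaust_3 by blast
  then show "poly3 (\<lambda>p. cross3 (K p) (L p) $ k)"
    using assms by cases
      (simp_all add: poly3_field_def cross_components poly3_intros real_polynomial_function_diff)
qed

text \<open>
  Smoothness is only tested on \<open>U\<close>, although the derivatives refer to neighbourhoods; hence \<open>U\<close> has to be
  open.
\<close>

lemma Ck_on_cong:
  assumes "open U" "\<And>x. x \<in> U \<Longrightarrow> f x = g x" "Ck_on k f U"
  shows "Ck_on k g U"
  using assms(2,3)
proof (induction k arbitrary: f g)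
  case 0
  then show ?case by (metis Ck_on.simps(1) continuous_on_cong)
next
  case (Suc k)
  have d: "(g has_derivative frechet_derivative f (at x)) (at x)" if "x \<in> U" for x
  proof -
    have "(f has_derivative frechet_derivative f (at x)) (at x)"
      using Suc.prems(2) that by (simp add: frechet_derivative_works)
    then show ?thesis
      by (rule has_derivative_transform_within_open[OF _ assms(1) that]) (use Suc.prems in auto)
  qed
  have eq: "frechet_derivative f (at x) v = frechet_derivative g (at x) v" if "x \<in> U" for x v
    using frechet_derivative_at[OF d[OF that]] by simp
  have "Ck_on k (\<lambda>x. frechet_derivative g (at x) v) U" for v
    by (rule Suc.IH[of "\<lambda>x. frechet_derivative f (at x) v"]) (use eq Suc.prems(2) in auto)
  then show ?case using d by (auto simp: differentiable_def)
qed

lemma Ck_on_SucI: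
  assumes "open U" "\<And>x. x \<in> U \<Longrightarrow> (f has_derivative f' x) (at x)" "\<And>v. Ck_on k (\<lambda>x. f' x v) U"
  shows "Ck_on (Suc k) f U"
proof -
  have "Ck_on k (\<lambda>x. frechet_derivative f (at x) v) U" for v
    by (rule Ck_on_cong[OF assms(1) _ assms(3)[of v]]) (use frechet_derivative_at[OF assms(2)] in simp)
  then show ?thesis using assms(2) by (auto simp: differentiable_def)
qed

lemma Ck_on_Suc_D: "Ck_on (Suc k) f U \<Longrightarrow> Ck_on k f U"
proof (induction k arbitrary: f)
  case 0
  then show ?case
    by (simp add: continuous_at_imp_continuous_on differentiable_imp_continuous_within)
qed auto

lemma Ck_on_has_derivative:
  "Ck_on (Suc k) f U \<Longrightarrow> x \<in> U \<Longrightarrow> (f has_derivative frechet_derivative f (at x)) (at x)"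
  by (simp add: frechet_derivative_works)

lemma Ck_on_const: "open U \<Longrightarrow> Ck_on k (\<lambda>x. c) U"
proof (induction k arbitrary: c)
  case (Suc k)
  show ?case by (rule Ck_on_SucI[OF Suc.prems has_derivative_const]) (rule Suc.IH[OF Suc.prems])
qed simp

lemma Ck_on_add:
  assumes "open U"
  shows "Ck_on k f U \<Longrightarrow> Ck_on k g U \<Longrightarrow> Ck_on k (\<lambda>x. f x + g x) U"
proof (induction k arbitrary: f g)
  case 0
  then show ?case by (simp add: continuous_on_add)
next
  case (Suc k)
  show ?case
    by (rule Ck_on_SucI[OF assms has_derivative_add[OF Ck_on_has_derivative[OF Suc.prems(1)] Ck_on_has_derivative[OF Suc.prems(2)]]])
      (use Suc in auto)
qed

lemma Ck_on_mult:
  fixes f g :: "_ \<Rightarrow> real"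
  assumes "open U"
  shows "Ck_on k f U \<Longrightarrow> Ck_on k g U \<Longrightarrow> Ck_on k (\<lambda>x. f x * g x) U"
proof (induction k arbitrary: f g)
  case 0
  then show ?case by (simp add: continuous_on_mult)
next
  case (Suc k)
  show ?case
  proof (rule Ck_on_SucI[OF assms has_derivative_mult[OF Ck_on_has_derivative[OF Suc.prems(1)] Ck_on_has_derivative[OF Suc.prems(2)]]])
    fix v
    have "Ck_on k (\<lambda>x. f x * frechet_derivative g (at x) v) U"
      by (rule Suc.IH) (use Suc.prems Ck_on_Suc_D in auto)
    moreover have "Ck_on k (\<lambda>x. frechet_derivative f (at x) v * g x) U"
      by (rule Suc.IH) (use Suc.prems Ck_on_Suc_D in auto)
    ultimately show "Ck_on k (\<lambda>x. f x * frechet_derivative g (at x) v + frechet_derivative f (at x) v * g x) U"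
      by (rule Ck_on_add[OF assms])
  qed auto
qed

lemma Ck_on_inverse:
  fixes f :: "_ \<Rightarrow> real"
  assumes "open U" "\<And>x. x \<in> U \<Longrightarrow> f x \<noteq> 0"
  shows "Ck_on k f U \<Longrightarrow> Ck_on k (\<lambda>x. inverse (f x)) U"
proof (induction k)
  case 0
  then show ?case using assms by (auto intro: continuous_on_inverse)
next
  case (Suc k)
  have i: "Ck_on k (\<lambda>x. inverse (f x)) U" by (rule Suc.IH) (rule Ck_on_Suc_D[OF Suc.prems])
  show ?case
  proof (rule Ck_on_SucI[OF assms(1)])
    fix x assume x: "x \<in> U"
    show "((\<lambda>x. inverse (f x)) has_derivative
        (\<lambda>v. (-1) * (inverse (f x) * frechet_derivative f (at x) v * inverse (f x)))) (at x)"
      using Deriv.has_derivative_inverse[OF assms(2)[OF x] Ck_on_has_derivative[OF Suc.prems x]] by simp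
  next
    fix v
    show "Ck_on k (\<lambda>x. (-1) * (inverse (f x) * frechet_derivative f (at x) v * inverse (f x))) U"
      by (intro Ck_on_mult Ck_on_const assms(1) i) (use Suc.prems in auto)
  qed
qed

lemma Ck_on_bounded_linear:
  assumes L: "bounded_linear L" and "open U"
  shows "Ck_on k f U \<Longrightarrow> Ck_on k (\<lambda>x. L (f x)) U"
proof (induction k arbitrary: f)
  case 0
  then show ?case using L by (simp add: bounded_linear.continuous_on)
next
  case (Suc k)
  show ?case
    by (rule Ck_on_SucI[OF assms(2) bounded_linear.has_derivative[OF L Ck_on_has_derivative[OF Suc.prems]]])
      (use Suc in auto)
qed

lemma smooth_on_partial_deriv:
  assumes "smooth_on u U" shows "smooth_on (partial_deriv k u) U"
  unfolding smooth_on_def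
proof
  fix j
  have "Ck_on (Suc j) u U" using assms by (simp add: smooth_on_def)
  then show "Ck_on j (partial_deriv k u) U" by (simp add: partial_deriv_def[abs_def])
qed

lemma smooth_on_differentiable: "smooth_on u U \<Longrightarrow> p \<in> U \<Longrightarrow> u differentiable (at p)"
  unfolding smooth_on_def by (metis Ck_on.simps(2))

lemma smooth_on_subset: "smooth_on u U \<Longrightarrow> V \<subseteq> U \<Longrightarrow> smooth_on u V"
proof -
  have "Ck_on k u V" if "Ck_on k u U" "V \<subseteq> U" for k
    using that by (induction k arbitrary: u) (auto intro: continuous_on_subset)
  then show "smooth_on u U \<Longrightarrow> V \<subseteq> U \<Longrightarrow> smooth_on u V" by (simp add: smooth_on_def)
qed

lemma smooth_on_const: "open U \<Longrightarrow> smooth_on (\<lambda>x. c) U"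
  and smooth_on_add: "open U \<Longrightarrow> smooth_on f U \<Longrightarrow> smooth_on g U \<Longrightarrow> smooth_on (\<lambda>x. f x + g x) U"
  and smooth_on_mult: "open U \<Longrightarrow> smooth_on a U \<Longrightarrow> smooth_on b U \<Longrightarrow> smooth_on (\<lambda>x. a x * b x) U"
  and smooth_on_inverse: "open U \<Longrightarrow> smooth_on a U \<Longrightarrow> (\<And>x. x \<in> U \<Longrightarrow> a x \<noteq> 0) \<Longrightarrow> smooth_on (\<lambda>x. inverse (a x)) U"
  for a b :: "_ \<Rightarrow> real"
  by (simp_all add: smooth_on_def Ck_on_const Ck_on_add Ck_on_mult Ck_on_inverse)

lemma smooth_on_nth: "open U \<Longrightarrow> smooth_on K U \<Longrightarrow> smooth_on (\<lambda>x. K x $ i) U"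
  unfolding smooth_on_def using Ck_on_bounded_linear[OF bounded_linear_vec_nth] by blast

lemma smooth_on_diff:
  fixes a b :: "_ \<Rightarrow> real"
  assumes "open U" "smooth_on a U" "smooth_on b U" shows "smooth_on (\<lambda>x. a x - b x) U"
  using smooth_on_add[OF assms(1,2) smooth_on_mult[OF assms(1) smooth_on_const[OF assms(1), of "-1"] assms(3)]]
  by simp

lemma smooth_on_poly3:
  assumes "poly3 u" "open U" shows "smooth_on u U"
  unfolding smooth_on_def
proof
  fix k show "Ck_on k u U"
    using assms(1)
  proof (induction k arbitrary: u)
    case 0
    then show ?case by (simp add: poly3_continuous_on)
  next
    case (Suc k)
    show ?case
    proof (rule Ck_on_SucI[OF assms(2) has_derivative_grad[OF poly3_differentiable[OF Suc.prems]]])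
      fix v :: "real^3"
      have "poly3 (\<lambda>x. v $ 1 * partial_deriv 1 u x + v $ 2 * partial_deriv 2 u x + v $ 3 * partial_deriv 3 u x)"
        by (intro poly3_intros poly3_partial_deriv Suc.prems)
      then show "Ck_on k (\<lambda>x. grad u x \<bullet> v) U"
        by (intro Suc.IH) (simp add: inner_vec_def sum_3 grad_def mult.commute)
    qed
  qed
qed

lemma smooth_on_grad_inner:
  assumes "open U" "smooth_on u U" "smooth_on K U"
  shows "smooth_on (\<lambda>p. grad u p \<bullet> K p) U"
  unfolding inner_vec_def sum_3 grad_def
  by (auto intro!: smooth_on_add smooth_on_mult smooth_on_partial_deriv smooth_on_nth assms)

lemma smooth_on_inner:
  fixes K L :: "real^3 \<Rightarrow> real^3"
  assumes "open U" "smooth_on L U" "smooth_on K U"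
  shows "smooth_on (\<lambda>p. L p \<bullet> K p) U"
  unfolding inner_vec_def sum_3
  by (auto intro!: smooth_on_add smooth_on_mult smooth_on_nth assms)

lemma smooth_on_vector:
  fixes K :: "'a::real_normed_vector \<Rightarrow> real^3"
  assumes "open U" "\<And>i. smooth_on (\<lambda>x. K x $ i) U"
  shows "smooth_on K U"
  unfolding smooth_on_def
proof
  fix k
  have "Ck_on k (\<lambda>x. K x $ i *\<^sub>R (axis i 1 :: real^3)) U" for i
    using Ck_on_bounded_linear[OF bounded_linear_scaleR_left assms(1)] assms(2)
    unfolding smooth_on_def by blast
  then have "Ck_on k (\<lambda>x. (K x $ 1 *\<^sub>R (axis 1 1 :: real^3) + K x $ 2 *\<^sub>R axis 2 1) + K x $ 3 *\<^sub>R axis 3 1) U"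
    by (intro Ck_on_add assms(1))
  moreover have "(K x $ 1 *\<^sub>R (axis 1 1 :: real^3) + K x $ 2 *\<^sub>R axis 2 1) + K x $ 3 *\<^sub>R axis 3 1 = K x" for x
    by (simp add: vec_eq_iff forall_3 axis_def)
  ultimately show "Ck_on k K U" by simp
qed

lemma smooth_on_poly3_field: "poly3_field K \<Longrightarrow> open U \<Longrightarrow> smooth_on K U"
  by (rule smooth_on_vector) (auto simp: poly3_field_def smooth_on_poly3)

section \<open>Curves in level sets\<close>

text \<open>
  Cramer's rule for the vectors orthogonal to \<open>a\<close> and \<open>b\<close>.
\<close>

lemma cross3_kernel:
  fixes a b v n :: "real^3"
  assumes "a \<bullet> v = 0" "b \<bullet> v = 0"
  shows "(n \<bullet> cross3 a b) *\<^sub>R v = (n \<bullet> v) *\<^sub>R cross3 a b"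
proof -
  have "(n \<bullet> cross3 a b) *\<^sub>R v = (n \<bullet> v) *\<^sub>R cross3 a b + (a \<bullet> v) *\<^sub>R cross3 b n + (b \<bullet> v) *\<^sub>R cross3 n a"
    by (simp add: vec_eq_iff forall_3 cross_components inner_vec_def sum_3 algebra_simps)
  then show ?thesis using assms by simp
qed

text \<open>
  The functions \<open>u(\<gamma> t) / D(\<gamma> t)\<^sup>m\<close> with polynomial \<open>u\<close> form a class that is closed under differentiation along
  the curve, since \<open>\<gamma>' = W(\<gamma>) / D(\<gamma>)\<close>. So differentiability of \<open>\<gamma>\<close> bootstraps to smoothness without any theorem on
  compositions of smooth maps.
\<close>

lemma smooth_on_poly_along_curve:
  fixes \<gamma> :: "real \<Rightarrow> real^3"
  assumes W: "poly3_field W" and D: "poly3 D" "\<And>t. t \<in> T \<Longrightarrow> D (\<gamma> t) \<noteq> 0" and T: "open T"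
    and \<gamma>: "\<And>t. t \<in> T \<Longrightarrow> (\<gamma> has_vector_derivative (W (\<gamma> t) /\<^sub>R D (\<gamma> t))) (at t)"
  shows "smooth_on \<gamma> T"
proof -
  have ch: "((\<lambda>t. u (\<gamma> t)) has_real_derivative (grad u (\<gamma> t) \<bullet> W (\<gamma> t)) / D (\<gamma> t)) (at t)"
    if "poly3 u" "t \<in> T" for u t
  proof -
    have "((\<lambda>t. u (\<gamma> t)) has_derivative (\<lambda>s. grad u (\<gamma> t) \<bullet> (s *\<^sub>R (W (\<gamma> t) /\<^sub>R D (\<gamma> t))))) (at t)"
      using has_derivative_compose[OF \<gamma>[OF that(2), unfolded has_vector_derivative_def]
          has_derivative_grad[OF poly3_differentiable[OF that(1)]]] .
    then show ?thesis
      by (simp add: has_field_derivative_def field_simps) (simp add: mult_commute_abs divide_inverse mult_ac)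
  qed
  have Ck: "Ck_on k (\<lambda>t. u (\<gamma> t) / D (\<gamma> t) ^ m) T" if "poly3 u" for k u m
    using that
  proof (induction k arbitrary: u m)
    case 0
    have "isCont (\<lambda>t. u (\<gamma> t)) t" "isCont (\<lambda>t. D (\<gamma> t)) t" if "t \<in> T" for t
      using ch[OF 0 that] ch[OF D(1) that] by (auto intro: DERIV_isCont)
    then show ?case
      using D(2) by (auto simp: continuous_on_eq_continuous_at[OF T] intro!: continuous_intros)
  next
    case (Suc k)
    define u' where "u' p = (grad u p \<bullet> W p) * D p - of_nat m * (u p * (grad D p \<bullet> W p))" for p
    have pu': "poly3 u'"
      unfolding u'_def[abs_def] using W D(1) Suc.prems
      by (intro poly3_intros real_polynomial_function_diff poly3_inner poly3_field_grad)
    show ?case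
    proof (rule Ck_on_SucI[OF T])
      fix t assume t: "t \<in> T"
      have "((\<lambda>t. u (\<gamma> t) / D (\<gamma> t) ^ m) has_real_derivative u' (\<gamma> t) / D (\<gamma> t) ^ (m + 2)) (at t)"
      proof -
        have nz: "D (\<gamma> t) ^ m \<noteq> 0" using D(2)[OF t] by simp
        have "((\<lambda>t. u (\<gamma> t) / D (\<gamma> t) ^ m) has_real_derivative
          ((grad u (\<gamma> t) \<bullet> W (\<gamma> t)) / D (\<gamma> t) * D (\<gamma> t) ^ m -
           u (\<gamma> t) * (real m * ((grad D (\<gamma> t) \<bullet> W (\<gamma> t)) / D (\<gamma> t) * D (\<gamma> t) ^ (m - Suc 0))))
           / (D (\<gamma> t) ^ m * D (\<gamma> t) ^ m)) (at t)"
          using DERIV_divide[OF ch[OF Suc.prems t] DERIV_power[OF ch[OF D(1) t], of m] nz] by simp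
        moreover have "((grad u (\<gamma> t) \<bullet> W (\<gamma> t)) / D (\<gamma> t) * D (\<gamma> t) ^ m -
           u (\<gamma> t) * (real m * ((grad D (\<gamma> t) \<bullet> W (\<gamma> t)) / D (\<gamma> t) * D (\<gamma> t) ^ (m - Suc 0))))
           / (D (\<gamma> t) ^ m * D (\<gamma> t) ^ m) = u' (\<gamma> t) / D (\<gamma> t) ^ (m + 2)"
          using D(2)[OF t] by (cases m) (simp_all add: u'_def field_simps power2_eq_square)
        ultimately show ?thesis by simp
      qed
      moreover have "(\<lambda>s. (s * u' (\<gamma> t)) / D (\<gamma> t) ^ (m + 2)) = (*) (u' (\<gamma> t) / D (\<gamma> t) ^ (m + 2))"
        by (rule ext) simp
      ultimately show "((\<lambda>t. u (\<gamma> t) / D (\<gamma> t) ^ m) has_derivative (\<lambda>s. (s * u' (\<gamma> t)) / D (\<gamma> t) ^ (m + 2))) (at t)"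
        by (simp only: has_field_derivative_def)
    next
      fix s
      have "poly3 (\<lambda>p. s * u' p)" using pu' by (intro poly3_intros)
      from Suc.IH[OF this, of "m + 2"]
      show "Ck_on k (\<lambda>t. (s * u' (\<gamma> t)) / D (\<gamma> t) ^ (m + 2)) T" .
    qed
  qed
  show ?thesis
  proof (rule smooth_on_vector[OF T])
    show "smooth_on (\<lambda>t. \<gamma> t $ i) T" for i
      using Ck[OF poly3_coord[of i], where m = 0] by (simp add: smooth_on_def)
  qed
qed

text \<open>
  Complete \<open>a, b\<close> to a local diffeomorphism \<open>H\<close> by the linear function \<open>x \<mapsto> n \<bullet> x\<close>, where \<open>n\<close> is the cross product
  of the gradients at \<open>p\<close>, and pull back the line through \<open>H p\<close> in the third direction. The velocity of the
  resulting curve is orthogonal to both gradients, hence it is the cross product \<open>W\<close> of the gradients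
  divided by \<open>n \<bullet> W\<close>.
\<close>

lemma curve_in_intersection:
  assumes ab: "poly3 a" "poly3 b" and ind: "cross3 (grad a p) (grad b p) \<noteq> 0"
    and N: "open N" "p \<in> N"
  shows "\<exists>\<gamma> e c. 0 < e \<and> smooth_on \<gamma> {-e<..<e} \<and> \<gamma> 0 = p \<and>
    (\<forall>t\<in>{-e<..<e}. \<gamma> t \<in> N \<and> a (\<gamma> t) = a p \<and> b (\<gamma> t) = b p) \<and>
    c \<noteq> 0 \<and> (\<gamma> has_vector_derivative c *\<^sub>R cross3 (grad a p) (grad b p)) (at (0::real))"
proof -
  define W where "W q = cross3 (grad a q) (grad b q)" for q
  define n where "n = W p"
  define D where "D q = n \<bullet> W q" for q
  have Wp: "poly3_field W" unfolding W_def[abs_def] using ab by (intro poly3_field_cross poly3_field_grad)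
  have Dp: "poly3 D" unfolding D_def[abs_def]
    by (rule poly3_inner[OF _ Wp]) (simp add: poly3_field_def poly3_intros)
  have Dp0: "D p \<noteq> 0" using ind by (simp add: D_def n_def W_def)
  \<comment> \<open>\<open>D\<close> is the Jacobian determinant of \<open>H\<close>; it must not vanish along the whole curve\<close>
  define U where "U = N \<inter> {q. D q \<noteq> 0}"
  have U: "open U" "p \<in> U" using N Dp0 open_poly3_nonzero[OF Dp] by (auto simp: U_def)
  define H where "H q = a q *\<^sub>R (axis 1 1 :: real^3) + b q *\<^sub>R axis 2 1 + (n \<bullet> q) *\<^sub>R axis 3 1" for q
  define h' where "h' q v = (grad a q \<bullet> v) *\<^sub>R (axis 1 1 :: real^3) + (grad b q \<bullet> v) *\<^sub>R axis 2 1 + (n \<bullet> v) *\<^sub>R axis 3 1" for q v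
  have blh: "bounded_linear (h' q)" for q
    unfolding h'_def[abs_def]
    by (intro bounded_linear_add bounded_linear_compose[OF bounded_linear_scaleR_left] bounded_linear_inner_right)
  define H' where "H' q = Blinfun (h' q)" for q
  have H'ap: "blinfun_apply (H' q) = h' q" for q
    unfolding H'_def by (rule bounded_linear_Blinfun_apply[OF blh])
  have derH: "(H has_derivative blinfun_apply (H' q)) (at q)" for q
    unfolding H'ap h'_def[abs_def] H_def[abs_def]
    using has_derivative_grad[OF poly3_differentiable[OF ab(1)], of q]
      has_derivative_grad[OF poly3_differentiable[OF ab(2)], of q]
    by (auto intro!: derivative_eq_intros)
  have contH: "continuous_on U H'"
  proof (rule continuous_on_blinfun_componentwise)
    fix i :: "real^3" assume "i \<in> Basis"
    have "poly3 (\<lambda>q. grad a q \<bullet> i)" "poly3 (\<lambda>q. grad b q \<bullet> i)"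
      using ab by (auto intro!: poly3_inner poly3_field_grad simp: poly3_field_def poly3_intros)
    then show "continuous_on U (\<lambda>q. blinfun_apply (H' q) i)"
      unfolding H'ap h'_def by (intro continuous_intros poly3_continuous_on)
  qed
  have ker: "v = 0" if "h' q v = 0" "D q \<noteq> 0" for q v
  proof -
    have "grad a q \<bullet> v = 0" "grad b q \<bullet> v = 0" "n \<bullet> v = 0"
      using that(1) by (auto simp: h'_def vec_eq_iff forall_3 axis_def)
    then have "D q *\<^sub>R v = 0" using cross3_kernel[of "grad a q" v "grad b q" n] by (simp add: D_def W_def)
    then show ?thesis using that(2) by simp
  qed
  have "inj (h' p)"
  proof (rule injI)
    fix x y assume "h' p x = h' p y"
    then have "h' p (x - y) = 0"
      using linear_diff[OF bounded_linear.linear[OF blh[of p]], of x y] by simp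
    then show "x = y" using ker[OF _ Dp0] by force
  qed
  then obtain g0 where g0: "linear g0" "g0 \<circ> h' p = id"
    using linear_injective_left_inverse[OF bounded_linear.linear[OF blh]] by blast
  have "Blinfun g0 o\<^sub>L H' p = id_blinfun"
  proof (rule blinfun_eqI)
    fix v
    have "bounded_linear g0" using g0(1) linear_conv_bounded_linear by blast
    then show "blinfun_apply (Blinfun g0 o\<^sub>L H' p) v = blinfun_apply id_blinfun v"
      using g0(2) by (simp add: bounded_linear_Blinfun_apply H'ap fun_eq_iff)
  qed
  note inverse_function = inverse_function_theorem[OF U(1) derH contH U(2) this]
  obtain U' V G G' where IF: "open U'" "U' \<subseteq> U" "p \<in> U'" "open V" "H p \<in> V" "homeomorphism U' V H G"
    "\<And>y. y \<in> V \<Longrightarrow> (G has_derivative (G' y)) (at y)"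
    "\<And>y. y \<in> V \<Longrightarrow> G' y = inv_into UNIV (blinfun_apply (H'(G y)))"
    "\<And>y. y \<in> V \<Longrightarrow> bij (blinfun_apply (H'(G y)))"
    by (rule inverse_function) (rule that)
  have HG: "H (G y) = y" "G y \<in> U'" if "y \<in> V" for y
    using IF(6) that by (auto simp: homeomorphism_def)
  define line where "line t = H p + t *\<^sub>R (axis 3 1 :: real^3)" for t :: real
  define \<gamma> where "\<gamma> t = G (line t)" for t
  have "continuous_on UNIV line" unfolding line_def by (intro continuous_intros)
  then have "open (line -` V)" by (rule open_vimage[OF IF(4)])
  moreover have "0 \<in> line -` V" using IF(5) by (simp add: line_def)
  ultimately obtain e where e: "e > 0" "ball 0 e \<subseteq> line -` V" by (meson openE)
  have V: "line t \<in> V" if "t \<in> {-e<..<e}" for t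
  proof -
    have "t \<in> ball 0 e" using that by auto
    then show ?thesis using e(2) by auto
  qed
  have inU: "\<gamma> t \<in> U" if "t \<in> {-e<..<e}" for t
    using HG(2)[OF V[OF that]] IF(2) by (auto simp: \<gamma>_def)
  have der: "(\<gamma> has_vector_derivative (W (\<gamma> t) /\<^sub>R D (\<gamma> t))) (at t)" if t: "t \<in> {-e<..<e}" for t
  proof -
    let ?y = "line t"
    have "(line has_derivative (\<lambda>s. s *\<^sub>R axis 3 1)) (at t)"
      unfolding line_def[abs_def] by (auto intro!: derivative_eq_intros)
    from has_derivative_compose[OF this IF(7)[OF V[OF t]]]
    have d: "(\<gamma> has_derivative (\<lambda>s. G' ?y (s *\<^sub>R axis 3 1))) (at t)"
      by (simp add: \<gamma>_def[abs_def])
    have lin: "linear (G' ?y)" using IF(7)[OF V[OF t]] by (rule has_derivative_linear)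
    have Dn: "D (\<gamma> t) \<noteq> 0" using inU[OF t] by (simp add: U_def)
    have "h' (\<gamma> t) (W (\<gamma> t)) = D (\<gamma> t) *\<^sub>R axis 3 1"
      by (simp add: h'_def W_def D_def dot_cross_self)
    then have "h' (\<gamma> t) (W (\<gamma> t) /\<^sub>R D (\<gamma> t)) = axis 3 1"
      using linear_scale[OF bounded_linear.linear[OF blh]] Dn by simp
    moreover have "G' ?y = inv_into UNIV (h' (\<gamma> t))" "bij (h' (\<gamma> t))"
      using IF(8,9)[OF V[OF t]] by (simp_all add: H'ap \<gamma>_def)
    ultimately have "G' ?y (axis 3 1) = W (\<gamma> t) /\<^sub>R D (\<gamma> t)"
      by (metis bij_inv_eq_iff)
    then show ?thesis
      using d linear_scale[OF lin] by (simp add: has_vector_derivative_def)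
  qed
  have sm: "smooth_on \<gamma> {-e<..<e}"
    by (rule smooth_on_poly_along_curve[OF Wp Dp _ _ der]) (use inU in \<open>auto simp: U_def\<close>)
  have \<gamma>0: "\<gamma> 0 = p"
    using IF(3,6) by (simp add: \<gamma>_def line_def homeomorphism_def)
  have const: "a (\<gamma> t) = a p \<and> b (\<gamma> t) = b p" if "t \<in> {-e<..<e}" for t
  proof -
    have "H (\<gamma> t) = line t" using HG(1)[OF V[OF that]] by (simp add: \<gamma>_def)
    then have "H (\<gamma> t) $ 1 = line t $ 1" "H (\<gamma> t) $ 2 = line t $ 2" by simp_all
    then show ?thesis by (simp add: H_def line_def axis_def)
  qed
  have "(\<gamma> has_vector_derivative inverse (D p) *\<^sub>R cross3 (grad a p) (grad b p)) (at 0)"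
    using der[of 0] e \<gamma>0 by (simp add: W_def)
  then show ?thesis
    using e(1) sm \<gamma>0 const inU Dp0
    by (intro exI[of _ \<gamma>] exI[of _ e] exI[of _ "inverse (D p)"]) (auto simp: U_def)
qed

lemma chain_curve:
  assumes "(\<gamma> has_vector_derivative v) (at (0::real))" "u differentiable (at (\<gamma> 0))"
  shows "((\<lambda>t. u (\<gamma> t)) has_real_derivative (grad u (\<gamma> 0) \<bullet> v)) (at 0)"
  using has_derivative_compose[OF assms(1)[unfolded has_vector_derivative_def] has_derivative_grad[OF assms(2)]]
  by (simp add: has_field_derivative_def mult_commute_abs)

lemma curve_tangent:
  assumes "(\<gamma> has_vector_derivative v) (at (0::real))" "u differentiable (at (\<gamma> 0))"
    and "0 < e" "\<And>t. t \<in> {-e<..<e} \<Longrightarrow> u (\<gamma> t) = 0"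
  shows "grad u (\<gamma> 0) \<bullet> v = 0"
proof -
  have "((\<lambda>t. u (\<gamma> t)) has_real_derivative 0) (at 0)"
    by (rule has_field_derivative_transform_within_open[of "\<lambda>t. 0" _ _ "{-e<..<e}"]) (use assms(3,4) in auto)
  then show ?thesis using chain_curve[OF assms(1,2)] DERIV_unique by blast
qed

lemma cross3_perp:
  fixes n v :: "real^3"
  assumes "n \<bullet> v = 0"
  shows "cross3 n (cross3 v n) = (n \<bullet> n) *\<^sub>R v"
proof -
  have "cross3 n (cross3 v n) = (n \<bullet> n) *\<^sub>R v - (n \<bullet> v) *\<^sub>R n"
    by (simp add: vec_eq_iff forall_3 cross_components inner_vec_def sum_3 algebra_simps)
  then show ?thesis using assms by simp
qed

text \<open>
  Intersect the surface with a plane whose normal is chosen such that the intersection has the prescribed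
  tangent direction.
\<close>

lemma curve_in_surface:
  assumes a: "poly3 a" "grad a p \<noteq> 0" and N: "open N" "p \<in> N" and v: "grad a p \<bullet> v = 0"
  shows "\<exists>\<gamma> e c. 0 < e \<and> smooth_on \<gamma> {-e<..<e} \<and> \<gamma> 0 = p \<and>
    (\<forall>t\<in>{-e<..<e}. \<gamma> t \<in> N \<and> a (\<gamma> t) = a p) \<and>
    c \<noteq> 0 \<and> (\<gamma> has_vector_derivative c *\<^sub>R v) (at (0::real))"
proof (cases "v = 0")
  case True
  have "smooth_on (\<lambda>t::real. p) {-1<..<1}" by (rule smooth_on_const) simp
  then show ?thesis using N True
    by (intro exI[of _ "\<lambda>t. p"] exI[of _ 1]) auto
next
  case False
  define m where "m = cross3 v (grad a p)"
  have b: "poly3 (\<lambda>q. m \<bullet> q)"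
    by (rule poly3_inner) (simp_all add: poly3_field_def poly3_intros)
  have gb: "grad (\<lambda>q. m \<bullet> q) p = m"
    by (rule grad_eqI, rule grad_unique) (auto intro!: derivative_eq_intros)
  have cr: "cross3 (grad a p) m = (grad a p \<bullet> grad a p) *\<^sub>R v"
    unfolding m_def by (rule cross3_perp[OF v])
  then have "cross3 (grad a p) (grad (\<lambda>q. m \<bullet> q) p) \<noteq> 0" using False a(2) by (simp add: gb)
  note curve = curve_in_intersection[OF a(1) b this N, unfolded gb cr]
  obtain \<gamma> e c where
    "0 < e" "smooth_on \<gamma> {-e<..<e}" "\<gamma> 0 = p"
    "\<forall>t\<in>{-e<..<e}. \<gamma> t \<in> N \<and> a (\<gamma> t) = a p \<and> m \<bullet> \<gamma> t = m \<bullet> p" "c \<noteq> 0"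
    "(\<gamma> has_vector_derivative c *\<^sub>R ((grad a p \<bullet> grad a p) *\<^sub>R v)) (at (0::real))"
    using curve by (elim exE conjE) (rule that)
  then show ?thesis using a(2)
    by (intro exI[of _ \<gamma>] exI[of _ e] exI[of _ "c * (grad a p \<bullet> grad a p)"]) auto
qed

text \<open>
  The derivative of \<open>R\<close> vanishes along all curves in the surface \<open>a = 0\<close>, and these realise all tangent
  directions.
\<close>

lemma grad_parallel:
  assumes a: "poly3 a" "grad a p \<noteq> 0" "a p = 0" and N: "open N" "p \<in> N"
    and R: "R differentiable (at p)" "\<And>q. q \<in> N \<Longrightarrow> a q = 0 \<Longrightarrow> R q = 0"
  shows "grad R p = ((grad R p \<bullet> grad a p) / (grad a p \<bullet> grad a p)) *\<^sub>R grad a p"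
proof -
  have perp: "grad R p \<bullet> v = 0" if v: "grad a p \<bullet> v = 0" for v
  proof -
    obtain \<gamma> e c where \<gamma>: "0 < e" "\<gamma> 0 = p" "\<forall>t\<in>{-e<..<e}. \<gamma> t \<in> N \<and> a (\<gamma> t) = a p"
      "c \<noteq> 0" "(\<gamma> has_vector_derivative c *\<^sub>R v) (at (0::real))"
      using curve_in_surface[OF a(1,2) N v] by (elim exE conjE) (rule that)
    have "grad R (\<gamma> 0) \<bullet> (c *\<^sub>R v) = 0"
      by (rule curve_tangent[OF \<gamma>(5) _ \<gamma>(1)]) (use \<gamma>(2,3) R a(3) in auto)
    then show ?thesis using \<gamma>(2,4) by simp
  qed
  define w where "w = grad R p - ((grad R p \<bullet> grad a p) / (grad a p \<bullet> grad a p)) *\<^sub>R grad a p"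
  have "grad a p \<bullet> w = 0" using a(2) by (simp add: w_def inner_diff_right inner_commute)
  then have "grad R p \<bullet> w = 0" "grad a p \<bullet> w = 0" using perp by auto
  then have "w \<bullet> w = 0" by (subst (1) w_def) (simp add: inner_diff_left)
  then show ?thesis by (simp add: w_def)
qed

section \<open>Zeros of ideals and ranks in three dimensions\<close>

lemma grad_add: "u differentiable (at p) \<Longrightarrow> v differentiable (at p) \<Longrightarrow>
    grad (\<lambda>p. u p + v p) p = grad u p + grad v p"
  by (rule grad_eqI) (simp add: grad_unique[OF has_derivative_add[OF has_derivative_grad has_derivative_grad]] inner_add_left)

lemma grad_diff: "u differentiable (at p) \<Longrightarrow> v differentiable (at p) \<Longrightarrow>
    grad (\<lambda>p. u p - v p) p = grad u p - grad v p"
  by (rule grad_eqI) (simp add: grad_unique[OF has_derivative_diff[OF has_derivative_grad has_derivative_grad]] inner_diff_left)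

lemma grad_mult: "u differentiable (at p) \<Longrightarrow> v differentiable (at p) \<Longrightarrow>
    grad (\<lambda>p. u p * v p) p = u p *\<^sub>R grad v p + v p *\<^sub>R grad u p"
  by (rule grad_eqI) (simp add: grad_unique[OF has_derivative_mult[OF has_derivative_grad has_derivative_grad]] inner_add_left)

lemma jacobian_rows:
  fixes F :: "real^3 \<Rightarrow> real^3"
  assumes "\<And>i. (\<lambda>q. F q $ i) differentiable (at p)"
  shows "jacobian F (at p) $ i = grad (\<lambda>q. F q $ i) p"
proof -
  let ?D = "\<lambda>v. ((grad (\<lambda>q. F q $ 1) p \<bullet> v) *\<^sub>R (axis 1 1 :: real^3) + (grad (\<lambda>q. F q $ 2) p \<bullet> v) *\<^sub>R axis 2 1)
     + (grad (\<lambda>q. F q $ 3) p \<bullet> v) *\<^sub>R axis 3 1"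
  have F: "F q = ((F q $ 1) *\<^sub>R (axis 1 1 :: real^3) + (F q $ 2) *\<^sub>R axis 2 1) + (F q $ 3) *\<^sub>R axis 3 1" for q
    by (simp add: vec_eq_iff forall_3 axis_def)
  have "((\<lambda>q. ((F q $ 1) *\<^sub>R (axis 1 1 :: real^3) + (F q $ 2) *\<^sub>R axis 2 1) + (F q $ 3) *\<^sub>R axis 3 1) has_derivative ?D) (at p)"
    by (intro has_derivative_add has_derivative_scaleR_left has_derivative_grad assms)
  then have d: "(F has_derivative ?D) (at p)" using F by (metis (no_types, lifting) ext)
  have "jacobian F (at p) = matrix ?D" by (simp add: jacobian_def frechet_derivative_at[OF d, symmetric])
  then have "jacobian F (at p) $ i $ j = ?D (axis j 1) $ i" for j by (simp add: matrix_def)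
  then have "jacobian F (at p) $ i $ j = grad (\<lambda>q. F q $ 1) p $ j * (axis 1 1 :: real^3) $ i
      + grad (\<lambda>q. F q $ 2) p $ j * (axis 2 1 :: real^3) $ i + grad (\<lambda>q. F q $ 3) p $ j * (axis 3 1 :: real^3) $ i" for j
    by (simp add: inner_axis)
  then show "jacobian F (at p) $ i = grad (\<lambda>q. F q $ i) p"
    using exhaust_3[of i] by (auto simp: vec_eq_iff axis_def)
qed

lemma det_rows: "det (M :: real^3^3) = M $ 1 \<bullet> cross3 (M $ 2) (M $ 3)"
  by (simp add: det_3 cross_components inner_vec_def sum_3 algebra_simps)

lemma vanishing_ideal: "ideal {u. poly3 u \<and> u p = 0} poly3_ring"
proof -
  interpret cring poly3_ring by (rule cring_poly3_ring)
  show ?thesis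
  proof (rule idealI)
    show "subgroup {u. poly3 u \<and> u p = 0} (add_monoid poly3_ring)"
    proof (rule add.subgroupI)
      fix u assume "u \<in> {u. poly3 u \<and> u p = 0}"
      moreover from this have "\<ominus>\<^bsub>poly3_ring\<^esub> u = (\<lambda>p. - u p)"
        by (intro minus_equality) (auto simp: real_polynomial_function_minus)
      ultimately show "\<ominus>\<^bsub>poly3_ring\<^esub> u \<in> {u. poly3 u \<and> u p = 0}"
        by (simp add: real_polynomial_function_minus)
    qed (auto simp: poly3_intros intro: exI[of _ "\<lambda>p. 0"])
  qed (auto simp: poly3_intros ring_axioms)
qed

lemma zero_set_genideal:
  assumes "\<And>u. u \<in> S \<Longrightarrow> poly3 u"
  shows "p \<in> zero_set (Idl\<^bsub>poly3_ring\<^esub> S) \<longleftrightarrow> (\<forall>u\<in>S. u p = 0)"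
proof -
  interpret cring poly3_ring by (rule cring_poly3_ring)
  have S: "S \<subseteq> carrier poly3_ring" using assms by auto
  have "S \<subseteq> Idl\<^bsub>poly3_ring\<^esub> S" by (rule genideal_self[OF S])
  moreover have "Idl\<^bsub>poly3_ring\<^esub> S \<subseteq> {u. poly3 u \<and> u p = 0}" if "\<forall>u\<in>S. u p = 0"
    by (rule genideal_minimal[OF vanishing_ideal]) (use assms that in auto)
  ultimately show ?thesis by (auto simp: zero_set_def)
qed

text \<open>
  The polynomials vanishing at \<open>p\<close> form a proper ideal. This is how the hypotheses \<open>I\<^sub>1 = I\<^sub>2 = I\<^sub>3 = \<real>[x,y,z]\<close> are
  used.
\<close>

lemma unit_ideal_no_zero:
  assumes "\<And>u. u \<in> S \<Longrightarrow> poly3 u" "Idl\<^bsub>poly3_ring\<^esub> S = carrier poly3_ring"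
  shows "\<exists>u\<in>S. u p \<noteq> 0"
proof (rule ccontr)
  assume "\<not> ?thesis"
  then have "p \<in> zero_set (carrier poly3_ring)" using zero_set_genideal[OF assms(1), of S p] assms(2) by auto
  moreover have "(\<lambda>p. 1) \<in> carrier poly3_ring" by (simp add: poly3_intros)
  ultimately show False by (auto simp: zero_set_def)
qed

lemma poly3_minors2: "(\<And>u. u \<in> set us \<Longrightarrow> poly3 u) \<Longrightarrow> m \<in> minors2 us \<Longrightarrow> poly3 m"
  unfolding minors2_def
  by (auto intro!: poly3_intros real_polynomial_function_diff poly3_partial_deriv)

lemma minor_nonzero:
  assumes "m \<in> minors2 us" "m p \<noteq> 0"
  shows "\<exists>r s. r < s \<and> s < length us \<and> cross3 (grad (us ! r) p) (grad (us ! s) p) \<noteq> 0"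
proof -
  obtain r s k l where m: "m = (\<lambda>p. partial_deriv k (us ! r) p * partial_deriv l (us ! s) p
                   - partial_deriv l (us ! r) p * partial_deriv k (us ! s) p)"
    and rs: "r < s" "s < length us" and kl: "(k, l) \<in> index_pairs"
    using assms(1) unfolding minors2_def by blast
  have "cross3 (grad (us ! r) p) (grad (us ! s) p) \<noteq> 0"
  proof
    assume "cross3 (grad (us ! r) p) (grad (us ! s) p) = 0"
    then have "m p = 0"
      using kl by (auto simp: m index_pairs_def vec_eq_iff forall_3 cross_components grad_def algebra_simps)
    then show False using assms(2) by simp
  qed
  then show ?thesis using rs by blast
qed

lemma parallel_cross:
  fixes a b K v :: "real^3"
  assumes "a \<bullet> v = 0" "b \<bullet> v = 0" "cross3 a b \<noteq> 0"
  shows "v = ((v \<bullet> cross3 a b) / (cross3 a b \<bullet> cross3 a b)) *\<^sub>R cross3 a b"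
proof -
  let ?K = "cross3 a b"
  have "v = (1 / (?K \<bullet> ?K)) *\<^sub>R ((?K \<bullet> ?K) *\<^sub>R v)" using assms(3) by simp
  also have "\<dots> = (1 / (?K \<bullet> ?K)) *\<^sub>R ((?K \<bullet> v) *\<^sub>R ?K)" by (simp only: cross3_kernel[OF assms(1,2)])
  finally show ?thesis by (simp add: inner_commute)
qed

text \<open>
  The set \<open>T\<close> spans the plane orthogonal to \<open>n\<close>, and \<open>M\<close> has kernel \<open>\<real> K\<close>. The image of the plane has dimension
  \<open>1\<close> if the kernel lies in the plane, and \<open>2\<close> otherwise. Only multiples of the tangent vectors are asked to
  be in \<open>T\<close>, since curves are constructed with unspecified speed.
\<close>

lemma dim_image_hyperplane:
  fixes M :: "real^3^3" and n K :: "real^3"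
  assumes n: "n \<noteq> 0" and K: "K \<noteq> 0" "M *v K = 0" and ker: "\<And>v. M *v v = 0 \<Longrightarrow> \<exists>c. v = c *\<^sub>R K"
    and T: "\<And>v. v \<in> T \<Longrightarrow> n \<bullet> v = 0" "\<And>v. n \<bullet> v = 0 \<Longrightarrow> \<exists>c\<noteq>0. c *\<^sub>R v \<in> T"
  shows "dim ((*v) M ` T) = 1 \<longleftrightarrow> n \<bullet> K = 0"
proof -
  have spT: "span T = {v. n \<bullet> v = 0}"
  proof (intro equalityI subsetI)
    fix v assume "v \<in> span T"
    moreover have "span T \<subseteq> {v. n \<bullet> v = 0}"
      by (rule span_minimal) (use T(1) subspace_hyperplane in auto)
    ultimately show "v \<in> {v. n \<bullet> v = 0}" by auto
  next
    fix v assume "v \<in> {v. n \<bullet> v = 0}"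
    then obtain c where c: "c \<noteq> 0" "c *\<^sub>R v \<in> T" using T(2) by auto
    then have "(1 / c) *\<^sub>R (c *\<^sub>R v) \<in> span T" by (intro span_mul span_base)
    then show "v \<in> span T" using c by simp
  qed
  have lin: "linear ((*v) M)" by simp
  have dimP: "dim ((*v) M ` T) = dim ((*v) M ` {v. n \<bullet> v = 0})"
    by (metis dim_span spT linear_span_image lin)
  show ?thesis
  proof (cases "n \<bullet> K = 0")
    case True
    define v0 where "v0 = cross3 n K"
    have v0: "v0 \<noteq> 0" "n \<bullet> v0 = 0" "K \<bullet> v0 = 0"
      using norm_and_cross_eq_0[of n K] n K True by (auto simp: v0_def dot_cross_self)
    have "M *v v0 \<noteq> 0"
    proof
      assume "M *v v0 = 0"
      then obtain c where "v0 = c *\<^sub>R K" using ker by blast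
      then show False using v0(1,3) K(1) by auto
    qed
    moreover have "(*v) M ` {v. n \<bullet> v = 0} = span {M *v v0}"
    proof (intro equalityI subsetI)
      fix w assume "w \<in> (*v) M ` {v. n \<bullet> v = 0}"
      then obtain x where x: "n \<bullet> x = 0" "w = M *v x" by auto
      define y where "y = x - ((x \<bullet> K) / (K \<bullet> K)) *\<^sub>R K"
      have "n \<bullet> y = 0" "K \<bullet> y = 0"
        using x(1) True K(1) by (simp_all add: y_def inner_diff_right inner_commute)
      from parallel_cross[OF this] v0(1) obtain c where c: "y = c *\<^sub>R v0" unfolding v0_def by blast
      have "M *v y = w"
        using K(2) by (simp add: y_def x(2) linear_diff[OF lin] linear_scale[OF lin])
      then have "w = c *\<^sub>R (M *v v0)" by (simp add: c linear_scale[OF lin])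
      then show "w \<in> span {M *v v0}" by (auto simp: span_singleton)
    next
      fix w assume "w \<in> span {M *v v0}"
      then obtain c where "w = M *v (c *\<^sub>R v0)" by (auto simp: span_singleton linear_scale[OF lin])
      then show "w \<in> (*v) M ` {v. n \<bullet> v = 0}" using v0(2) by auto
    qed
    ultimately show ?thesis using True by (simp add: dimP)
  next
    case False
    have "inj_on ((*v) M) {v. n \<bullet> v = 0}"
    proof (rule inj_onI)
      fix x y assume xy: "x \<in> {v. n \<bullet> v = 0}" "y \<in> {v. n \<bullet> v = 0}" "M *v x = M *v y"
      then have "M *v (x - y) = 0" by (simp add: linear_diff[OF lin])
      then obtain c where c: "x - y = c *\<^sub>R K" using ker by blast
      have "n \<bullet> (x - y) = 0" using xy by (simp add: inner_diff_right)
      then have "c = 0" using False by (simp add: c)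
      then show "x = y" using c by simp
    qed
    then have "dim ((*v) M ` {v. n \<bullet> v = 0}) = dim {v. n \<bullet> v = 0}"
      by (intro dim_image_eq[OF lin]) (simp add: span_eq_iff[THEN iffD2, OF subspace_hyperplane])
    then show ?thesis using False dim_hyperplane[OF n] by (simp add: dimP)
  qed
qed

lemma rank_eq_2_iff:
  fixes M :: "real^3^3"
  assumes "det M = 0 \<Longrightarrow> \<exists>i j. cross3 (M $ i) (M $ j) \<noteq> 0"
  shows "rank M = 2 \<longleftrightarrow> det M = 0"
proof
  assume "rank M = 2"
  then show "det M = 0" by (simp add: det_eq_0_rank)
next
  assume d: "det M = 0"
  then obtain i j where ij: "cross3 (M $ i) (M $ j) \<noteq> 0" using assms by blast
  have ne: "M $ i \<noteq> M $ j" using ij by auto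
  have "independent {M $ i, M $ j}"
  proof (rule ccontr)
    assume "\<not> ?thesis"
    then have "M $ i \<in> span {M $ j} \<or> M $ j = 0"
      using independent_insert[of "M $ i" "{M $ j}"] ne by auto
    then show False using ij by (auto simp: span_singleton cross_mult_left)
  qed
  moreover have "{M $ i, M $ j} \<subseteq> rows M" by (auto simp: rows_def row_def)
  ultimately have "card {M $ i, M $ j} \<le> dim (rows M)"
    by (metis independent_card_le_dim)
  then have "2 \<le> rank M" using ne by (simp add: row_rank_def)
  moreover have "rank M < 3" using d by (simp add: det_eq_0_rank)
  ultimately show "rank M = 2" by simp
qed

section \<open>Change of the kernel field\<close>

locale polynomial_map =
  fixes f :: "real^3 \<Rightarrow> real^3"
  assumes poly_f: "polynomial_function f"
begin

abbreviation "g i \<equiv> grad (comp_fun f i)"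
abbreviation "J \<equiv> jac_det f"
abbreviation "Kf \<equiv> K_field f"

lemma poly3_comp: "poly3 (comp_fun f i)"
proof -
  have "comp_fun f i = (\<lambda>x. x $ i) \<circ> f" by (auto simp: comp_fun_def)
  then show ?thesis using poly_f bounded_linear_vec_nth by (auto simp: polynomial_function_def)
qed

lemma jacobian_f: "jacobian f (at p) $ i = g i p"
  using jacobian_rows[of f p i] poly3_differentiable[OF poly3_comp] by (simp add: comp_fun_def[abs_def])

lemma J_eq: "J p = g 1 p \<bullet> cross3 (g 2 p) (g 3 p)"
  by (simp add: jac_det_def det_rows jacobian_f)

lemma poly3_J: "poly3 J"
proof -
  have "J = (\<lambda>p. g 1 p \<bullet> cross3 (g 2 p) (g 3 p))" by (rule ext) (rule J_eq)
  then show ?thesis by (auto intro!: poly3_inner poly3_field_cross poly3_field_grad poly3_comp)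
qed

lemma poly3_field_K: "poly3_field (Kf i j)"
  unfolding K_field_def[abs_def] by (intro poly3_field_cross poly3_field_grad poly3_comp)

lemma poly3_X: "poly3_field K \<Longrightarrow> poly3 (X_fun f K)"
  unfolding X_fun_def[abs_def] by (intro poly3_inner poly3_field_grad poly3_J)

lemma poly3_Y: "poly3_field K \<Longrightarrow> poly3 (Y_fun f K)"
  unfolding Y_fun_def[abs_def] by (intro poly3_inner poly3_field_grad poly3_X)

lemma poly3_Z: "poly3_field K \<Longrightarrow> poly3 (Z_fun f K)"
  unfolding Z_fun_def[abs_def] by (intro poly3_inner poly3_field_grad poly3_Y)

lemma jacobian_mult: "(jacobian f (at p) *v v) $ i = g i p \<bullet> v"
  by (simp add: matrix_vector_mul_component jacobian_f)

lemma jacobian_mult_eq_0: "jacobian f (at p) *v v = 0 \<longleftrightarrow> (\<forall>i. g i p \<bullet> v = 0)"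
  by (simp add: vec_eq_iff jacobian_mult)

text \<open>
  Each entry is a determinant of gradients of components of \<open>f\<close>; it is \<open>\<plusminus>J\<close> or has a repeated row.
\<close>

lemma jacobian_K:
  assumes "J p = 0"
  shows "jacobian f (at p) *v Kf i j p = 0"
  unfolding jacobian_mult_eq_0
proof
  fix l
  have "g l p \<bullet> Kf i j p \<in> {0, J p, - J p}"
    using exhaust_3[of i] exhaust_3[of j] exhaust_3[of l]
    by (auto simp: K_field_def J_eq) (simp_all add: cross_components inner_vec_def sum_3 algebra_simps)
  then show "g l p \<bullet> Kf i j p = 0" using assms by auto
qed

lemma kernel_parallel:
  assumes "jacobian f (at p) *v v = 0" "Kf i j p \<noteq> 0"
  shows "v = ((v \<bullet> Kf i j p) / (Kf i j p \<bullet> Kf i j p)) *\<^sub>R Kf i j p"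
  using parallel_cross[of "g i p" v "g j p"] assms by (simp add: jacobian_mult_eq_0 K_field_def)

lemma det_H_map:
  assumes "X_fun f M differentiable (at p)" "Y_fun f M differentiable (at p)"
  shows "det (jacobian (H_map f M) (at p)) = grad J p \<bullet> cross3 (grad (X_fun f M) p) (grad (Y_fun f M) p)"
proof -
  have c: "(\<lambda>q. H_map f M q $ 1) = J" "(\<lambda>q. H_map f M q $ 2) = X_fun f M" "(\<lambda>q. H_map f M q $ 3) = Y_fun f M"
    by (simp_all add: H_map_def fun_eq_iff)
  have "(\<lambda>q. H_map f M q $ k) differentiable (at p)" for k
    using exhaust_3[of k] c assms poly3_differentiable[OF poly3_J] by auto
  note r = jacobian_rows[OF this]
  show ?thesis unfolding det_rows r c ..
qed

lemma g_fun_poly: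
  assumes "poly3_field K"
  shows "g_fun f K = (\<lambda>p. Z_fun f K p * (grad J p \<bullet> cross3 (grad (X_fun f K) p) (grad (Y_fun f K) p)))"
    and "poly3 (g_fun f K)"
proof -
  show eq: "g_fun f K = (\<lambda>p. Z_fun f K p * (grad J p \<bullet> cross3 (grad (X_fun f K) p) (grad (Y_fun f K) p)))"
    using det_H_map[of K] poly3_differentiable[OF poly3_X[OF assms]] poly3_differentiable[OF poly3_Y[OF assms]]
    by (simp add: g_fun_def[abs_def])
  show "poly3 (g_fun f K)"
    unfolding eq by (intro poly3_intros poly3_Z poly3_inner poly3_field_cross poly3_field_grad poly3_J poly3_X poly3_Y assms)
qed

end

text \<open>
  The pointwise content of the three hypotheses on ideals: \<open>{J = 0}\<close> is a regular surface, \<open>Df\<close> has rank at least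
  \<open>2\<close> on it, and two of \<open>J, X\<^sub>1\<^sub>2, X\<^sub>1\<^sub>3, X\<^sub>2\<^sub>3\<close> have independent gradients at their common zeros.
\<close>

locale swallowtail_map = polynomial_map +
  assumes gradJ: "\<And>p. J p = 0 \<Longrightarrow> grad J p \<noteq> 0"
    and K_nonzero: "\<And>p. J p = 0 \<Longrightarrow> \<exists>(i,j)\<in>index_pairs. Kf i j p \<noteq> 0"
    and X_independent: "\<And>p. J p = 0 \<Longrightarrow> \<forall>(i,j)\<in>index_pairs. X_fun f (Kf i j) p = 0 \<Longrightarrow>
      \<exists>u v. u \<in> {J, X_fun f (Kf 1 2), X_fun f (Kf 1 3), X_fun f (Kf 2 3)} \<and>
        v \<in> {J, X_fun f (Kf 1 2), X_fun f (Kf 1 3), X_fun f (Kf 2 3)} \<and> cross3 (grad u p) (grad v p) \<noteq> 0"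
begin

lemma S1_eq: "S1 f = {p. J p = 0}"
proof -
  have "rank (jacobian f (at p)) = 2 \<longleftrightarrow> J p = 0" for p
    unfolding jac_det_def
  proof (rule rank_eq_2_iff)
    assume "det (jacobian f (at p)) = 0"
    then have "J p = 0" by (simp add: jac_det_def)
    then obtain i j where "Kf i j p \<noteq> 0" using K_nonzero by blast
    then show "\<exists>i j. cross3 (jacobian f (at p) $ i) (jacobian f (at p) $ j) \<noteq> 0"
      by (auto simp: jacobian_f K_field_def)
  qed
  then show ?thesis by (simp add: S1_def)
qed

text \<open>
  Let \<open>L = K\<^sub>i\<^sub>j\<close> and let \<open>X0, Y0\<close> be the functions attached to it. On \<open>S\<^sub>1\<close> both fields span \<open>ker Df\<close>, so \<open>K = \<lambda> L\<close>
  there. A function that vanishes on \<open>S\<^sub>1\<close> has a gradient parallel to \<open>\<nabla>J\<close>. Applied to \<open>X - \<lambda> X0\<close> this determines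
  \<open>\<nabla>X\<close> on \<open>S\<^sub>1\<close> modulo \<open>\<nabla>J\<close>, and pairing with \<open>K\<close> gives \<open>Y = \<lambda>\<^sup>2 Y0 + \<nu> X0\<close> on \<open>S\<^sub>1\<close> with smooth \<open>\<nu>\<close>. The same
  argument for \<open>Y - \<lambda>\<^sup>2 Y0 - \<nu> X0\<close> determines \<open>\<nabla>Y\<close> modulo \<open>\<nabla>J\<close>. At a common zero of \<open>J\<close>, \<open>X0\<close> and \<open>Y0\<close> all correction
  terms drop out.
\<close>

lemma kernel_field_change:
  assumes p0: "J p0 = 0" and K0: "Kf i j p0 \<noteq> 0"
    and K: "open U" "p0 \<in> U" "smooth_on K U" "\<forall>p\<in>U. J p = 0 \<longrightarrow> jacobian f (at p) *v K p = 0"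
  shows "\<exists>l. K p0 = l *\<^sub>R Kf i j p0 \<and> X_fun f K p0 = l * X_fun f (Kf i j) p0 \<and>
    (X_fun f (Kf i j) p0 = 0 \<longrightarrow> Y_fun f K p0 = l\<^sup>2 * Y_fun f (Kf i j) p0 \<and>
      (\<exists>m. grad (X_fun f K) p0 = l *\<^sub>R grad (X_fun f (Kf i j)) p0 + m *\<^sub>R grad J p0)) \<and>
    (X_fun f (Kf i j) p0 = 0 \<and> Y_fun f (Kf i j) p0 = 0 \<longrightarrow>
      g_fun f K p0 = l ^ 6 * g_fun f (Kf i j) p0 \<and>
      grad J p0 \<bullet> cross3 (grad (X_fun f K) p0) (grad (Y_fun f K) p0) =
        l ^ 3 * (grad J p0 \<bullet> cross3 (grad (X_fun f (Kf i j)) p0) (grad (Y_fun f (Kf i j)) p0)))"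
proof -
  define L where "L = Kf i j"
  define X where "X = X_fun f K" define X0 where "X0 = X_fun f L"
  define Y where "Y = Y_fun f K" define Y0 where "Y0 = Y_fun f L"
  have pL: "poly3_field L" by (simp add: L_def poly3_field_K)
  have pX0: "poly3 X0" and pY0: "poly3 Y0" using poly3_X[OF pL] poly3_Y[OF pL] by (simp_all add: X0_def Y0_def)
  have X_at: "X q = grad J q \<bullet> K q" "X0 q = grad J q \<bullet> L q"
    "Y q = grad X q \<bullet> K q" "Y0 q = grad X0 q \<bullet> L q" for q
    by (simp_all add: X_def X0_def Y_def Y0_def X_fun_def Y_fun_def)
  \<comment> \<open>here the denominators of \<open>\<lambda>\<close> and \<open>\<mu>\<close> do not vanish\<close>
  define V where "V = U \<inter> {q. L q \<bullet> L q \<noteq> 0} \<inter> {q. grad J q \<bullet> grad J q \<noteq> 0}"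
  have V: "open V" "p0 \<in> V"
    using K(1,2) open_poly3_nonzero[OF poly3_inner[OF pL pL]]
      open_poly3_nonzero[OF poly3_inner[OF poly3_field_grad[OF poly3_J] poly3_field_grad[OF poly3_J]]]
      K0 gradJ[OF p0] by (auto simp: V_def L_def)
  have sK: "smooth_on K V" by (rule smooth_on_subset[OF K(3)]) (auto simp: V_def)
  have sL: "smooth_on L V" by (rule smooth_on_poly3_field[OF pL V(1)])
  have sJ: "smooth_on J V" by (rule smooth_on_poly3[OF poly3_J V(1)])
  have sgJ: "smooth_on (grad J) V" by (rule smooth_on_poly3_field[OF poly3_field_grad[OF poly3_J] V(1)])
  have sX0: "smooth_on X0 V" "smooth_on Y0 V" by (rule smooth_on_poly3[OF pX0 V(1)], rule smooth_on_poly3[OF pY0 V(1)])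
  have sX: "smooth_on X V"
    unfolding X_def X_fun_def[abs_def] by (rule smooth_on_grad_inner[OF V(1) sJ sK])
  have sY: "smooth_on Y V"
    unfolding Y_def Y_fun_def[abs_def] X_def[symmetric] by (rule smooth_on_grad_inner[OF V(1) sX sK])
  define lam where "lam q = (K q \<bullet> L q) * inverse (L q \<bullet> L q)" for q
  have slam: "smooth_on lam V"
    unfolding lam_def[abs_def]
    by (intro smooth_on_mult smooth_on_inverse smooth_on_inner V(1) sK sL) (auto simp: V_def)
  have Keq: "K q = lam q *\<^sub>R L q" if "q \<in> V" "J q = 0" for q
    using kernel_parallel[of q "K q" i j] K(4) that by (auto simp: V_def lam_def L_def divide_inverse)
  define R1 where "R1 q = X q - lam q * X0 q" for q
  have sR1: "smooth_on R1 V"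
    unfolding R1_def[abs_def] by (intro smooth_on_diff smooth_on_mult V(1) sX slam sX0)
  have R1: "R1 q = 0" if "q \<in> V" "J q = 0" for q
    using Keq[OF that] by (simp add: R1_def X_at)
  define mu where "mu q = (grad R1 q \<bullet> grad J q) * inverse (grad J q \<bullet> grad J q)" for q
  have smu: "smooth_on mu V"
    unfolding mu_def[abs_def]
    by (intro smooth_on_mult smooth_on_inverse smooth_on_inner smooth_on_grad_inner V(1) sR1 sgJ) (auto simp: V_def)
  note dif = smooth_on_differentiable
  have gR1: "grad R1 q = mu q *\<^sub>R grad J q" if q: "q \<in> V" "J q = 0" for q
    using grad_parallel[OF poly3_J gradJ[OF q(2)] q(2) V(1) q(1) dif[OF sR1 q(1)] R1]
    by (simp add: mu_def divide_inverse)
  have gX: "grad X q = mu q *\<^sub>R grad J q + lam q *\<^sub>R grad X0 q + X0 q *\<^sub>R grad lam q" if q: "q \<in> V" "J q = 0" for q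
  proof -
    have "grad R1 q = grad X q - (lam q *\<^sub>R grad X0 q + X0 q *\<^sub>R grad lam q)"
      unfolding R1_def[abs_def]
      by (simp add: grad_diff grad_mult dif[OF sX q(1)] dif[OF slam q(1)] dif[OF sX0(1) q(1)] differentiable_mult)
    then show ?thesis using gR1[OF q] by (simp add: algebra_simps)
  qed
  define nu where "nu q = lam q * (grad lam q \<bullet> L q + mu q)" for q
  have snu: "smooth_on nu V"
    unfolding nu_def[abs_def]
    by (intro smooth_on_mult smooth_on_add smooth_on_grad_inner V(1) slam sL smu)
  define R2 where "R2 q = Y q - (lam q * lam q * Y0 q + nu q * X0 q)" for q
  have sR2: "smooth_on R2 V"
    unfolding R2_def[abs_def] by (intro smooth_on_diff smooth_on_add smooth_on_mult V(1) sY slam sX0 snu)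
  have R2: "R2 q = 0" if q: "q \<in> V" "J q = 0" for q
    using gX[OF q] Keq[OF q] by (simp add: R2_def X_at nu_def inner_add_left algebra_simps)
  obtain m2 where m2: "grad R2 p0 = m2 *\<^sub>R grad J p0"
    using grad_parallel[OF poly3_J gradJ[OF p0] p0 V(1,2) dif[OF sR2 V(2)] R2] by blast
  have gR2: "grad R2 p0 = grad Y p0 - ((lam p0 * lam p0) *\<^sub>R grad Y0 p0
      + Y0 p0 *\<^sub>R grad (\<lambda>q. lam q * lam q) p0 + (nu p0 *\<^sub>R grad X0 p0 + X0 p0 *\<^sub>R grad nu p0))"
  proof -
    note d = dif[OF sY V(2)] dif[OF slam V(2)] dif[OF sX0(1) V(2)] dif[OF sX0(2) V(2)] dif[OF snu V(2)]
    show ?thesis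
      unfolding R2_def[abs_def]
      by (subst grad_diff, (intro d differentiable_mult differentiable_add)+,
          subst grad_add, (intro d differentiable_mult differentiable_add)+,
          subst grad_mult, (intro d differentiable_mult differentiable_add)+,
          subst (2) grad_mult, (intro d differentiable_mult differentiable_add)+) simp
  qed
  define l where "l = lam p0"
  have at0: "K p0 = l *\<^sub>R L p0" unfolding l_def by (rule Keq[OF V(2) p0])
  have Xl: "X p0 = l * X0 p0" by (simp add: X_at at0)
  have gX0: "grad X p0 = l *\<^sub>R grad X0 p0 + mu p0 *\<^sub>R grad J p0" if "X0 p0 = 0"
    using gX[OF V(2) p0] that by (simp add: l_def)
  have Yl: "Y p0 = l\<^sup>2 * Y0 p0" if "X0 p0 = 0"
    using R2[OF V(2) p0] that by (simp add: R2_def power2_eq_square l_def)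
  have gY: "grad Y p0 = l\<^sup>2 *\<^sub>R grad Y0 p0 + nu p0 *\<^sub>R grad X0 p0 + m2 *\<^sub>R grad J p0"
    if "X0 p0 = 0" "Y0 p0 = 0"
    using gR2 m2 that by (simp add: algebra_simps power2_eq_square l_def)
  have tri: "n \<bullet> cross3 (l *\<^sub>R a + m *\<^sub>R n) (l\<^sup>2 *\<^sub>R b + v *\<^sub>R a + m' *\<^sub>R n) = l ^ 3 * (n \<bullet> cross3 a b)"
    for n a b :: "real^3" and m v m' :: real
    by (simp add: cross_components inner_vec_def sum_3 algebra_simps power2_eq_square power3_eq_cube)
  have triple: "grad J p0 \<bullet> cross3 (grad X p0) (grad Y p0) = l ^ 3 * (grad J p0 \<bullet> cross3 (grad X0 p0) (grad Y0 p0))"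
    if z: "X0 p0 = 0" "Y0 p0 = 0"
    unfolding gX0[OF z(1)] gY[OF z] by (rule tri)
  have gl: "g_fun f K p0 = l ^ 6 * g_fun f L p0" if z: "X0 p0 = 0" "Y0 p0 = 0"
  proof -
    have "grad X0 p0 \<bullet> L p0 = 0" "grad J p0 \<bullet> L p0 = 0" using z by (simp_all add: X_at)
    then have Zl: "Z_fun f K p0 = l ^ 3 * Z_fun f L p0"
      unfolding Z_fun_def Y_def[symmetric] Y0_def[symmetric] gY[OF z] at0
      by (simp add: inner_add_left power2_eq_square power3_eq_cube)
    have "det (jacobian (H_map f K) (at p0)) = l ^ 3 * det (jacobian (H_map f L) (at p0))"
      using triple[OF z] det_H_map[of K p0] det_H_map[of L p0]
        dif[OF sX V(2)] dif[OF sY V(2)] dif[OF sX0(1) V(2)] dif[OF sX0(2) V(2)]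
      by (simp add: X_def X0_def Y_def Y0_def)
    then show ?thesis
      using Zl by (simp add: g_fun_def power_mult_distrib eval_nat_numeral)
  qed
  show ?thesis
    unfolding L_def[symmetric] X_def[symmetric] X0_def[symmetric] Y_def[symmetric] Y0_def[symmetric]
    by (intro exI[of _ l] conjI impI exI[of _ "mu p0"]) (use at0 Xl Yl gX0 gl triple in auto)
qed

end

section \<open>The singular sets and the swallowtail sign\<close>

lemma triple_independent:
  fixes x y z :: "real^3"
  assumes "x \<bullet> cross3 y z \<noteq> 0" "a *\<^sub>R x + b *\<^sub>R y + c *\<^sub>R z = 0"
  shows "a = 0 \<and> b = 0 \<and> c = 0"
proof -
  let ?v = "a *\<^sub>R x + b *\<^sub>R y + c *\<^sub>R z"
  have e: "?v \<bullet> cross3 y z = a * (x \<bullet> cross3 y z)" "?v \<bullet> cross3 z x = b * (x \<bullet> cross3 y z)"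
    "?v \<bullet> cross3 x y = c * (x \<bullet> cross3 y z)"
    by (simp_all add: cross_components inner_vec_def sum_3 algebra_simps)
  show ?thesis using e assms(1) unfolding assms(2) by simp
qed

lemma cross3_eq_0_multiple:
  fixes x y :: "real^3"
  assumes "cross3 x y = 0" "x \<noteq> 0"
  shows "\<exists>c. y = c *\<^sub>R x"
proof -
  have "cross3 x (cross3 y x) = (x \<bullet> x) *\<^sub>R y - (x \<bullet> y) *\<^sub>R x"
    by (simp add: vec_eq_iff forall_3 cross_components inner_vec_def sum_3 algebra_simps)
  moreover have "cross3 y x = 0" using assms(1) cross_skew[of y x] by simp
  ultimately have "(x \<bullet> x) *\<^sub>R y = (x \<bullet> y) *\<^sub>R x" by simp
  moreover have "y = (1 / (x \<bullet> x)) *\<^sub>R ((x \<bullet> x) *\<^sub>R y)" using assms(2) by simp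
  ultimately have "y = (1 / (x \<bullet> x)) *\<^sub>R ((x \<bullet> y) *\<^sub>R x)" by metis
  then have "y = ((x \<bullet> y) / (x \<bullet> x)) *\<^sub>R x" by simp
  then show ?thesis by (rule exI)
qed

context swallowtail_map
begin

lemma K_field_change:
  assumes "J p = 0" "Kf i j p \<noteq> 0"
  shows "\<exists>l. X_fun f (Kf a b) p = l * X_fun f (Kf i j) p \<and>
    (X_fun f (Kf i j) p = 0 \<longrightarrow> Y_fun f (Kf a b) p = l\<^sup>2 * Y_fun f (Kf i j) p \<and>
      (\<exists>m. grad (X_fun f (Kf a b)) p = l *\<^sub>R grad (X_fun f (Kf i j)) p + m *\<^sub>R grad J p)) \<and>
    (X_fun f (Kf i j) p = 0 \<and> Y_fun f (Kf i j) p = 0 \<longrightarrow> g_fun f (Kf a b) p = l ^ 6 * g_fun f (Kf i j) p)"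
proof -
  have "\<forall>q\<in>UNIV. J q = 0 \<longrightarrow> jacobian f (at q) *v Kf a b q = 0" by (simp add: jacobian_K)
  from kernel_field_change[OF assms open_UNIV UNIV_I smooth_on_poly3_field[OF poly3_field_K open_UNIV] this]
  show ?thesis by blast
qed

lemma X_fun_zero_all_fields:
  assumes "J p = 0" "Kf i j p \<noteq> 0" "X_fun f (Kf i j) p = 0"
  shows "X_fun f (Kf a b) p = 0"
  using K_field_change[OF assms(1,2), of a b] assms(3) by auto

lemma Y_fun_zero_all_fields:
  assumes "J p = 0" "Kf i j p \<noteq> 0" "X_fun f (Kf i j) p = 0" "Y_fun f (Kf i j) p = 0"
  shows "Y_fun f (Kf a b) p = 0"
  using K_field_change[OF assms(1,2), of a b] assms(3,4) by auto

text \<open>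
  The tangent plane of \<open>S\<^sub>1\<close> is orthogonal to \<open>\<nabla>J\<close>, and it contains the kernel direction \<open>K\<close> of \<open>Df\<close> exactly when
  \<open>X = \<langle>\<nabla>J, K\<rangle>\<close> vanishes.
\<close>

lemma S11_eq: "S11 f = {p. J p = 0 \<and> (\<forall>(i,j)\<in>index_pairs. X_fun f (Kf i j) p = 0)}"
proof -
  have "rank_restr f (S1 f) p = 1 \<longleftrightarrow> (\<forall>(i,j)\<in>index_pairs. X_fun f (Kf i j) p = 0)" if p: "J p = 0" for p
  proof -
    obtain i j where ij: "(i,j) \<in> index_pairs" "Kf i j p \<noteq> 0" using K_nonzero[OF p] by blast
    have "rank_restr f (S1 f) p = 1 \<longleftrightarrow> grad J p \<bullet> Kf i j p = 0"
      unfolding rank_restr_def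
    proof (rule dim_image_hyperplane[OF gradJ[OF p] ij(2) jacobian_K[OF p]])
      fix v assume "jacobian f (at p) *v v = 0"
      from kernel_parallel[OF this ij(2)] show "\<exists>c. v = c *\<^sub>R Kf i j p" by blast
    next
      fix v assume "v \<in> tangent_space (S1 f) p"
      then obtain \<gamma> e where \<gamma>: "0 < e" "\<gamma> ` {-e<..<e} \<subseteq> S1 f" "\<gamma> 0 = p"
        "(\<gamma> has_vector_derivative v) (at (0::real))"
        unfolding tangent_space_def by blast
      have on: "J (\<gamma> t) = 0" if "t \<in> {-e<..<e}" for t
      proof -
        have "\<gamma> t \<in> S1 f" using \<gamma>(2) that by auto
        then show ?thesis by (simp add: S1_eq)
      qed
      have "grad J (\<gamma> 0) \<bullet> v = 0"
        by (rule curve_tangent[OF \<gamma>(4) poly3_differentiable[OF poly3_J] \<gamma>(1) on])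
      then show "grad J p \<bullet> v = 0" by (simp add: \<gamma>(3))
    next
      fix v assume v: "grad J p \<bullet> v = 0"
      obtain \<gamma> e c where \<gamma>: "0 < e" "smooth_on \<gamma> {-e<..<e}" "\<gamma> 0 = p"
        "\<forall>t\<in>{-e<..<e}. \<gamma> t \<in> UNIV \<and> J (\<gamma> t) = J p"
        "c \<noteq> 0" "(\<gamma> has_vector_derivative c *\<^sub>R v) (at (0::real))"
        using curve_in_surface[OF poly3_J gradJ[OF p] open_UNIV UNIV_I v]
        by (elim exE conjE) (rule that)
      have "\<gamma> ` {-e<..<e} \<subseteq> S1 f" using \<gamma>(4) p by (auto simp: S1_eq)
      then have "c *\<^sub>R v \<in> tangent_space (S1 f) p"
        unfolding tangent_space_def using \<gamma>(1-3,6) by blast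
      then show "\<exists>c. c \<noteq> 0 \<and> c *\<^sub>R v \<in> tangent_space (S1 f) p" using \<gamma>(5) by blast
    qed
    also have "\<dots> \<longleftrightarrow> (\<forall>(i,j)\<in>index_pairs. X_fun f (Kf i j) p = 0)"
    proof
      assume "grad J p \<bullet> Kf i j p = 0"
      then have "X_fun f (Kf i j) p = 0" by (simp add: X_fun_def)
      from X_fun_zero_all_fields[OF p ij(2) this]
      show "\<forall>(i,j)\<in>index_pairs. X_fun f (Kf i j) p = 0" by (simp add: split_beta)
    next
      assume "\<forall>(i,j)\<in>index_pairs. X_fun f (Kf i j) p = 0"
      then have "X_fun f (Kf i j) p = 0" using ij(1) by blast
      then show "grad J p \<bullet> Kf i j p = 0" by (simp add: X_fun_def)
    qed
    finally show ?thesis .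
  qed
  then show ?thesis by (auto simp: S11_def S1_eq)
qed

text \<open>
  At such a point all \<open>\<nabla>X\<^sub>k\<^sub>l\<close> are combinations of \<open>\<nabla>J\<close> and \<open>\<nabla>X\<^sub>i\<^sub>j\<close>. If these two were parallel, no two of the four
  gradients would be independent.
\<close>

lemma grad_J_X_independent:
  assumes p: "J p = 0" "Kf i j p \<noteq> 0" "X_fun f (Kf i j) p = 0"
  shows "cross3 (grad J p) (grad (X_fun f (Kf i j)) p) \<noteq> 0"
proof
  assume "cross3 (grad J p) (grad (X_fun f (Kf i j)) p) = 0"
  from cross3_eq_0_multiple[OF this gradJ[OF p(1)]]
  obtain c where c: "grad (X_fun f (Kf i j)) p = c *\<^sub>R grad J p" by blast
  have mult: "\<exists>c. grad (X_fun f (Kf a b)) p = c *\<^sub>R grad J p" for a b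
  proof -
    obtain l where "X_fun f (Kf i j) p = 0 \<longrightarrow> Y_fun f (Kf a b) p = l\<^sup>2 * Y_fun f (Kf i j) p \<and>
      (\<exists>m. grad (X_fun f (Kf a b)) p = l *\<^sub>R grad (X_fun f (Kf i j)) p + m *\<^sub>R grad J p)"
      using K_field_change[OF p(1,2), of a b] by (elim exE conjE) (rule that)
    from mp[OF this p(3)] obtain m where
      "grad (X_fun f (Kf a b)) p = l *\<^sub>R grad (X_fun f (Kf i j)) p + m *\<^sub>R grad J p"
      by (elim exE conjE) (rule that)
    then have "grad (X_fun f (Kf a b)) p = (l * c + m) *\<^sub>R grad J p" by (simp add: c algebra_simps)
    then show ?thesis by blast
  qed
  have "\<exists>c. grad u p = c *\<^sub>R grad J p"
    if "u \<in> {J, X_fun f (Kf 1 2), X_fun f (Kf 1 3), X_fun f (Kf 2 3)}" for u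
  proof -
    have "\<exists>c. grad J p = c *\<^sub>R grad J p" by (rule exI[of _ 1]) simp
    then show ?thesis using that mult by auto
  qed
  note all_mult = this
  have "\<forall>(i,j)\<in>index_pairs. X_fun f (Kf i j) p = 0"
    using X_fun_zero_all_fields[OF p] by (simp add: split_beta)
  from X_independent[OF p(1) this] obtain u v where
    uv: "u \<in> {J, X_fun f (Kf 1 2), X_fun f (Kf 1 3), X_fun f (Kf 2 3)}"
    "v \<in> {J, X_fun f (Kf 1 2), X_fun f (Kf 1 3), X_fun f (Kf 2 3)}"
    and ne: "cross3 (grad u p) (grad v p) \<noteq> 0" by (elim exE conjE) (rule that)
  obtain c d where "grad u p = c *\<^sub>R grad J p" "grad v p = d *\<^sub>R grad J p"
    using all_mult[OF uv(1)] all_mult[OF uv(2)] by (elim exE) (rule that)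
  with ne show False by (simp add: cross_mult_left cross_mult_right)
qed

text \<open>
  Near a point where \<open>K\<^sub>i\<^sub>j \<noteq> 0\<close> the set \<open>S\<^sub>1\<^sub>,\<^sub>1\<close> is the curve \<open>J = X\<^sub>i\<^sub>j = 0\<close> with tangent \<open>w = \<nabla>J \<times> \<nabla>X\<^sub>i\<^sub>j\<close>. The restriction
  of \<open>f\<close> to it has rank \<open>0\<close> exactly when \<open>w\<close> is parallel to \<open>K\<^sub>i\<^sub>j\<close>. As \<open>K\<^sub>i\<^sub>j\<close> is already orthogonal to \<open>\<nabla>J\<close>, this means
  \<open>Y\<^sub>i\<^sub>j = \<langle>\<nabla>X\<^sub>i\<^sub>j, K\<^sub>i\<^sub>j\<rangle> = 0\<close>.
\<close>

lemma S111_eq: "S111 f = {p. J p = 0 \<and> (\<forall>(i,j)\<in>index_pairs. X_fun f (Kf i j) p = 0 \<and> Y_fun f (Kf i j) p = 0)}"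
proof -
  have "rank_restr f (S11 f) p = 0 \<longleftrightarrow> (\<forall>(i,j)\<in>index_pairs. Y_fun f (Kf i j) p = 0)"
    if p11: "p \<in> S11 f" for p
  proof -
    have p: "J p = 0" and all_X0: "\<forall>(i,j)\<in>index_pairs. X_fun f (Kf i j) p = 0"
      using p11 by (simp_all add: S11_eq)
    have X0: "X_fun f (Kf i j) p = 0" if "(i,j) \<in> index_pairs" for i j
      using bspec[OF all_X0 that] by simp
    obtain i j where ij: "(i,j) \<in> index_pairs" "Kf i j p \<noteq> 0" using K_nonzero[OF p] by blast
    let ?X = "X_fun f (Kf i j)" and ?M = "jacobian f (at p)" and ?T = "tangent_space (S11 f) p"
    have pX: "poly3 ?X" by (rule poly3_X[OF poly3_field_K])
    define w where "w = cross3 (grad J p) (grad ?X p)"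
    have w0: "w \<noteq> 0" unfolding w_def by (rule grad_J_X_independent[OF p ij(2) X0[OF ij(1)]])
    have T1: "\<exists>c. v = c *\<^sub>R w" if "v \<in> ?T" for v
    proof -
      obtain \<gamma> e where \<gamma>: "0 < e" "\<gamma> ` {-e<..<e} \<subseteq> S11 f" "\<gamma> 0 = p"
        "(\<gamma> has_vector_derivative v) (at (0::real))"
        using \<open>v \<in> ?T\<close> unfolding tangent_space_def by blast
      have on: "J (\<gamma> t) = 0 \<and> ?X (\<gamma> t) = 0" if "t \<in> {-e<..<e}" for t
      proof -
        have "\<gamma> t \<in> S11 f" using \<gamma>(2) that by auto
        then have "J (\<gamma> t) = 0" "\<forall>(i,j)\<in>index_pairs. X_fun f (Kf i j) (\<gamma> t) = 0"
          unfolding S11_eq by simp_all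
        from this(1) bspec[OF this(2) ij(1)] show ?thesis by simp
      qed
      have "grad J p \<bullet> v = 0"
        by (rule curve_tangent[OF \<gamma>(4) poly3_differentiable[OF poly3_J] \<gamma>(1) conjunct1[OF on], unfolded \<gamma>(3)])
      moreover have "grad ?X p \<bullet> v = 0"
        by (rule curve_tangent[OF \<gamma>(4) poly3_differentiable[OF pX] \<gamma>(1) conjunct2[OF on], unfolded \<gamma>(3)])
      ultimately have "v = ((v \<bullet> w) / (w \<bullet> w)) *\<^sub>R w"
        unfolding w_def by (rule parallel_cross) (rule w0[unfolded w_def])
      then show ?thesis by (rule exI)
    qed
    have T2: "\<exists>c. c \<noteq> 0 \<and> c *\<^sub>R w \<in> ?T"
    proof -
      have N: "open {q. Kf i j q \<bullet> Kf i j q \<noteq> 0}"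
        by (intro open_poly3_nonzero poly3_inner poly3_field_K)
      have pN: "p \<in> {q. Kf i j q \<bullet> Kf i j q \<noteq> 0}" using ij(2) by simp
      obtain \<gamma> e c where \<gamma>: "0 < e" "smooth_on \<gamma> {-e<..<e}" "\<gamma> 0 = p"
        "\<forall>t\<in>{-e<..<e}. \<gamma> t \<in> {q. Kf i j q \<bullet> Kf i j q \<noteq> 0} \<and> J (\<gamma> t) = J p \<and> ?X (\<gamma> t) = ?X p"
        "c \<noteq> 0" "(\<gamma> has_vector_derivative c *\<^sub>R w) (at (0::real))"
        using curve_in_intersection[OF poly3_J pX w0[unfolded w_def] N pN, folded w_def]
        by (elim exE conjE) (rule that)
      have "\<gamma> t \<in> S11 f" if "t \<in> {-e<..<e}" for t
      proof -
        have "J (\<gamma> t) = 0" "Kf i j (\<gamma> t) \<noteq> 0" "?X (\<gamma> t) = 0"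
          using bspec[OF \<gamma>(4) that] p X0[OF ij(1)] by auto
        from this(1) X_fun_zero_all_fields[OF this] show ?thesis by (simp add: S11_eq split_beta)
      qed
      then have "c *\<^sub>R w \<in> ?T"
        unfolding tangent_space_def using \<gamma>(1-3,6) by blast
      then show ?thesis using \<gamma>(5) by blast
    qed
    have lin: "linear ((*v) ?M)" by simp
    have "rank_restr f (S11 f) p = 0 \<longleftrightarrow> (\<forall>v\<in>?T. ?M *v v = 0)"
      unfolding rank_restr_def dim_eq_0 by (simp add: image_subset_iff)
    also have "\<dots> \<longleftrightarrow> ?M *v w = 0"
    proof
      assume "\<forall>v\<in>?T. ?M *v v = 0"
      moreover obtain c where "c \<noteq> 0" "c *\<^sub>R w \<in> ?T" using T2 by blast
      ultimately have "c *\<^sub>R (?M *v w) = 0" by (simp only: linear_scale[OF lin, symmetric])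
      then show "?M *v w = 0" using \<open>c \<noteq> 0\<close> by (simp only: scaleR_eq_0_iff) simp
    next
      assume "?M *v w = 0"
      show "\<forall>v\<in>?T. ?M *v v = 0"
      proof
        fix v assume "v \<in> ?T"
        then obtain c where "v = c *\<^sub>R w" using T1[of v] by blast
        then show "?M *v v = 0" using \<open>?M *v w = 0\<close> by (simp only: linear_scale[OF lin] scaleR_zero_right)
      qed
    qed
    also have "\<dots> \<longleftrightarrow> Y_fun f (Kf i j) p = 0"
    proof
      assume "?M *v w = 0"
      from kernel_parallel[OF this ij(2)] obtain c where c: "w = c *\<^sub>R Kf i j p" by blast
      have "c \<noteq> 0"
      proof
        assume "c = 0"
        then show False using c w0 by simp
      qed
      have "grad ?X p \<bullet> w = 0" unfolding w_def by (rule dot_cross_self(2))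
      then have "c * Y_fun f (Kf i j) p = 0" unfolding c Y_fun_def by simp
      then show "Y_fun f (Kf i j) p = 0" using \<open>c \<noteq> 0\<close> by simp
    next
      assume "Y_fun f (Kf i j) p = 0"
      then have "grad J p \<bullet> Kf i j p = 0" "grad ?X p \<bullet> Kf i j p = 0"
        using X0[OF ij(1)] by (simp_all add: Y_fun_def X_fun_def)
      from parallel_cross[OF this w0[unfolded w_def], folded w_def]
      obtain c where c: "Kf i j p = c *\<^sub>R w" by (rule that)
      have "c \<noteq> 0"
      proof
        assume "c = 0"
        then show False using c ij(2) by simp
      qed
      have "c *\<^sub>R (?M *v w) = ?M *v Kf i j p" unfolding c by (rule linear_scale[OF lin, symmetric])
      then have "c *\<^sub>R (?M *v w) = 0" by (simp only: jacobian_K[OF p])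
      then show "?M *v w = 0" using \<open>c \<noteq> 0\<close> by (simp only: scaleR_eq_0_iff) simp
    qed
    also have "\<dots> \<longleftrightarrow> (\<forall>(i,j)\<in>index_pairs. Y_fun f (Kf i j) p = 0)"
    proof
      assume "Y_fun f (Kf i j) p = 0"
      from Y_fun_zero_all_fields[OF p ij(2) X0[OF ij(1)] this]
      show "\<forall>(i,j)\<in>index_pairs. Y_fun f (Kf i j) p = 0" by (simp add: split_beta)
    qed (use ij(1) in blast)
    finally show ?thesis .
  qed
  then have "S111 f = {p \<in> S11 f. \<forall>(i,j)\<in>index_pairs. Y_fun f (Kf i j) p = 0}"
    unfolding S111_def by blast
  then show ?thesis unfolding S11_eq by auto
qed

lemma poly3_idealI_generators:
  "u \<in> {J} \<union> {X_fun f (Kf i j) | i j. (i, j) \<in> index_pairs} \<union> {Y_fun f (Kf i j) | i j. (i, j) \<in> index_pairs}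
    \<Longrightarrow> poly3 u"
  by (auto intro: poly3_J poly3_X[OF poly3_field_K] poly3_Y[OF poly3_field_K])

lemma S111_eq_zero_set: "S111 f = zero_set (idealI f)"
  unfolding S111_eq idealI_def
  by (rule Set.set_eqI, subst zero_set_genideal[OF poly3_idealI_generators], assumption, unfold ball_Un) auto

lemma poly_ideal_idealI: "poly_ideal (idealI f)"
proof -
  interpret cring poly3_ring by (rule cring_poly3_ring)
  show ?thesis
    unfolding poly_ideal_def idealI_def
    by (rule genideal_ideal) (rule subsetI, simp only: poly3_ring_simps, rule poly3_idealI_generators)
qed

lemma poly3_g_sum: "poly3 (g_sum \<alpha> f)"
proof -
  have "g_sum \<alpha> f = (\<lambda>p. \<alpha> 1 2 * g_fun f (Kf 1 2) p + (\<alpha> 1 3 * g_fun f (Kf 1 3) p + \<alpha> 2 3 * g_fun f (Kf 2 3) p))"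
    by (rule ext) (simp add: g_sum_def index_pairs_def)
  then show ?thesis by (simp add: poly3_intros g_fun_poly(2)[OF poly3_field_K])
qed

text \<open>
  Some term \<open>\<alpha>\<^sub>i\<^sub>j g\<^sub>i\<^sub>j\<close> is nonzero at \<open>p\<close>. All other \<open>g\<^sub>k\<^sub>l(p)\<close>, and the product of \<open>Z\<close> and the determinant for any other
  kernel field, are sixth powers times \<open>g\<^sub>i\<^sub>j(p)\<close>, so there is no cancellation and the sign is that of
  \<open>g\<^sub>i\<^sub>j(p)\<close>.
\<close>

lemma simple_swallowtail_sign:
  assumes p: "p \<in> S111 f" and \<alpha>: "\<forall>(i,j)\<in>index_pairs. 0 \<le> \<alpha> i j" and g: "g_sum \<alpha> f p \<noteq> 0"
  shows "simple_swallowtail f p" "swallowtail_sign f p = sgn (g_sum \<alpha> f p)"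
proof -
  have J0: "J p = 0" and X0: "\<And>i j. (i,j) \<in> index_pairs \<Longrightarrow> X_fun f (Kf i j) p = 0"
    and Y0: "\<And>i j. (i,j) \<in> index_pairs \<Longrightarrow> Y_fun f (Kf i j) p = 0"
    using p by (auto simp: S111_eq)
  have "\<exists>(i,j)\<in>index_pairs. \<alpha> i j * g_fun f (Kf i j) p \<noteq> 0"
  proof (rule ccontr)
    assume "\<not> ?thesis"
    then have "g_sum \<alpha> f p = 0" unfolding g_sum_def by (intro sum.neutral) auto
    with g show False by simp
  qed
  then obtain i j where ij: "(i,j) \<in> index_pairs" and nz: "\<alpha> i j \<noteq> 0" "g_fun f (Kf i j) p \<noteq> 0" by auto
  have K0: "Kf i j p \<noteq> 0"
  proof
    assume "Kf i j p = 0"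
    then have "Z_fun f (Kf i j) p = 0" by (simp add: Z_fun_def)
    then show False using nz(2) by (simp add: g_fun_def)
  qed
  let ?g = "g_fun f (Kf i j) p"
  have "0 < g_sum \<alpha> f p * ?g"
  proof -
    have tm: "0 \<le> \<alpha> a b * g_fun f (Kf a b) p * ?g" if "(a,b) \<in> index_pairs" for a b
    proof -
      obtain l where "g_fun f (Kf a b) p = l ^ 6 * ?g"
        using K_field_change[OF J0 K0, of a b] X0[OF ij] Y0[OF ij] by blast
      then have "\<alpha> a b * g_fun f (Kf a b) p * ?g = \<alpha> a b * (l ^ 6 * ?g\<^sup>2)" by (simp add: power2_eq_square)
      moreover have "0 \<le> \<alpha> a b" using \<alpha> that by auto
      then have "0 \<le> \<alpha> a b * (l ^ 6 * ?g\<^sup>2)" by simp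
      ultimately show ?thesis by (simp only:)
    qed
    have pos: "0 < \<alpha> i j * g_fun f (Kf i j) p * ?g"
      using tm[OF ij] nz by (simp add: less_le)
    have "g_sum \<alpha> f p * ?g = (\<Sum>(a,b)\<in>index_pairs. \<alpha> a b * g_fun f (Kf a b) p * ?g)"
      unfolding g_sum_def sum_distrib_right by (rule sum.cong) auto
    also have "\<dots> > 0"
      by (rule sum_pos2[of _ "(i,j)"]) (use ij tm pos in \<open>auto simp: index_pairs_def\<close>)
    finally show ?thesis .
  qed
  then have sgn_eq: "sgn (g_sum \<alpha> f p) = sgn ?g"
    by (auto simp: zero_less_mult_iff sgn_if)
  define K where "K = some_kernel_field f p"
  have "kernel_field f p (Kf i j)"
    unfolding kernel_field_def
    by (intro conjI K0 exI[of _ UNIV]) (auto simp: smooth_on_poly3_field poly3_field_K S1_eq jacobian_K)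
  then have "kernel_field f p K" unfolding K_def some_kernel_field_def by (rule someI[of "kernel_field f p"])
  then obtain U where U: "open U" "p \<in> U" "smooth_on K U" and Kp: "K p \<noteq> 0"
    and ker: "\<forall>q\<in>U. J q = 0 \<longrightarrow> jacobian f (at q) *v K q = 0"
    unfolding kernel_field_def S1_eq by auto
  obtain l where l: "K p = l *\<^sub>R Kf i j p" "X_fun f K p = 0" "Y_fun f K p = 0"
    "g_fun f K p = l ^ 6 * ?g"
    "grad J p \<bullet> cross3 (grad (X_fun f K) p) (grad (Y_fun f K) p) =
       l ^ 3 * (grad J p \<bullet> cross3 (grad (X_fun f (Kf i j)) p) (grad (Y_fun f (Kf i j)) p))"
  proof -
    obtain l where "K p = l *\<^sub>R Kf i j p" "X_fun f K p = l * X_fun f (Kf i j) p"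
      "X_fun f (Kf i j) p = 0 \<longrightarrow> Y_fun f K p = l\<^sup>2 * Y_fun f (Kf i j) p \<and>
        (\<exists>m. grad (X_fun f K) p = l *\<^sub>R grad (X_fun f (Kf i j)) p + m *\<^sub>R grad J p)"
      "X_fun f (Kf i j) p = 0 \<and> Y_fun f (Kf i j) p = 0 \<longrightarrow> g_fun f K p = l ^ 6 * ?g \<and>
        grad J p \<bullet> cross3 (grad (X_fun f K) p) (grad (Y_fun f K) p) =
        l ^ 3 * (grad J p \<bullet> cross3 (grad (X_fun f (Kf i j)) p) (grad (Y_fun f (Kf i j)) p))"
      using kernel_field_change[OF J0 K0 U ker] by (elim exE conjE) (rule that)
    then show thesis using X0[OF ij] Y0[OF ij] by (intro that[of l]) simp_all
  qed
  have l0: "l \<noteq> 0" using Kp l(1) by auto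
  have "grad J p \<bullet> cross3 (grad (X_fun f (Kf i j)) p) (grad (Y_fun f (Kf i j)) p) \<noteq> 0"
    using nz(2) by (auto simp: g_fun_poly(1)[OF poly3_field_K])
  then have det: "grad J p \<bullet> cross3 (grad (X_fun f K) p) (grad (Y_fun f K) p) \<noteq> 0"
    using l0 by (simp add: l(5))
  have "rank (jacobian f (at p)) = 2" using S1_eq J0 by (auto simp: S1_def)
  then show "simple_swallowtail f p"
    unfolding simple_swallowtail_def Let_def K_def[symmetric]
    using J0 l(2,3) triple_independent[OF det] by blast
  have "swallowtail_sign f p = sgn (g_fun f K p)"
    by (simp add: swallowtail_sign_def Let_def K_def[symmetric] g_fun_def)
  also have "\<dots> = sgn ?g"
  proof -
    have "sgn (l ^ 6) = 1" using l0 by (intro sgn_pos) simp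
    then show ?thesis by (simp only: l(4) sgn_mult mult_1)
  qed
  finally show "swallowtail_sign f p = sgn (g_sum \<alpha> f p)" by (simp add: sgn_eq)
qed

end

lemma swallowtail_mapI:
  assumes "polynomial_function f" "ideal1 f = carrier poly3_ring" "ideal2 f = carrier poly3_ring"
    "ideal3 f = carrier poly3_ring"
  shows "swallowtail_map f"
proof -
  interpret polynomial_map f by unfold_locales (rule assms(1))
  note pX = poly3_X[OF poly3_field_K]
  show ?thesis
  proof
    fix p assume J0: "J p = 0"
    have "\<exists>u\<in>{J} \<union> {partial_deriv k J | k. True}. u p \<noteq> 0"
      by (rule unit_ideal_no_zero[OF _ assms(2)[unfolded ideal1_def]])
        (use poly3_J poly3_partial_deriv in auto)
    then show "grad J p \<noteq> 0" using J0 by (auto simp: grad_def vec_eq_iff)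
    let ?us = "[comp_fun f 1, comp_fun f 2, comp_fun f 3]"
    have "\<exists>u\<in>{J} \<union> minors2 ?us. u p \<noteq> 0"
      by (rule unit_ideal_no_zero[OF _ assms(3)[unfolded ideal2_def]])
        (use poly3_J poly3_comp poly3_minors2[of ?us] in auto)
    then obtain m where "m \<in> minors2 ?us" "m p \<noteq> 0" using J0 by auto
    from minor_nonzero[OF this] obtain r s where rs: "r < s" "s < 3"
      "cross3 (grad (?us ! r) p) (grad (?us ! s) p) \<noteq> 0" by auto
    then consider "r = 0" "s = 1" | "r = 0" "s = 2" | "r = 1" "s = 2" by linarith
    then show "\<exists>(i,j)\<in>index_pairs. Kf i j p \<noteq> 0"
      using rs(3) by cases (auto simp: index_pairs_def K_field_def)
    assume X0: "\<forall>(i,j)\<in>index_pairs. X_fun f (Kf i j) p = 0"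
    let ?vs = "[J, X_fun f (Kf 1 2), X_fun f (Kf 1 3), X_fun f (Kf 2 3)]"
    have "poly3 u" if u: "u \<in> {J, X_fun f (Kf 1 2), X_fun f (Kf 1 3), X_fun f (Kf 2 3)} \<union> minors2 ?vs" for u
      using u
    proof
      assume "u \<in> minors2 ?vs"
      then show ?thesis by (rule poly3_minors2[rotated]) (use poly3_J pX in auto)
    qed (use poly3_J pX in auto)
    then have "\<exists>u\<in>{J, X_fun f (Kf 1 2), X_fun f (Kf 1 3), X_fun f (Kf 2 3)} \<union> minors2 ?vs. u p \<noteq> 0"
      by (rule unit_ideal_no_zero[OF _ assms(4)[unfolded ideal3_def Let_def]])
    then obtain m where "m \<in> minors2 ?vs" "m p \<noteq> 0" using J0 X0 by (auto simp: index_pairs_def)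
    from minor_nonzero[OF this] obtain r s where rs: "r < length ?vs" "s < length ?vs"
      "cross3 (grad (?vs ! r) p) (grad (?vs ! s) p) \<noteq> 0" by (meson less_trans)
    have "?vs ! r \<in> set ?vs" "?vs ! s \<in> set ?vs" using rs(1,2) nth_mem by blast+
    then show "\<exists>u v. u \<in> {J, X_fun f (Kf 1 2), X_fun f (Kf 1 3), X_fun f (Kf 2 3)} \<and>
        v \<in> {J, X_fun f (Kf 1 2), X_fun f (Kf 1 3), X_fun f (Kf 2 3)} \<and> cross3 (grad u p) (grad v p) \<noteq> 0"
      using rs(3) by (intro exI[of _ "?vs ! r"] exI[of _ "?vs ! s"]) simp
  qed
qed

theorem theorem8p5:
  fixes f :: "real^3 \<Rightarrow> real^3" and \<alpha> :: "3 \<Rightarrow> 3 \<Rightarrow> real"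
  assumes "polynomial_function f"
    and "\<forall>(i,j)\<in>index_pairs. 0 \<le> \<alpha> i j" and "\<exists>(i,j)\<in>index_pairs. 0 < \<alpha> i j"
    and "ideal1 f = carrier poly3_ring" and "ideal2 f = carrier poly3_ring"
    and "ideal3 f = carrier poly3_ring"
    and "vectorspace.fin_dim real_ring (algA f)"
  shows "S111 f = zero_set (idealI f) \<and> finite (S111 f) \<and>
    signature (algA f) (Theta f) = int (card (S111 f)) \<and>
    (nondegenerate (algA f) (Psi \<alpha> f) \<longrightarrow>
       (\<forall>p\<in>S111 f. simple_swallowtail f p) \<and>
       real_of_int (signature (algA f) (Psi \<alpha> f)) = (\<Sum>p\<in>S111 f. swallowtail_sign f p) \<and>
       real (card {p \<in> S111 f. swallowtail_sign f p = 1}) =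
         (real_of_int (signature (algA f) (Theta f)) +
          real_of_int (signature (algA f) (Psi \<alpha> f))) / 2 \<and>
       real (card {p \<in> S111 f. swallowtail_sign f p = - 1}) =
         (real_of_int (signature (algA f) (Theta f)) -
          real_of_int (signature (algA f) (Psi \<alpha> f))) / 2)"
proof -
  interpret swallowtail_map f by (rule swallowtail_mapI[OF assms(1,4-6)])
  interpret P: poly_ideal "idealI f" by (rule poly_ideal_idealI)
  let ?V = "S111 f" and ?g = "g_sum \<alpha> f"
  note V = S111_eq_zero_set[symmetric]
  have fd: "P.A.fin_dim" using assms(7) by (simp add: algA_def)
  have Theta: "Theta f h = mult_trace P.A (P.cls (\<lambda>p. 1) \<otimes>\<^bsub>P.A\<^esub> (h \<otimes>\<^bsub>P.A\<^esub> h))"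
    if "h \<in> carrier P.A" for h
  proof -
    obtain u where "poly3 u" "h = P.cls u" using \<open>h \<in> carrier P.A\<close> by (rule P.in_A_cases)
    then show ?thesis by (simp add: Theta_def algA_def P.A_ops poly3_intros)
  qed
  have Psi: "Psi \<alpha> f h = mult_trace P.A (P.cls ?g \<otimes>\<^bsub>P.A\<^esub> (h \<otimes>\<^bsub>P.A\<^esub> h))"
    if "h \<in> carrier P.A" for h
    by (simp add: Psi_def algA_def)
  have one: "poly3 (\<lambda>p. 1)" by (simp add: poly3_intros)
  have fin: "finite ?V"
    using P.signature_trace_form(1)[OF fd one Theta] by (simp add: V)
  have sT: "signature (algA f) (Theta f) = int (card ?V)"
    using P.signature_trace_form(2)[OF fd one Theta] by (simp add: V algA_def)
  have sP: "signature (algA f) (Psi \<alpha> f) = int (card {p\<in>?V. ?g p > 0}) - int (card {p\<in>?V. ?g p < 0})"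
    using P.signature_trace_form(2)[OF fd poly3_g_sum Psi] by (simp add: V algA_def)
  have "(\<forall>p\<in>?V. simple_swallowtail f p) \<and>
       real_of_int (signature (algA f) (Psi \<alpha> f)) = (\<Sum>p\<in>?V. swallowtail_sign f p) \<and>
       real (card {p \<in> ?V. swallowtail_sign f p = 1}) =
         (real_of_int (signature (algA f) (Theta f)) + real_of_int (signature (algA f) (Psi \<alpha> f))) / 2 \<and>
       real (card {p \<in> ?V. swallowtail_sign f p = - 1}) =
         (real_of_int (signature (algA f) (Theta f)) - real_of_int (signature (algA f) (Psi \<alpha> f))) / 2"
    if nd: "nondegenerate (algA f) (Psi \<alpha> f)"
  proof -
    have nz: "?g p \<noteq> 0" if "p \<in> ?V" for p
      using P.signature_trace_form(3)[OF fd poly3_g_sum Psi, of p] nd that by (simp add: V algA_def)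
    have st: "simple_swallowtail f p" "swallowtail_sign f p = sgn (?g p)" if "p \<in> ?V" for p
      using simple_swallowtail_sign[OF that assms(2) nz[OF that]] by auto
    have pos: "{p \<in> ?V. swallowtail_sign f p = 1} = {p\<in>?V. ?g p > 0}"
      and neg: "{p \<in> ?V. swallowtail_sign f p = - 1} = {p\<in>?V. ?g p < 0}"
      using st(2) by (auto simp: sgn_if split: if_splits)
    have un: "?V = {p\<in>?V. ?g p > 0} \<union> {p\<in>?V. ?g p < 0}" using nz by force
    have cV: "card ?V = card {p\<in>?V. ?g p > 0} + card {p\<in>?V. ?g p < 0}"
      by (subst un, rule card_Un_disjoint) (use fin in auto)
    have "(\<Sum>p\<in>?V. swallowtail_sign f p) =
        (\<Sum>p\<in>{p\<in>?V. ?g p > 0}. swallowtail_sign f p) + (\<Sum>p\<in>{p\<in>?V. ?g p < 0}. swallowtail_sign f p)"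
      by (subst (1) un, rule sum.union_disjoint) (use fin in auto)
    also have "\<dots> = real (card {p\<in>?V. ?g p > 0}) - real (card {p\<in>?V. ?g p < 0})"
      using st(2) by simp
    finally have sum: "(\<Sum>p\<in>?V. swallowtail_sign f p) = real_of_int (signature (algA f) (Psi \<alpha> f))"
      by (simp add: sP)
    show ?thesis using st(1) sum sT sP cV by (simp add: pos neg)
  qed
  then show ?thesis using S111_eq_zero_set fin sT by blast
qed

end
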